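(* Let $A$ and $B$ be $C^{*}$-algebras and let $\varphi:A \to B$ be a completely positive contractive order zero map. Then $\varphi$ induces a (well-defined) morphism of ordered semigroups \[ W(\varphi): W(A) \to W(B) \] between the Cuntz semigroups via \[ W(\varphi)(\langle a \rangle) = \langle \varphi^{(k)}(a) \rangle \quad \text{if } a \in M_{k}(A)_{+},\ k\in\mathbb{N}. \]
   Context: Two elements $a,b$ of a $C^{*}$-algebra are orthogonal, written $a \perp b$, if $ab=ba=a^{*}b=ab^{*}=0$. A completely positive map $\varphi:A\to B$ between $C^{*}$-algebras has order zero if, for all $a,b\in A_{+}$, $a\perp b$ implies $\varphi(a)\perp\varphi(b)$. The amplification $\varphi^{(k)}:M_k(A)\to M_k(B)$ applies $\varphi$ entrywise. Cuntz semigroup: let $M_{\infty}(A)_{+}=\bigcup_{k}M_{k}(A)_{+}$, where $M_k(A)$ is embedded in $M_{k+1}(A)$ as the upper left corner. For $a,b\in M_{k}(A)_{+}$ (any two elements of $M_\infty(A)_+$ may be regarded as lying in a common $M_k(A)$), write $a\precsim b$ if there is a sequence $(x_{n})_{n\in\mathbb{N}}\subset M_{k}(A)$ with $a=\lim_{n\to\infty}x_{n}^{*}bx_{n}$, and $a\sim b$ if $a\precsim b$ and $b\precsim a$. $W(A):=M_{\infty}(A)_{+}/\!\sim$, with $\langle a\rangle$ the class of $a$, is an ordered abelian semigroup with addition $\langle a\rangle+\langle b\rangle=\langle a\oplus b\rangle$ (where $a\oplus b=\mathrm{diag}(a,b)$) and order $\langle a\rangle\le\langle b\rangle$ iff $a\precsim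 b$. A morphism of ordered semigroups is an additive, order preserving map. *)

theory Defs
  imports Complex_Main "Jordan_Normal_Form.Matrix"
begin

text \<open>
  Complex C*-algebras, not necessarily unital. Submultiplicativity of the norm and completeness
  come from the superclasses.
\<close>

class cstar_algebra = real_normed_algebra + banach +
  fixes scaleC :: "complex \<Rightarrow> 'a \<Rightarrow> 'a"
    and star :: "'a \<Rightarrow> 'a"
  assumes scaleC_add_right: "scaleC c (x + y) = scaleC c x + scaleC c y"
    and scaleC_add_left: "scaleC (c + d) x = scaleC c x + scaleC d x"
    and scaleC_scaleC: "scaleC c (scaleC d x) = scaleC (c * d) x"
    and scaleR_eq_scaleC: "scaleR r x = scaleC (complex_of_real r) x"
    and mult_scaleC_left: "scaleC c x * y = scaleC c (x * y)"
    and mult_scaleC_right: "x * scaleC c y = scaleC c (x * y)"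
    and norm_scaleC: "norm (scaleC c x) = cmod c * norm x"
    and star_star: "star (star x) = x"
    and star_add: "star (x + y) = star x + star y"
    and star_scaleC: "star (scaleC c x) = scaleC (cnj c) (star x)"
    and star_mult: "star (x * y) = star y * star x"
    and cstar_identity: "norm (star x * x) = (norm x)\<^sup>2"

instantiation complex :: cstar_algebra
begin

definition scaleC_complex :: "complex \<Rightarrow> complex \<Rightarrow> complex"
  where "scaleC_complex = (*)"

definition star_complex :: "complex \<Rightarrow> complex"
  where "star_complex = cnj"

instance
  by standard
    (auto simp: scaleC_complex_def star_complex_def algebra_simps scaleR_conv_of_real
      norm_mult power2_eq_square)

end

definition positive_elements :: "'a::cstar_algebra set"
  where "positive_elements = {a. \<exists>x. a = star x * x}"

definition orthogonal_elements :: "'a::cstar_algebra \<Rightarrow> 'a \<Rightarrow> bool"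
  where "orthogonal_elements a b \<longleftrightarrow>
    a * b = 0 \<and> b * a = 0 \<and> star a * b = 0 \<and> a * star b = 0"

definition mat_star :: "'a::cstar_algebra mat \<Rightarrow> 'a mat"
  where "mat_star a = map_mat star (transpose_mat a)"

definition mat_pos :: "nat \<Rightarrow> 'a::cstar_algebra mat set"
  where "mat_pos k = {a. \<exists>x \<in> carrier_mat k k. a = mat_star x * x}"

text \<open>
  The C*-norm of \<open>M\<^sub>k(A)\<close> is the operator norm of its (faithful, hence isometric) left action on
  the Hilbert \<open>A\<close>-module \<open>A\<^sup>k\<close>, whose inner product is \<open>(\<xi>, \<eta>) \<mapsto> \<Sum>\<^sub>i \<xi>\<^sub>i\<^sup>* \<eta>\<^sub>i\<close>.
\<close>

definition column_norm :: "'a::cstar_algebra vec \<Rightarrow> real"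
  where "column_norm \<xi> = sqrt (norm (\<Sum>i<dim_vec \<xi>. star (vec_index \<xi> i) * vec_index \<xi> i))"

definition mat_norm :: "'a::cstar_algebra mat \<Rightarrow> real"
  where "mat_norm a =
    (SUP \<xi> \<in> {\<xi> \<in> carrier_vec (dim_col a). column_norm \<xi> \<le> 1}. column_norm (mult_mat_vec a \<xi>))"

definition mat_oplus :: "'a::cstar_algebra mat \<Rightarrow> 'a mat \<Rightarrow> 'a mat"
  where "mat_oplus a b =
    four_block_mat a (0\<^sub>m (dim_row a) (dim_col b)) (0\<^sub>m (dim_row b) (dim_col a)) b"

text \<open>The upper left corner embedding of \<open>M\<^sub>k(A)\<close> into \<open>M\<^sub>n(A)\<close>, for \<open>k \<le> n\<close>.\<close>

definition mat_pad :: "nat \<Rightarrow> 'a::cstar_algebra mat \<Rightarrow> 'a mat"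
  where "mat_pad n a = mat_oplus a (0\<^sub>m (n - dim_row a) (n - dim_col a))"

text \<open>The amplification of \<open>\<phi>\<close> to \<open>k \<times> k\<close> matrices is \<open>map_mat \<phi>\<close>, for every \<open>k\<close>.\<close>

definition completely_positive :: "('a::cstar_algebra \<Rightarrow> 'b::cstar_algebra) \<Rightarrow> bool"
  where "completely_positive \<phi> \<longleftrightarrow>
    Vector_Spaces.linear scaleC scaleC \<phi> \<and>
    (\<forall>k\<ge>1. \<forall>a \<in> mat_pos k. map_mat \<phi> a \<in> mat_pos k)"

definition contractive :: "('a::cstar_algebra \<Rightarrow> 'b::cstar_algebra) \<Rightarrow> bool"
  where "contractive \<phi> \<longleftrightarrow> (\<forall>a. norm (\<phi> a) \<le> norm a)"

definition order_zero :: "('a::cstar_algebra \<Rightarrow> 'b::cstar_algebra) \<Rightarrow> bool"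
  where "order_zero \<phi> \<longleftrightarrow>
    (\<forall>a \<in> positive_elements. \<forall>b \<in> positive_elements.
      orthogonal_elements a b \<longrightarrow> orthogonal_elements (\<phi> a) (\<phi> b))"

text \<open>
  Positive square matrices of all sizes. A matrix is not identified with its corner embeddings
  here; Cuntz comparison embeds both arguments into a common matrix algebra first, so the
  identification is absorbed by Cuntz equivalence.
\<close>

definition mat_inf_pos :: "'a::cstar_algebra mat set"
  where "mat_inf_pos = (\<Union>k\<in>{1..}. mat_pos k)"

definition cuntz_below :: "'a::cstar_algebra mat \<Rightarrow> 'a mat \<Rightarrow> bool"
  where "cuntz_below a b \<longleftrightarrow>
    (let k = max (dim_row a) (dim_row b); a' = mat_pad k a; b' = mat_pad k b in
      \<exists>x :: nat \<Rightarrow> 'a mat. (\<forall>n. x n \<in> carrier_mat k k) \<and>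
        (\<lambda>n. mat_norm (mat_star (x n) * b' * x n - a')) \<longlonglongrightarrow> 0)"

definition cuntz_rel :: "('a::cstar_algebra mat \<times> 'a mat) set"
  where "cuntz_rel = {(a, b). a \<in> mat_inf_pos \<and> b \<in> mat_inf_pos \<and>
    cuntz_below a b \<and> cuntz_below b a}"

typedef (overloaded) 'a cuntz = "(mat_inf_pos :: 'a::cstar_algebra mat set) // cuntz_rel"
proof -
  have "mat_star (0\<^sub>m 1 1) * 0\<^sub>m 1 1 \<in> (mat_inf_pos :: 'a mat set)"
    unfolding mat_inf_pos_def mat_pos_def by force
  then show ?thesis
    by (blast intro: quotientI)
qed

text \<open>\<open>cuntz_class a\<close> is only meaningful for \<open>a \<in> mat_inf_pos\<close>.\<close>

definition cuntz_class :: "'a::cstar_algebra mat \<Rightarrow> 'a cuntz"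
  where "cuntz_class a = Abs_cuntz (cuntz_rel `` {a})"

instantiation cuntz :: (cstar_algebra) "{plus, ord}"
begin

definition plus_cuntz :: "'a cuntz \<Rightarrow> 'a cuntz \<Rightarrow> 'a cuntz"
  where "x + y = (THE z. \<exists>a \<in> mat_inf_pos. \<exists>b \<in> mat_inf_pos.
    x = cuntz_class a \<and> y = cuntz_class b \<and> z = cuntz_class (mat_oplus a b))"

definition less_eq_cuntz :: "'a cuntz \<Rightarrow> 'a cuntz \<Rightarrow> bool"
  where "x \<le> y \<longleftrightarrow> (\<exists>a \<in> mat_inf_pos. \<exists>b \<in> mat_inf_pos.
    x = cuntz_class a \<and> y = cuntz_class b \<and> cuntz_below a b)"

definition less_cuntz :: "'a cuntz \<Rightarrow> 'a cuntz \<Rightarrow> bool"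
  where "less_cuntz x y \<longleftrightarrow> x \<le> y \<and> \<not> y \<le> x"

instance ..

end

definition ordered_semigroup_morphism :: "('s::{plus, ord} \<Rightarrow> 't::{plus, ord}) \<Rightarrow> bool"
  where "ordered_semigroup_morphism f \<longleftrightarrow>
    (\<forall>x y. f (x + y) = f x + f y) \<and> (\<forall>x y. x \<le> y \<longrightarrow> f x \<le> f y)"

end

theory Submission
  imports Defs "HOL-Analysis.Operator_Norm" "HOL-Library.Function_Algebras"
begin

text \<open>
  The heart of the matter is the relation \<open>\<phi>(xa) \<phi>(y) = \<phi>(x) \<phi>(ay)\<close>, which replaces the structure
  theorem \<open>\<phi> = h\<pi>\<close> for order zero maps. By 2-positivity, \<open>xy = 0\<close> implies \<open>\<phi>(x) \<phi>(y) = 0\<close>, so in the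
  unitization the bilinear maps \<open>W(f, g) = \<phi>(xf) \<phi>(gy)\<close> vanish whenever \<open>fg = 0\<close>. Telescoping over the
  positive parts \<open>(c - \<lambda>)\<^sub>+\<close> yields \<open>W(c\<^sup>2, 1) + W(1, c\<^sup>2) = 2 W(c, c)\<close>. Hence for unitary \<open>u\<close> the sequence
  \<open>\<phi>(xu\<^sup>n) \<phi>(u\<^sup>-\<^sup>n y)\<close> is affine in \<open>n\<close>; being bounded it is constant.

  The relation passes to the amplifications and gives \<open>\<phi>(xc)\<^sup>* \<phi>(b) \<phi>(xc) = \<phi>(c)\<^sup>3\<close> for \<open>c = x\<^sup>*bx\<close>.
  Since a self-adjoint \<open>t\<close> satisfies \<open>t \<precsim> t\<^sup>3\<close>, it follows that \<open>\<phi>(x\<^sup>*bx) \<precsim> \<phi>(b)\<close>.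
\<close>

section \<open>C*-algebras\<close>

text \<open>In the picture \<phi> = h\<pi> with h commuting with the range of \<pi>, both sides of
  the product relation are h^2 \<pi>(xay). For c = \<open>star x * b * x\<close> the naive candidate
  \<open>star (\<phi> x) * \<phi> b * \<phi> x\<close> would be h^3 \<pi>(c), that is h^2 \<phi>(c),
  and h need not lie in the target algebra. The extra factor c in \<phi>(xc) turns this into h^3
  \<pi>(c^3), which is \<phi>(c)^3 and makes sense without h; this is where the cube comes from.

  Two obstacles shape the rest. The algebras may lack a unit, whereas unitaries and the map W need
  one: \<phi> is never extended to the unitization, only applied to products x f and f y, which stay
  in the ideal. Functional calculus is avoided: positivity is a norm inequality, roots come from an
  iteration, positive parts from absolute values. Estimates therefore carry constants such as 2,
  harmless because they only serve limits and vanishing arguments. Contractivity provides the bound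
  that makes the affine sequence constant.\<close>

lemma star_zero [simp]: "star (0::'a::cstar_algebra) = 0"
  using star_add[of "0::'a" 0] by simp

lemma star_minus [simp]: "star (- x) = - star (x::'a::cstar_algebra)"
  using star_add[of x "- x"] by (simp add: eq_neg_iff_add_eq_0 add.commute)

lemma star_diff: "star (x - y) = star x - star (y::'a::cstar_algebra)"
  using star_add[of x "- y"] by simp

lemma star_scaleR: "star (scaleR r x) = scaleR r (star (x::'a::cstar_algebra))"
  by (simp add: scaleR_eq_scaleC star_scaleC)

lemma star_sum: "star (\<Sum>i\<in>I. f i) = (\<Sum>i\<in>I. star (f i :: 'a::cstar_algebra))"
  by (induction I rule: infinite_finite_induct) (simp_all add: star_add)

lemma scaleC_one [simp]: "scaleC 1 x = (x::'a::cstar_algebra)"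
  using scaleR_eq_scaleC[of 1 x] by simp

lemma scaleC_zero_left [simp]: "scaleC 0 x = (0::'a::cstar_algebra)"
  using scaleR_eq_scaleC[of 0 x] by simp

lemma scaleC_zero_right [simp]: "scaleC c (0::'a::cstar_algebra) = 0"
  using scaleC_add_right[of c "0::'a" 0] by simp

lemma scaleC_minus_left: "scaleC (- c) x = - scaleC c (x::'a::cstar_algebra)"
  using scaleC_add_left[of c "- c" x] by (simp add: eq_neg_iff_add_eq_0 add.commute)

lemma scaleC_minus_right: "scaleC c (- x) = - scaleC c (x::'a::cstar_algebra)"
  using scaleC_add_right[of c x "- x"] by (simp add: eq_neg_iff_add_eq_0 add.commute)

lemma scaleC_diff_right: "scaleC c (x - y) = scaleC c x - scaleC c (y::'a::cstar_algebra)"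
  using scaleC_add_right[of c x "- y"] by (simp add: scaleC_minus_right)

lemma scaleC_of_real: "scaleC (complex_of_real r) x = scaleR r (x::'a::cstar_algebra)"
  by (simp add: scaleR_eq_scaleC)

lemma scaleC_scaleR: "scaleC c (scaleR r x) = scaleR r (scaleC c (x::'a::cstar_algebra))"
  by (simp add: scaleR_eq_scaleC scaleC_scaleC mult.commute)

lemma norm_star [simp]: "norm (star x) = norm (x::'a::cstar_algebra)"
proof -
  have le: "norm y \<le> norm (star y)" for y :: 'a
  proof (cases "norm y = 0")
    case False
    have "(norm y)\<^sup>2 \<le> norm (star y) * norm y"
      using cstar_identity[of y] norm_mult_ineq[of "star y" y] by simp
    then show ?thesis
      using False by (simp add: power2_eq_square)
  qed simp
  show ?thesis
    using le[of x] le[of "star x"] by (simp add: star_star)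
qed

lemma star_mult_self_eq_0_iff: "star x * x = 0 \<longleftrightarrow> x = (0::'a::cstar_algebra)"
  by (metis cstar_identity norm_eq_zero mult_zero_right power_eq_0_iff)

lemma norm_power2_selfadjoint: "star c = c \<Longrightarrow> norm (c * c) = (norm (c::'a::cstar_algebra))\<^sup>2"
  using cstar_identity[of c] by simp

lemma square_selfadjoint_eq_0_iff: "star c = c \<Longrightarrow> c * c = 0 \<longleftrightarrow> (c::'a::cstar_algebra) = 0"
  using star_mult_self_eq_0_iff[of c] by simp

lemma bounded_linear_star: "bounded_linear (star :: 'a::cstar_algebra \<Rightarrow> 'a)"
  by (rule bounded_linear_intro[where K = 1]) (simp_all add: star_add star_scaleR)

lemma bounded_linear_scaleC: "bounded_linear (scaleC c :: 'a::cstar_algebra \<Rightarrow> 'a)"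
  by (rule bounded_linear_intro[where K = "cmod c"])
    (simp_all add: scaleC_add_right scaleC_scaleR norm_scaleC)

text \<open>\<open>Y = 1 - \<surd>(1 - T)\<close>; the iteration for \<open>T\<close> is majorized by the scalar iteration for \<open>1\<close>,
  which is increasing and bounded.\<close>

lemma sqrt_iteration:
  fixes T :: "'a::cstar_algebra"
  assumes T: "norm T \<le> 1"
  obtains Y where "Y + Y = T + Y * Y" "norm Y \<le> 1"
    "\<forall>z. z * T = T * z \<longrightarrow> z * Y = Y * z" "star T = T \<longrightarrow> star Y = Y"
proof -
  define y :: "nat \<Rightarrow> 'a" where "y = rec_nat 0 (\<lambda>_ v. scaleR (1/2) (T + v * v))"
  define r :: "nat \<Rightarrow> real" where "r = rec_nat 0 (\<lambda>_ v. (1 + v * v) / 2)"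
  have y0: "y 0 = 0" and yS: "\<And>n. y (Suc n) = scaleR (1/2) (T + y n * y n)"
    by (simp_all add: y_def)
  have r0: "r 0 = 0" and rS: "\<And>n. r (Suc n) = (1 + r n * r n) / 2"
    by (simp_all add: r_def)
  have r_bounds: "0 \<le> r n \<and> r n \<le> 1" for n
  proof (induction n)
    case (Suc n)
    then have "r n * r n \<le> 1" by (meson mult_le_one)
    then show ?case by (simp add: rS)
  qed (simp add: r0)
  have r_mono: "r n \<le> r (Suc n)" for n
    using sum_squares_bound[of 1 "r n"] by (simp add: rS power2_eq_square)
  have y_le: "norm (y n) \<le> r n" for n
  proof (induction n)
    case (Suc n)
    have "norm (T + y n * y n) \<le> 1 + r n * r n"
      using norm_triangle_ineq[of T "y n * y n"] T norm_mult_ineq[of "y n" "y n"]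
        mult_mono'[OF Suc Suc] by fastforce
    then show ?case by (simp add: yS rS)
  qed (simp add: y0 r0)
  have step: "norm (y (Suc n) - y n) \<le> r (Suc n) - r n" for n
  proof (induction n)
    case (Suc n)
    let ?d = "y (Suc n) - y n" and ?e = "r (Suc n) - r n"
    have "y (Suc (Suc n)) - y (Suc n) = scaleR (1/2) (y (Suc n) * ?d + ?d * y n)"
      by (simp only: yS[of "Suc n"] yS[of n] scaleR_diff_right[symmetric]) (simp add: algebra_simps)
    moreover have "norm (y (Suc n) * ?d + ?d * y n) \<le> r (Suc n) * ?e + ?e * r n"
      by (intro norm_triangle_le add_mono order.trans[OF norm_mult_ineq] mult_mono y_le Suc.IH)
        (use r_bounds r_mono in auto)
    ultimately have "norm (y (Suc (Suc n)) - y (Suc n)) \<le> (r (Suc n) * ?e + ?e * r n) / 2"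
      by simp
    also have "\<dots> = r (Suc (Suc n)) - r (Suc n)"
      by (simp only: rS[of "Suc n"] rS[of n]) (simp add: field_simps)
    finally show ?case .
  qed (use T in \<open>simp add: y0 r0 yS rS\<close>)
  have "incseq r"
    using r_mono by (rule incseq_SucI)
  then obtain l where "r \<longlonglongrightarrow> l"
    by (rule incseq_convergent) (use r_bounds in auto)
  then have "summable (\<lambda>n. r (Suc n) - r n)"
    by (rule telescope_summable)
  then have "summable (\<lambda>n. y (Suc n) - y n)"
    by (rule summable_comparison_test'[where N = 0]) (rule step)
  then obtain s where s: "(\<lambda>n. y (Suc n) - y n) sums s"
    by (auto simp: summable_def)
  have lim: "y \<longlonglongrightarrow> s"
    using s unfolding sums_def sum_lessThan_telescope by (simp add: y0)
  show ?thesis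
  proof
    have "(\<lambda>n. y (Suc n)) \<longlonglongrightarrow> scaleR (1/2) (T + s * s)"
      unfolding yS by (intro tendsto_intros lim)
    then have "s = scaleR (1/2) (T + s * s)"
      using lim LIMSEQ_Suc LIMSEQ_unique by blast
    then have "scaleR 2 s = T + s * s"
      by (metis scaleR_half_double scaleR_2 scaleR_add_right)
    then show "s + s = T + s * s"
      by (simp add: scaleR_2)
    show "norm s \<le> 1"
      using tendsto_norm[OF lim] by (rule LIMSEQ_le_const2) (meson order.trans y_le r_bounds)
    show "\<forall>z. z * T = T * z \<longrightarrow> z * s = s * z"
    proof (intro allI impI)
      fix z
      assume z: "z * T = T * z"
      have "z * y n = y n * z" for n
      proof (induction n)
        case (Suc n)
        then have "z * (y n * y n) = y n * y n * z"
          by (metis mult.assoc)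
        then show ?case
          by (simp add: yS z distrib_left distrib_right)
      qed (simp add: y0)
      then have "(\<lambda>n. z * y n) \<longlonglongrightarrow> s * z"
        by (simp add: tendsto_mult_right lim)
      then show "z * s = s * z"
        using LIMSEQ_unique tendsto_mult_left[OF lim] by blast
    qed
    show "star T = T \<longrightarrow> star s = s"
    proof
      assume "star T = T"
      have "star (y n) = y n" for n
        by (induction n) (simp_all add: y0 yS star_add star_scaleR star_mult \<open>star T = T\<close>)
      then show "star s = s"
        using bounded_linear.tendsto[OF bounded_linear_star lim] lim LIMSEQ_unique by auto
    qed
  qed
qed

section \<open>Positivity in unital C*-algebras\<close>

class unital_cstar_algebra = cstar_algebra + real_normed_algebra_1

lemma star_one [simp]: "star (1::'a::unital_cstar_algebra) = 1"
  by (metis mult.right_neutral star_mult star_star)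

lemma star_power: "star (x ^ n) = star (x::'a::unital_cstar_algebra) ^ n"
  by (induction n) (simp_all add: star_mult power_commutes)

lemma star_of_real [simp]: "star (of_real r) = (of_real r :: 'a::unital_cstar_algebra)"
  by (simp add: of_real_def star_scaleR)

lemma norm_unitary:
  assumes "star u * u = (1::'a::unital_cstar_algebra)"
  shows "norm u = 1"
  using cstar_identity[of u] assms by (simp add: power2_eq_1_iff) (use norm_ge_zero[of u] in linarith)

text \<open>The unitary is sqrt(1 - c^2) + i c. The root \<open>1 - Y\<close> comes from the
  iteration for T = c^2 and commutes with c, so \<open>star u * u\<close> and
  \<open>u * star u\<close> both reduce to (1 - c^2) + c^2. The clause on the real part of u records
  the root for \<open>norm_one_minus_square\<close>.\<close>

lemma selfadjoint_unitary_decomposition: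
  fixes c :: "'a::unital_cstar_algebra"
  assumes sa: "star c = c" and norm_c: "norm c \<le> 1"
  obtains u where "star u * u = 1" "u * star u = 1"
    "c = scaleC (- \<i> / 2) (u - star u)" "((1/2) *\<^sub>R (u + star u)) * ((1/2) *\<^sub>R (u + star u)) = 1 - c * c"
proof -
  have "norm (c * c) \<le> 1"
    using norm_mult_ineq[of c c] mult_le_one[OF norm_c norm_ge_zero norm_c] by linarith
  then obtain Y where Y: "Y + Y = c * c + Y * Y" "\<forall>z. z * (c * c) = c * c * z \<longrightarrow> z * Y = Y * z"
    and "star (c * c) = c * c \<longrightarrow> star Y = Y"
    by (rule sqrt_iteration)
  then have saY: "star Y = Y" and comm: "c * Y = Y * c"
    by (simp_all add: star_mult sa mult.assoc)
  define u where "u = (1 - Y) + scaleC \<i> c"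
  have star_u: "star u = (1 - Y) - scaleC \<i> c"
    by (simp add: u_def star_add star_diff star_scaleC saY sa scaleC_minus_left)
  have sq: "(1 - Y) * (1 - Y) = 1 - c * c"
    using Y(1) by (simp add: algebra_simps)
  have ii: "scaleC \<i> c * scaleC \<i> c = - (c * c)"
    by (simp add: mult_scaleC_left mult_scaleC_right scaleC_scaleC scaleC_minus_left)
  have comm': "(1 - Y) * scaleC \<i> c = scaleC \<i> c * (1 - Y)"
    by (simp add: mult_scaleC_left mult_scaleC_right left_diff_distrib right_diff_distrib
        scaleC_diff_right comm)
  show ?thesis
  proof
    show "star u * u = 1"
      unfolding star_u unfolding u_def
      using sq ii comm' by (simp add: distrib_left left_diff_distrib)
    show "u * star u = 1"
      unfolding star_u unfolding u_def
      using sq ii comm' by (simp add: right_diff_distrib distrib_right)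
    have "u - star u = scaleC (2 * \<i>) c"
      unfolding star_u unfolding u_def
      by (simp add: scaleC_add_left[symmetric])
    then show "c = scaleC (- \<i> / 2) (u - star u)"
      by (simp add: scaleC_scaleC)
    have "(1/2) *\<^sub>R (u + star u) = 1 - Y"
      unfolding star_u unfolding u_def
      by (simp add: scaleR_add_right[symmetric])
    then show "((1/2) *\<^sub>R (u + star u)) * ((1/2) *\<^sub>R (u + star u)) = 1 - c * c"
      using sq by simp
  qed
qed

text \<open>A spectral bound without spectra: 1 - c^2 is the square of the real part of a unitary,
  and the mean of two elements of norm one has norm at most one. Positivity of squares rests on
  this.\<close>

lemma norm_one_minus_square:
  fixes c :: "'a::unital_cstar_algebra"
  assumes "star c = c" "norm c \<le> 1"
  shows "norm (1 - c * c) \<le> 1"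
proof -
  obtain u where u: "star u * u = 1"
    and sq: "((1/2) *\<^sub>R (u + star u)) * ((1/2) *\<^sub>R (u + star u)) = 1 - c * c"
    using selfadjoint_unitary_decomposition[OF assms] by blast
  have "norm (u + star u) \<le> 2"
    using norm_triangle_ineq[of u "star u"] norm_unitary[OF u] by simp
  then have *: "norm ((1/2) *\<^sub>R (u + star u)) \<le> 1"
    by simp
  show ?thesis
    unfolding sq[symmetric]
    by (rule order.trans[OF norm_mult_ineq]) (rule mult_le_one[OF * norm_ge_zero *])
qed

text \<open>Equivalent to \<open>p\<close> being self-adjoint with spectrum in \<open>[0, \<infinity>)\<close>.\<close>

definition pos :: "'a::unital_cstar_algebra \<Rightarrow> bool"
  where "pos p \<longleftrightarrow> star p = p \<and> (\<exists>t>0. norm (of_real t - p) \<le> t)"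

lemma pos_selfadjoint: "pos p \<Longrightarrow> star p = p"
  by (simp add: pos_def)

lemma posI:
  assumes "star p = p" "norm (of_real t - p) \<le> t"
  shows "pos p"
proof -
  \<comment> \<open>Enlarging the radius by 1 admits t = 0 here, although \<open>pos\<close> insists
    on t > 0 so that one may divide by it.\<close>
  have "norm (of_real (t + 1) - p) \<le> t + 1"
    using norm_triangle_ineq[of "of_real t - p" 1] assms(2) by (simp add: algebra_simps)
  moreover have "t \<ge> 0"
    using assms(2) norm_ge_zero order.trans by blast
  ultimately show ?thesis
    unfolding pos_def using assms(1) by (intro conjI exI[of _ "t + 1"]) auto
qed

lemma pos_zero [simp]: "pos 0"
  by (rule posI[of _ 0]) simp_all

lemma pos_add:
  assumes "pos p" "pos q"
  shows "pos (p + q)"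
proof -
  obtain s t where st: "norm (of_real s - p) \<le> s" "norm (of_real t - q) \<le> t"
    using assms by (auto simp: pos_def)
  show ?thesis
  proof (rule posI)
    show "star (p + q) = p + q"
      using assms by (simp add: star_add pos_selfadjoint)
    have eq: "of_real (s + t) - (p + q) = (of_real s - p) + (of_real t - q)"
      by simp
    show "norm (of_real (s + t) - (p + q)) \<le> s + t"
      unfolding eq by (rule norm_triangle_mono[OF st])
  qed
qed

lemma pos_scaleR:
  assumes "pos p" "r \<ge> 0"
  shows "pos (r *\<^sub>R p)"
proof -
  obtain s where s: "norm (of_real s - p) \<le> s"
    using assms by (auto simp: pos_def)
  have "of_real (r * s) - r *\<^sub>R p = r *\<^sub>R (of_real s - p)"
    by (simp add: of_real_def scaleR_diff_right)
  then have "norm (of_real (r * s) - r *\<^sub>R p) \<le> r * s"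
    using s assms(2) by (simp add: mult_left_mono)
  with _ show ?thesis
    by (rule posI) (simp add: star_scaleR pos_selfadjoint assms(1))
qed

lemma pos_norm_minus: "star x = x \<Longrightarrow> pos (of_real (norm x) - x)"
  by (rule posI[of _ "norm x"]) (simp_all add: star_diff)

lemma pos_of_real: "r \<ge> 0 \<Longrightarrow> pos (of_real r :: 'a::unital_cstar_algebra)"
  by (rule posI[of _ r]) simp_all

lemma norm_minus_square_le:
  fixes c :: "'a::unital_cstar_algebra"
  assumes sa: "star c = c" and t: "norm (c * c) \<le> t"
  shows "norm (of_real t - c * c) \<le> t"
proof (cases "t = 0")
  case True
  then show ?thesis
    using t by simp
next
  case False
  with t have "t > 0"
    using norm_ge_zero[of "c * c"] by linarith
  let ?d = "(1 / sqrt t) *\<^sub>R c"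
  have "(norm c)\<^sup>2 \<le> t"
    using t norm_power2_selfadjoint[OF sa] by simp
  then have "norm c \<le> sqrt t"
    by (rule real_le_rsqrt)
  then have "norm ?d \<le> 1"
    using \<open>t > 0\<close> by simp
  then have "norm (1 - ?d * ?d) \<le> 1"
    by (intro norm_one_minus_square) (simp_all add: star_scaleR sa)
  moreover have "?d * ?d = (1 / t) *\<^sub>R (c * c)"
    using \<open>t > 0\<close> by (simp add: real_sqrt_mult_self)
  moreover have "of_real t - c * c = t *\<^sub>R (1 - (1 / t) *\<^sub>R (c * c))"
    using \<open>t > 0\<close> by (simp add: scaleR_diff_right of_real_def)
  ultimately show ?thesis
    using \<open>t > 0\<close> by simp
qed

lemma pos_square: "star c = c \<Longrightarrow> pos (c * c)"
  using norm_minus_square_le[of c "norm (c * c)"] by (intro posI) (auto simp: star_mult)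

text \<open>Rescaling by the radius t puts 1 - p/t into the unit ball, the iteration extracts the
  root of its complement, and sqrt t undoes the scaling. The commutation clause takes over the role
  of functional calculus.\<close>

lemma pos_sqrt:
  fixes p :: "'a::unital_cstar_algebra"
  assumes "pos p"
  obtains r where "pos r" "r * r = p" "\<forall>z. z * p = p * z \<longrightarrow> z * r = r * z"
proof -
  obtain t where "t > 0" and t: "norm (of_real t - p) \<le> t" and sa: "star p = p"
    using assms by (auto simp: pos_def)
  let ?T = "1 - (1 / t) *\<^sub>R p"
  have T: "?T = (1 / t) *\<^sub>R (of_real t - p)"
    using \<open>t > 0\<close> by (simp add: scaleR_diff_right of_real_def)
  have "norm ?T \<le> 1"
    unfolding T norm_scaleR using t \<open>t > 0\<close> by (simp add: divide_le_eq)
  then obtain Y where Y: "Y + Y = ?T + Y * Y" "norm Y \<le> 1" "\<forall>z. z * ?T = ?T * z \<longrightarrow> z * Y = Y * z"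
    and saT: "star ?T = ?T \<longrightarrow> star Y = Y"
    by (rule sqrt_iteration)
  have saY: "star Y = Y"
    by (rule saT[rule_format]) (simp add: star_diff star_scaleR sa)
  let ?r = "sqrt t *\<^sub>R (1 - Y)"
  show ?thesis
  proof
    have "pos (1 - Y)"
      by (rule posI[of _ 1]) (simp_all add: star_diff saY Y(2))
    then show "pos ?r"
      using \<open>t > 0\<close> by (intro pos_scaleR) auto
    have "(1 - Y) * (1 - Y) = (1 / t) *\<^sub>R p"
      using Y(1) by (simp add: algebra_simps)
    then show "?r * ?r = p"
      using \<open>t > 0\<close> by (simp add: real_sqrt_mult_self)
    show "\<forall>z. z * p = p * z \<longrightarrow> z * ?r = ?r * z"
    proof (intro allI impI)
      fix z
      assume "z * p = p * z"
      then have "z * Y = Y * z"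
        by (intro Y(3)[rule_format]) (simp add: right_diff_distrib left_diff_distrib)
      then show "z * ?r = ?r * z"
        by (simp add: right_diff_distrib left_diff_distrib)
    qed
  qed
qed

text \<open>The definition of \<open>pos\<close> grants one radius. Passing through a square root
  upgrades it to every radius t \<ge> norm p, which is what quantitative estimates need.\<close>

lemma pos_norm_bound:
  assumes "pos p" "norm p \<le> t"
  shows "norm (of_real t - p) \<le> t"
proof -
  obtain r where "pos r" "r * r = p"
    by (rule pos_sqrt[OF assms(1)])
  then show ?thesis
    using norm_minus_square_le[of r t] assms(2) pos_selfadjoint by auto
qed

text \<open>The sharp constant is \<open>1\<close>; the proof rests on \<open>4Np = (N + p)\<^sup>2 - (N - p)\<^sup>2\<close>.\<close>

lemma pos_norm_mono:
  fixes p q :: "'a::unital_cstar_algebra"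
  assumes p: "pos p" and q: "pos q"
  shows "norm p \<le> 2 * norm (p + q)"
proof (rule ccontr)
  assume contra: "\<not> ?thesis"
  define N where "N = norm p"
  define r where "r = norm (p + q)"
  have "pos (of_real r - (p + q))"
    unfolding r_def using p q by (intro pos_norm_minus) (simp add: star_add pos_selfadjoint)
  from pos_add[OF this q] have "pos (of_real r - p)"
    by simp
  moreover have "norm (of_real r - p) \<le> N + r"
    unfolding N_def using norm_triangle_ineq4[of "of_real r" p] by (simp add: r_def)
  ultimately have "norm (of_real (N + r) - (of_real r - p)) \<le> N + r"
    by (rule pos_norm_bound)
  then have plus: "norm (of_real N + p) \<le> N + r"
    by (simp add: algebra_simps)
  have minus: "norm (of_real N - p) \<le> N"
    using pos_norm_bound[OF p, of N] by (simp add: N_def)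
  have "(4 * N) *\<^sub>R p = (of_real N + p) * (of_real N + p) - (of_real N - p) * (of_real N - p)"
    by (simp add: algebra_simps of_real_def scaleR_add_left[symmetric])
  then have "norm ((4 * N) *\<^sub>R p)
      \<le> norm ((of_real N + p) * (of_real N + p)) + norm ((of_real N - p) * (of_real N - p))"
    by (metis norm_triangle_ineq4)
  also have "\<dots> \<le> (N + r) * (N + r) + N * N"
    using order.trans[OF norm_ge_zero plus] order.trans[OF norm_ge_zero minus]
    by (intro add_mono order.trans[OF norm_mult_ineq] mult_mono plus minus) auto
  finally have "4 * (N * N) \<le> (N + r) * (N + r) + N * N"
    by (simp add: N_def mult.assoc)
  \<comment> \<open>For r < N/2 the right side is below (9/4 + 1) N^2 < 4 N^2; this is where the
    factor 2 of the statement enters.\<close>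
  moreover have "0 \<le> r" "2 * r < N"
    using contra by (auto simp: N_def r_def)
  then have "(N + r) * (N + r) < (3 / 2 * N) * (3 / 2 * N)"
    by (intro mult_strict_mono) auto
  moreover have "N * N > 0"
    using \<open>0 \<le> r\<close> \<open>2 * r < N\<close> by auto
  ultimately show False
    by simp
qed

lemma pos_antisym: "pos p \<Longrightarrow> pos (- p) \<Longrightarrow> p = (0::'a::unital_cstar_algebra)"
  using pos_norm_mono[of p "- p"] by simp

lemma pos_add_eq_0:
  assumes "pos p" "pos q" "p + q = (0::'a::unital_cstar_algebra)"
  shows "p = 0"
  using pos_norm_mono[OF assms(1,2)] assms(3) by simp

lemma pos_mult_commute:
  fixes p q :: "'a::unital_cstar_algebra"
  assumes "pos p" "pos q" "p * q = q * p"
  shows "pos (p * q)"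
proof -
  obtain r where r: "pos r" "r * r = p" "\<forall>z. z * p = p * z \<longrightarrow> z * r = r * z"
    by (rule pos_sqrt[OF assms(1)])
  obtain s where s: "pos s" "s * s = q" "\<forall>z. z * q = q * z \<longrightarrow> z * s = s * z"
    by (rule pos_sqrt[OF assms(2)])
  have "r * s = s * r"
    using s(3)[rule_format, of r] r(3)[rule_format, of q] assms(3) by simp
  then have "p * q = (r * s) * (r * s)"
    unfolding r(2)[symmetric] s(2)[symmetric] by (metis mult.assoc)
  moreover have "star (r * s) = r * s"
    using \<open>r * s = s * r\<close> r(1) s(1) by (simp add: star_mult pos_selfadjoint)
  ultimately show ?thesis
    using pos_square[of "r * s"] by simp
qed

text \<open>If \<open>\<parallel>x\<^bsup>m\<^esup>\<parallel>\<close> grows at most like \<open>m t\<^bsup>m\<^esup>\<close> then \<open>\<parallel>x\<parallel> \<le> t\<close>, since \<open>\<parallel>x\<^bsup>2m\<^esup>\<parallel> = \<parallel>x\<^bsup>m\<^esup>\<parallel>\<^sup>2\<close> for powers \<open>m\<close> of two.\<close>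

lemma selfadjoint_norm_le_of_power_growth:
  fixes x :: "'a::unital_cstar_algebra"
  assumes sa: "star x = x" and t: "t > 0" and K: "\<And>n. norm (x ^ n) \<le> t ^ n * (1 + real n * K)"
  shows "norm x \<le> t"
proof (rule ccontr)
  assume contra: "\<not> norm x \<le> t"
  define \<rho> where "\<rho> = norm x / t"
  have "\<rho> > 1"
    using contra t by (simp add: \<rho>_def field_simps)
  have pow: "norm (x ^ (2 ^ k)) = norm x ^ (2 ^ k)" for k
  proof (induction k)
    case (Suc k)
    have "x ^ 2 ^ Suc k = x ^ 2 ^ k * x ^ 2 ^ k"
      by (simp add: power_add[symmetric] mult_2)
    then have "norm (x ^ 2 ^ Suc k) = (norm (x ^ 2 ^ k))\<^sup>2"
      using norm_power2_selfadjoint[of "x ^ 2 ^ k"] by (simp add: star_power sa)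
    then show ?case
      by (simp add: Suc power_mult[symmetric] mult.commute)
  qed simp
  have le: "\<rho> ^ (2 ^ k) \<le> 1 + 2 ^ k * K" for k
    using K[of "2 ^ k"] t by (simp add: pow \<rho>_def power_divide divide_le_eq mult.commute)
  \<comment> \<open>Bernoulli's inequality is applied to sqrt \<rho> rather than \<rho>: squaring
    afterwards gives quadratic growth in m, which outruns the linear bound.\<close>
  define \<eta> where "\<eta> = sqrt \<rho> - 1"
  have \<eta>: "\<eta> > 0"
    using \<open>\<rho> > 1\<close> by (simp add: \<eta>_def)
  have ge: "\<rho> ^ m \<ge> (1 + real m * \<eta>)\<^sup>2" for m
  proof -
    have "\<rho> ^ m = ((1 + \<eta>) ^ m)\<^sup>2"
      using \<open>\<rho> > 1\<close> by (simp add: \<eta>_def real_sqrt_power[symmetric])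
    moreover have "1 + real m * \<eta> \<le> (1 + \<eta>) ^ m"
      using \<eta> by (intro Bernoulli_inequality) simp
    ultimately show ?thesis
      using \<eta> by (simp add: power_mono)
  qed
  obtain k :: nat where k: "K / \<eta>\<^sup>2 < 2 ^ k"
    using real_arch_pow[of 2] by auto
  let ?m = "2 ^ k :: real"
  have "(1 + ?m * \<eta>)\<^sup>2 \<le> 1 + ?m * K"
    using ge[of "2 ^ k"] le[of k] by simp
  moreover have "(1 + ?m * \<eta>)\<^sup>2 = 1 + 2 * ?m * \<eta> + ?m * (?m * \<eta>\<^sup>2)"
    by (simp add: power2_eq_square algebra_simps)
  moreover have "K < ?m * \<eta>\<^sup>2"
    using k \<eta> by (simp add: field_simps)
  then have "?m * K < ?m * (?m * \<eta>\<^sup>2)"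
    by simp
  moreover have "?m * \<eta> > 0"
    using \<eta> by simp
  ultimately show False
    by linarith
qed

text \<open>The usual argument compares the nonzero spectra of \<open>z * star z\<close> and
  \<open>star z * z\<close>. Here \<open>z * ?X ^ n = ?Y ^ n * z\<close> transfers a power of
  \<open>?X\<close> to one of \<open>?Y\<close>, whose norm is at most t^n. Each further factor
  \<open>?X\<close> then adds only a term of order t^n, so the powers of \<open>?X\<close> grow at
  most like n t^n and the growth lemma bounds \<open>?X\<close> itself.\<close>

lemma pos_star_mult_swap:
  fixes z :: "'a::unital_cstar_algebra"
  assumes "pos (z * star z)"
  shows "pos (star z * z)"
proof -
  obtain t where t: "t > 0" "norm (of_real t - z * star z) \<le> t"
    using assms by (auto simp: pos_def)
  let ?X = "of_real t - star z * z" and ?Y = "of_real t - z * star z"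
  have XY: "z * ?X ^ n = ?Y ^ n * z" for n
  proof (induction n)
    case (Suc n)
    have "z * ?X = ?Y * z"
      by (simp add: algebra_simps of_real_def)
    then show ?case
      using Suc by (simp add: mult.assoc[symmetric]) (simp add: mult.assoc)
  qed simp
  have "norm (?X ^ n) \<le> t ^ n * (1 + real n * ((norm z)\<^sup>2 / t))" for n
  proof (induction n)
    case (Suc n)
    have "?X ^ Suc n = of_real t * ?X ^ n - star z * (z * ?X ^ n)"
      by (simp add: left_diff_distrib mult.assoc)
    then have "?X ^ Suc n = t *\<^sub>R ?X ^ n - star z * (?Y ^ n * z)"
      by (simp only: XY scaleR_conv_of_real)
    moreover have "norm (star z * (?Y ^ n * z)) \<le> norm z * (t ^ n * norm z)"
    proof -
      have "norm (?Y ^ n) \<le> t ^ n"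
        using norm_power_ineq[of ?Y n] power_mono[OF t(2), of n] by simp
      then have "norm (?Y ^ n * z) \<le> t ^ n * norm z"
        using norm_mult_ineq[of "?Y ^ n" z] mult_right_mono[of _ _ "norm z"] by fastforce
      then have "norm (star z) * norm (?Y ^ n * z) \<le> norm z * (t ^ n * norm z)"
        unfolding norm_star by (rule mult_left_mono) simp
      then show ?thesis
        by (rule order.trans[OF norm_mult_ineq])
    qed
    moreover have "norm (t *\<^sub>R ?X ^ n) \<le> t * (t ^ n * (1 + real n * ((norm z)\<^sup>2 / t)))"
      using Suc t(1) by simp
    ultimately have "norm (?X ^ Suc n)
        \<le> t * (t ^ n * (1 + real n * ((norm z)\<^sup>2 / t))) + norm z * (t ^ n * norm z)"
      using norm_triangle_ineq4[of "t *\<^sub>R ?X ^ n" "star z * (?Y ^ n * z)"] by simp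
    also have "\<dots> = t ^ Suc n * (1 + real (Suc n) * ((norm z)\<^sup>2 / t))"
      using t(1) by (simp add: field_simps power2_eq_square)
    finally show ?case .
  qed simp
  then have "norm ?X \<le> t"
    by (intro selfadjoint_norm_le_of_power_growth[OF _ t(1), where K = "(norm z)\<^sup>2 / t"])
      (simp_all add: star_diff star_mult star_star)
  then show ?thesis
    by (intro posI) (simp_all add: star_mult star_star)
qed

lemma absolute_value_exists:
  fixes c :: "'a::unital_cstar_algebra"
  assumes "star c = c"
  obtains A where "pos A" "A * A = c * c" "\<forall>z. z * c = c * z \<longrightarrow> z * A = A * z"
proof -
  obtain A where A: "pos A" "A * A = c * c" "\<forall>z. z * (c * c) = c * c * z \<longrightarrow> z * A = A * z"
    by (rule pos_sqrt[OF pos_square[OF assms]])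
  have "\<forall>z. z * c = c * z \<longrightarrow> z * A = A * z"
  proof (intro allI impI)
    fix z
    assume "z * c = c * z"
    then have "z * (c * c) = c * c * z"
      by (metis mult.assoc)
    then show "z * A = A * z"
      by (rule A(3)[rule_format])
  qed
  with A(1,2) show ?thesis
    by (rule that)
qed

text \<open>With \<open>c = z\<^sup>*z\<close> and \<open>w = z (\<bar>c\<bar> - c)\<close>, the element \<open>w\<^sup>*w = - \<bar>c\<bar> (\<bar>c\<bar> - c)\<^sup>2\<close> is negative, while
  \<open>w\<^sup>*w + w w\<^sup>*\<close> is a sum of two squares, so that \<open>w w\<^sup>*\<close> is positive and hence \<open>w = 0\<close>.\<close>

lemma pos_star_mult:
  fixes z :: "'a::unital_cstar_algebra"
  shows "pos (star z * z)"
proof -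
  define c where "c = star z * z"
  have sa: "star c = c"
    by (simp add: c_def star_mult star_star)
  obtain A where A: "pos A" "A * A = c * c" and comm: "\<forall>z. z * c = c * z \<longrightarrow> z * A = A * z"
    by (rule absolute_value_exists[OF sa])
  obtain r where r: "pos r" "r * r = A" and r_comm: "\<forall>z. z * A = A * z \<longrightarrow> z * r = r * z"
    by (rule pos_sqrt[OF A(1)])
  have cA: "c * A = A * c"
    using comm by simp
  define e where "e = A - c"
  define w where "w = z * e"
  have sa_e: "star e = e" and sa_r: "star r = r"
    using A(1) r(1) by (simp_all add: e_def star_diff sa pos_selfadjoint)
  have ce: "c * e = - (A * e)"
    using A(2) cA by (simp add: e_def algebra_simps)
  have er: "e * r = r * e"
    unfolding e_def using cA by (intro r_comm[rule_format]) (simp add: algebra_simps)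
  have "star w * w = e * (c * e)"
    by (simp add: w_def c_def star_mult sa_e mult.assoc)
  also have "\<dots> = - ((r * e) * (r * e))"
    unfolding ce r(2)[symmetric] by (simp add: mult.assoc[symmetric] er)
  finally have ww: "star w * w = - ((r * e) * (r * e))" .
  have sa_re: "star (r * e) = r * e"
    by (simp add: star_mult sa_e sa_r er)
  have neg: "pos (- (star w * w))"
    using pos_square[OF sa_re] by (simp add: ww)
  let ?h = "w + star w" and ?k = "scaleC \<i> (w - star w)"
  have "pos (?h * ?h)"
    by (rule pos_square) (simp add: star_add star_star add.commute)
  moreover have "pos (?k * ?k)"
    by (rule pos_square)
      (simp add: star_scaleC star_diff star_star scaleC_minus_left scaleC_diff_right)
  ultimately have "pos ((1/2) *\<^sub>R (?h * ?h + ?k * ?k))"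
    by (intro pos_scaleR pos_add) auto
  moreover have kk: "?k * ?k = - ((w - star w) * (w - star w))"
    by (simp add: mult_scaleC_left mult_scaleC_right scaleC_scaleC scaleC_minus_left)
  have "?h * ?h + ?k * ?k = 2 *\<^sub>R (star w * w + w * star w)"
    unfolding kk by (simp add: algebra_simps scaleR_2)
  ultimately have "pos (star w * w + w * star w)"
    by simp
  from pos_add[OF neg this]
  have "pos (w * star w)"
    by simp
  then have "star w * w = 0"
    by (intro pos_antisym pos_star_mult_swap neg) (rule \<open>pos (w * star w)\<close>)
  then have "r * e = 0"
    using ww square_selfadjoint_eq_0_iff[OF sa_re] by simp
  then have "A * e = 0"
    by (metis mult.assoc mult_zero_right r(2))
  then have "A * A = A * c"
    by (simp add: e_def right_diff_distrib)
  then have "e * e = 0"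
    using A(2) cA by (simp add: e_def algebra_simps)
  then have "A = c"
    using square_selfadjoint_eq_0_iff[OF sa_e] by (simp add: e_def)
  then show ?thesis
    using A(1) by (simp add: c_def)
qed

lemma pos_compress:
  fixes p :: "'a::unital_cstar_algebra"
  assumes "pos p"
  shows "pos (star z * p * z)"
proof -
  obtain r where r: "pos r" "r * r = p"
    by (rule pos_sqrt[OF assms])
  have "star z * p * z = star (r * z) * (r * z)"
    unfolding r(2)[symmetric] by (simp add: star_mult pos_selfadjoint[OF r(1)] mult.assoc)
  then show ?thesis
    by (simp only: pos_star_mult)
qed

section \<open>Bilinear maps vanishing on zero products\<close>

text \<open>With e = A - c the aim is e = |e|. The element f = |e| - e is twice the negative part of
  e, and e^2 = 2 A e becomes |e|^2 f + 2 A |e| f = 0. Compressed by f, this is a vanishing sum of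
  two positive elements, so |e| f = 0 and then f^2 = 0.\<close>

lemma pos_absolute_value_minus:
  fixes c :: "'a::unital_cstar_algebra"
  assumes sa: "star c = c" and A: "pos A" "A * A = c * c" and cA: "A * c = c * A"
  shows "pos (A - c)"
proof -
  define e where "e = A - c"
  have sa_e: "star e = e"
    by (simp add: e_def star_diff sa pos_selfadjoint A(1))
  have ee: "e * e = 2 *\<^sub>R (A * e)"
    by (simp add: e_def algebra_simps A(2) cA scaleR_2)
  have Ae: "A * e = e * A"
    by (simp add: e_def algebra_simps cA)
  obtain E where E: "pos E" "E * E = e * e" and E_comm: "\<forall>z. z * e = e * z \<longrightarrow> z * E = E * z"
    by (rule absolute_value_exists[OF sa_e])
  have eE: "e * E = E * e" and AE: "A * E = E * A"
    using E_comm Ae by auto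
  define f where "f = E - e"
  have sa_f: "star f = f"
    by (simp add: f_def star_diff sa_e pos_selfadjoint E(1))
  have ef: "e * f = - (E * f)"
    by (simp add: f_def algebra_simps E(2) eE)
  have "E * E * f = 2 *\<^sub>R (A * (e * f))"
    by (simp add: E(2) ee mult.assoc)
  then have "f * (E * E) * f + 2 *\<^sub>R (f * (A * E) * f) = 0"
    by (simp add: ef mult.assoc distrib_left[symmetric])
  moreover have "pos (f * (E * E) * f)"
    using pos_compress[of "E * E" f] pos_square[of E] by (simp add: sa_f pos_selfadjoint E(1))
  moreover have "pos (2 *\<^sub>R (f * (A * E) * f))"
    using pos_compress[OF pos_mult_commute[OF A(1) E(1) AE], of f]
    by (intro pos_scaleR) (simp_all add: sa_f)
  ultimately have "f * (E * E) * f = 0"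
    by (metis pos_add_eq_0)
  then have "star (E * f) * (E * f) = 0"
    by (simp add: star_mult sa_f pos_selfadjoint E(1) mult.assoc)
  then have "E * f = 0"
    by (simp add: star_mult_self_eq_0_iff)
  then have "f * f = 0"
    using ef by (simp add: f_def left_diff_distrib)
  then have "f = 0"
    using square_selfadjoint_eq_0_iff[OF sa_f] by simp
  then show ?thesis
    using E(1) by (simp add: f_def e_def)
qed

section \<open>Positive and negative parts of self-adjoint elements\<close>

definition is_pos_part :: "'a::unital_cstar_algebra \<Rightarrow> 'a \<Rightarrow> bool"
  where "is_pos_part c k \<longleftrightarrow> pos k \<and> pos (k - c) \<and> k * (k - c) = 0 \<and>
    (\<forall>z. z * c = c * z \<longrightarrow> z * k = k * z)"

definition pos_part :: "'a::unital_cstar_algebra \<Rightarrow> 'a"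
  where "pos_part c = (SOME k. is_pos_part c k)"

text \<open>Half of |c| + c works: subtracting c leaves half of |c| - c, and both are positive by
  \<open>pos_absolute_value_minus\<close>, applied to c and to -c.\<close>

lemma is_pos_part_pos_part:
  fixes c :: "'a::unital_cstar_algebra"
  assumes sa: "star c = c"
  shows "is_pos_part c (pos_part c)"
proof -
  obtain A where A: "pos A" "A * A = c * c" and comm: "\<forall>z. z * c = c * z \<longrightarrow> z * A = A * z"
    by (rule absolute_value_exists[OF sa])
  have cA: "A * c = c * A"
    using comm by simp
  let ?k = "(1/2) *\<^sub>R (A + c)"
  have minus: "?k - c = (1/2) *\<^sub>R (A - c)"
  proof -
    have "?k - c = ?k - (1/2) *\<^sub>R (c + c)"
      by (simp only: scaleR_half_double)
    then show ?thesis
      by (simp only: scaleR_diff_right[symmetric]) simp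
  qed
  have "pos (A - c)" "pos (A - - c)"
    using A cA sa by (intro pos_absolute_value_minus; simp)+
  moreover have "?k * (?k - c) = 0"
    unfolding minus by (simp add: algebra_simps A(2) cA)
  moreover have "\<forall>z. z * c = c * z \<longrightarrow> z * ?k = ?k * z"
    using comm by (simp add: distrib_left distrib_right)
  ultimately have "is_pos_part c ?k"
    unfolding is_pos_part_def minus by (intro conjI pos_scaleR) auto
  then show ?thesis
    unfolding pos_part_def by (rule someI)
qed

lemma
  fixes c :: "'a::unital_cstar_algebra"
  assumes "star c = c"
  shows pos_pos_part: "pos (pos_part c)"
    and pos_neg_part: "pos (pos_part c - c)"
    and pos_part_mult_neg_part: "pos_part c * (pos_part c - c) = 0"
    and pos_part_commute: "z * c = c * z \<Longrightarrow> z * pos_part c = pos_part c * z"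
  using is_pos_part_pos_part[OF assms] by (simp_all add: is_pos_part_def)

lemma neg_part_mult_pos_part:
  fixes c :: "'a::unital_cstar_algebra"
  assumes "star c = c"
  shows "(pos_part c - c) * pos_part c = 0"
  using pos_part_mult_neg_part[OF assms] pos_part_commute[OF assms refl]
  by (simp add: left_diff_distrib right_diff_distrib)

text \<open>\<open>pos_part\<close> is a chosen element, so its value has to be pinned down from the
  defining properties. For n = \<open>pos_part c - c\<close> orthogonality reads n^2 + n c = 0, a
  sum of two positive elements, hence n = 0.\<close>

lemma pos_part_of_pos:
  fixes c :: "'a::unital_cstar_algebra"
  assumes "pos c"
  shows "pos_part c = c"
proof -
  let ?k = "pos_part c"
  have sa: "star c = c"
    using assms by (rule pos_selfadjoint)
  have m: "pos (?k - c)"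
    using pos_neg_part[OF sa] .
  have "(?k - c) * (?k - c) + (?k - c) * c = 0"
    using neg_part_mult_pos_part[OF sa] by (simp add: algebra_simps)
  moreover have "pos ((?k - c) * c)"
    using m assms by (rule pos_mult_commute) (simp add: algebra_simps pos_part_commute[OF sa refl])
  moreover have "pos ((?k - c) * (?k - c))"
    using m by (intro pos_square pos_selfadjoint)
  ultimately have "(?k - c) * (?k - c) = 0"
    by (metis pos_add_eq_0)
  then show ?thesis
    using square_selfadjoint_eq_0_iff[OF pos_selfadjoint[OF m]] by simp
qed

lemma pos_part_of_neg:
  fixes c :: "'a::unital_cstar_algebra"
  assumes "pos (- c)"
  shows "pos_part c = 0"
proof -
  let ?k = "pos_part c"
  have sa: "star c = c"
    using pos_selfadjoint[OF assms] by simp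
  have k: "pos ?k"
    using pos_pos_part[OF sa] .
  have "?k * ?k + ?k * (- c) = 0"
    using pos_part_mult_neg_part[OF sa] by (simp add: right_diff_distrib)
  moreover have "pos (?k * (- c))"
    using k assms by (rule pos_mult_commute) (simp add: pos_part_commute[OF sa refl])
  moreover have "pos (?k * ?k)"
    using k by (intro pos_square pos_selfadjoint)
  ultimately have "?k * ?k = 0"
    by (metis pos_add_eq_0)
  then show ?thesis
    using square_selfadjoint_eq_0_iff[OF pos_selfadjoint[OF k]] by simp
qed

text \<open>As functions of c, the first factor lives where c > \<delta> and the second where c < 0.
  Algebraically, for k and y the two factors, k^2 = k (c - \<delta>) and y^2 = - c y combine to
  \<delta> k y + k^2 y + y k y = 0, in which every summand is positive.\<close>

lemma pos_part_shift_mult_neg_part: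
  fixes c :: "'a::unital_cstar_algebra"
  assumes sa: "star c = c" and \<delta>: "\<delta> > 0"
  shows "pos_part (c - of_real \<delta>) * (pos_part c - c) = 0"
    and "(pos_part c - c) * pos_part (c - of_real \<delta>) = 0"
proof -
  let ?d = "of_real \<delta> :: 'a"
  have sa': "star (c - ?d) = c - ?d"
    by (simp add: star_diff sa)
  define k where "k = pos_part (c - ?d)"
  define y where "y = pos_part c - c"
  have k: "pos k" and kk: "k * k = k * (c - ?d)" and ck: "c * k = k * c"
    using pos_pos_part[OF sa'] pos_part_mult_neg_part[OF sa']
      pos_part_commute[OF sa', of c]
    by (simp_all add: k_def right_diff_distrib left_diff_distrib of_real_def)
  have y: "pos y"
    unfolding y_def by (rule pos_neg_part[OF sa])
  have cy: "c * y = y * c"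
    by (simp add: y_def algebra_simps pos_part_commute[OF sa refl])
  have yy: "y * y = - (c * y)"
    using neg_part_mult_pos_part[OF sa] cy unfolding y_def by (simp add: algebra_simps)
  have "k * pos_part c = pos_part c * k"
    using ck by (intro pos_part_commute[OF sa]) simp
  then have ky: "k * y = y * k"
    by (simp add: y_def algebra_simps ck)
  have pos1: "pos (k * y)"
    using k y ky by (rule pos_mult_commute)
  have "pos (k * (k * y))"
    by (rule pos_mult_commute[OF k pos1]) (metis ky mult.assoc)
  moreover have "pos (y * (k * y))"
    by (rule pos_mult_commute[OF y pos1]) (metis ky mult.assoc)
  ultimately have pos2: "pos (k * (k * y) + y * (k * y))"
    by (rule pos_add)
  have "k * (k * y) = k * (c * y) - \<delta> *\<^sub>R (k * y)"
    by (simp add: mult.assoc[symmetric] kk) (simp add: algebra_simps of_real_def mult.assoc)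
  moreover have "y * (k * y) = - (k * (c * y))"
    by (simp add: mult.assoc[symmetric] ky[symmetric]) (simp add: mult.assoc yy)
  ultimately have sum: "\<delta> *\<^sub>R (k * y) + (k * (k * y) + y * (k * y)) = 0"
    by simp
  have "pos (\<delta> *\<^sub>R (k * y))"
    using pos1 \<delta> by (intro pos_scaleR) auto
  from pos_add_eq_0[OF this pos2 sum] have "k * y = 0"
    using \<delta> by simp
  then show "pos_part (c - ?d) * (pos_part c - c) = 0" "(pos_part c - c) * pos_part (c - ?d) = 0"
    using ky by (simp_all add: k_def y_def)
qed

text \<open>As a function of c, s is the minimum of c_+ and \<delta>, hence equals \<delta> on the
  support of k. For the norm, with m the negative part of c - \<delta>, the element \<delta> s is
  the sum of the positive elements s^2 and c_+ m; the factor 2 is that of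
  \<open>pos_norm_mono\<close>.\<close>

lemma pos_part_shift:
  fixes c :: "'a::unital_cstar_algebra"
  assumes sa: "star c = c" and \<delta>: "\<delta> > 0"
  defines "k \<equiv> pos_part (c - of_real \<delta>)"
  defines "s \<equiv> pos_part c - k"
  shows "k * (s - of_real \<delta>) = 0" "(s - of_real \<delta>) * k = 0" "norm s \<le> 2 * \<delta>"
proof -
  let ?d = "of_real \<delta> :: 'a"
  have sa': "star (c - ?d) = c - ?d"
    by (simp add: star_diff sa)
  define x where "x = pos_part c"
  define y where "y = x - c"
  define m where "m = k - (c - ?d)"
  have s: "s = x - k" and sd: "s - ?d = y - m"
    by (simp_all add: s_def x_def y_def m_def)
  have ky: "k * y = 0" "y * k = 0"
    using pos_part_shift_mult_neg_part[OF sa \<delta>] by (simp_all add: k_def x_def y_def)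
  have km: "k * m = 0" "m * k = 0"
    using pos_part_mult_neg_part[OF sa'] neg_part_mult_pos_part[OF sa']
    by (simp_all add: k_def m_def)
  have xy: "x * y = 0"
    using pos_part_mult_neg_part[OF sa] by (simp add: x_def y_def)
  show "k * (s - ?d) = 0" "(s - ?d) * k = 0"
    unfolding sd using ky km by (simp_all add: left_diff_distrib right_diff_distrib)
  have x: "pos x" and m: "pos m"
    using pos_pos_part[OF sa] pos_neg_part[OF sa'] by (simp_all add: x_def m_def k_def)
  have "c * k = k * c"
    unfolding k_def by (rule pos_part_commute[OF sa']) (simp add: algebra_simps of_real_def)
  then have cm: "m * c = c * m"
    by (simp add: m_def algebra_simps of_real_def)
  have xm: "x * m = m * x"
    unfolding x_def using pos_part_commute[OF sa cm] by simp
  have "s * (s - ?d) = - (x * m)"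
    unfolding sd unfolding s using xy km ky by (simp add: left_diff_distrib right_diff_distrib)
  then have eq: "s * s + x * m = \<delta> *\<^sub>R s"
    by (simp add: algebra_simps of_real_def)
  have sa_s: "star s = s"
    unfolding s using pos_selfadjoint[OF x] pos_selfadjoint[OF pos_pos_part[OF sa']]
    by (simp add: star_diff k_def)
  have "norm (s * s) \<le> 2 * norm (\<delta> *\<^sub>R s)"
    unfolding eq[symmetric] using pos_square[OF sa_s] pos_mult_commute[OF x m xm]
    by (rule pos_norm_mono)
  then have "norm s * norm s \<le> 2 * \<delta> * norm s"
    using \<delta> by (simp add: norm_power2_selfadjoint[OF sa_s] power2_eq_square)
  then show "norm s \<le> 2 * \<delta>"
    using \<delta> by (cases "norm s = 0") auto
qed

text \<open>The elements \<open>k j = (c - j\<delta>)\<^sub>+\<close> interpolate between \<open>c\<close> and \<open>0\<close>. As \<open>k j - k (j + 1) - \<delta>\<close> is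
  annihilated by \<open>k (j + 1)\<close>, locality of \<open>W\<close> determines the increments of \<open>W (k j) (k j)\<close>
  up to an error of order \<open>\<delta>\<^sup>2\<close>.\<close>

lemma local_bilinear_telescope:
  fixes c :: "'a::unital_cstar_algebra" and W :: "'a \<Rightarrow> 'a \<Rightarrow> 'b::real_normed_vector"
  assumes W: "bounded_bilinear W" and local: "\<And>f g. f * g = 0 \<Longrightarrow> W f g = 0"
    and K: "\<And>f g. norm (W f g) \<le> norm f * norm g * K" and K0: "K \<ge> 0"
    and c: "pos c" and R: "R > 0" "pos (of_real R - c)" and N: "N > 0"
  defines "\<delta> \<equiv> R / real N"
  defines "k \<equiv> \<lambda>j. pos_part (c - of_real (real j * \<delta>))"
  defines "S \<equiv> \<delta> *\<^sub>R (\<Sum>j<N. k (Suc j))"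
  shows "norm (W c c - (W 1 S + W S 1)) \<le> 4 * R\<^sup>2 * K / real N"
proof -
  interpret W: bounded_bilinear W by (fact W)
  have \<delta>: "\<delta> > 0"
    using R N by (simp add: \<delta>_def)
  have sa: "star (c - of_real (real j * \<delta>)) = c - of_real (real j * \<delta>)" for j
    by (simp add: star_diff pos_selfadjoint[OF c] del: of_real_mult)
  have k_Suc: "k (Suc j) = pos_part (c - of_real (real j * \<delta>) - of_real \<delta>)" for j
    by (simp add: k_def algebra_simps)
  have k_eq: "pos_part (c - of_real (real j * \<delta>)) = k j" for j
    by (simp add: k_def)
  define T where "T j = \<delta> *\<^sub>R (W 1 (k (Suc j)) + W (k (Suc j)) 1)" for j
  have incr: "norm (W (k j) (k j) - W (k (Suc j)) (k (Suc j)) - T j) \<le> 4 * \<delta>\<^sup>2 * K" for j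
  proof -
    define s where "s = k j - k (Suc j)"
    note shift = pos_part_shift[OF sa[of j] \<delta>, folded k_Suc, unfolded k_eq, folded s_def]
    have "W (k (Suc j)) (s - of_real \<delta>) = 0" "W (s - of_real \<delta>) (k (Suc j)) = 0"
      using shift(1,2) by (simp_all add: local)
    then have T: "W (k (Suc j)) s + W s (k (Suc j)) = T j"
      by (simp add: T_def W.diff_left W.diff_right of_real_def W.scaleR_left W.scaleR_right
          scaleR_add_right)
    have "k j = k (Suc j) + s"
      by (simp add: s_def)
    then have "W (k j) (k j) - W (k (Suc j)) (k (Suc j)) - T j = W s s"
      unfolding T[symmetric] by (simp add: W.add_left W.add_right)
    moreover have "norm (W s s) \<le> (2 * \<delta>) * (2 * \<delta>) * K"
      by (rule order.trans[OF K]) (intro mult_right_mono mult_mono shift(3) K0; use \<delta> in simp)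
    ultimately show ?thesis
      by (simp add: power2_eq_square)
  qed
  have "k N = 0"
    using pos_part_of_neg[of "c - of_real R"] R(2) N by (simp add: k_def \<delta>_def)
  moreover have "k 0 = c"
    using pos_part_of_pos[OF c] by (simp add: k_def)
  ultimately have "(\<Sum>j<N. W (k j) (k j) - W (k (Suc j)) (k (Suc j))) = W c c"
    by (subst sum_lessThan_telescope') (simp add: W.zero_left)
  moreover have "(\<Sum>j<N. T j) = W 1 S + W S 1"
    by (simp add: T_def S_def W.scaleR_left W.scaleR_right W.sum_left W.sum_right
        scaleR_sum_right[symmetric] sum.distrib scaleR_add_right)
  ultimately have "W c c - (W 1 S + W S 1)
      = (\<Sum>j<N. W (k j) (k j) - W (k (Suc j)) (k (Suc j)) - T j)"
    by (simp add: sum_subtractf)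
  also have "norm \<dots> \<le> real N * (4 * \<delta>\<^sup>2 * K)"
    using sum_norm_bound[of "{..<N}", OF incr] by simp
  also have "\<dots> = 4 * R\<^sup>2 * K / real N"
    using N by (simp add: \<delta>_def power2_eq_square)
  finally show ?thesis .
qed

text \<open>The \<open>S n\<close> are Riemann sums of the integral of (c - \<lambda>)_+ over
  \<lambda> \<ge> 0, whose value is c^2 / 2. No integral is evaluated: multiplication is itself a
  local bilinear map, and the telescoping estimate for it already shows that c^2 - 2 S n tends to
  0.\<close>

lemma local_bilinear_square_pos:
  fixes c :: "'a::unital_cstar_algebra" and W :: "'a \<Rightarrow> 'a \<Rightarrow> 'b::real_normed_vector"
  assumes W: "bounded_bilinear W" and local: "\<And>f g. f * g = 0 \<Longrightarrow> W f g = 0"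
    and c: "pos c"
  shows "W (c * c) 1 + W 1 (c * c) = 2 *\<^sub>R W c c"
proof -
  interpret W: bounded_bilinear W by (fact W)
  obtain K where K: "K \<ge> 0" "\<And>f g. norm (W f g) \<le> norm f * norm g * K"
    using W.nonneg_bounded by blast
  define R where "R = norm c + 1"
  have "pos (of_real (norm c) - c + of_real 1)"
    by (intro pos_add pos_norm_minus pos_selfadjoint[OF c] pos_of_real) simp
  then have R: "R > 0" "pos (of_real R - c)"
    by (simp_all add: R_def algebra_simps add_pos_nonneg)
  define S where "S n = (R / real (Suc n)) *\<^sub>R
    (\<Sum>j<Suc n. pos_part (c - of_real (real (Suc j) * (R / real (Suc n)))))" for n
  have tele: "(\<lambda>n. V c c - (V 1 (S n) + V (S n) 1)) \<longlonglongrightarrow> 0"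
    if V: "bounded_bilinear V" "\<And>f g. f * g = 0 \<Longrightarrow> V f g = 0"
      and B: "B \<ge> 0" "\<And>f g. norm (V f g) \<le> norm f * norm g * B"
    for V :: "'a \<Rightarrow> 'a \<Rightarrow> 'c::real_normed_vector" and B
  proof (rule tendsto_0_le[where K = 1])
    have "norm (V c c - (V 1 (S n) + V (S n) 1)) \<le> 4 * R\<^sup>2 * B / real (Suc n)" for n
      unfolding S_def by (rule local_bilinear_telescope[OF V B(2,1) c R]) simp_all
    then show "\<forall>\<^sub>F n in sequentially. norm (V c c - (V 1 (S n) + V (S n) 1))
        \<le> norm (4 * R\<^sup>2 * B / real (Suc n)) * 1"
      by (intro always_eventually allI) (metis abs_ge_self mult.right_neutral order.trans real_norm_def)
    show "(\<lambda>n. 4 * R\<^sup>2 * B / real (Suc n)) \<longlonglongrightarrow> 0"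
      by (rule LIMSEQ_Suc) (rule lim_const_over_n)
  qed
  have "(\<lambda>n. c * c - (1 * S n + S n * 1)) \<longlonglongrightarrow> 0"
    by (rule tele[OF bounded_bilinear_mult, of 1]) (simp_all add: norm_mult_ineq)
  then have "(\<lambda>n. (1/2) *\<^sub>R (c * c) - (1/2) *\<^sub>R (c * c - (S n + S n))) \<longlonglongrightarrow> (1/2) *\<^sub>R (c * c) - (1/2) *\<^sub>R 0"
    by (intro tendsto_intros) simp
  moreover have "(1/2) *\<^sub>R (c * c) - (1/2) *\<^sub>R (c * c - (S n + S n)) = S n" for n
    by (simp add: scaleR_diff_right scaleR_add_right[symmetric])
  ultimately have S: "S \<longlonglongrightarrow> (1/2) *\<^sub>R (c * c)"
    by simp
  have "(\<lambda>n. W c c - (W 1 (S n) + W (S n) 1))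
      \<longlonglongrightarrow> W c c - (W 1 ((1/2) *\<^sub>R (c * c)) + W ((1/2) *\<^sub>R (c * c)) 1)"
    by (intro tendsto_intros W.tendsto S)
  with tele[OF W local K]
  have "W c c - (W 1 ((1/2) *\<^sub>R (c * c)) + W ((1/2) *\<^sub>R (c * c)) 1) = 0"
    using LIMSEQ_unique by blast
  then have "W c c = (1/2) *\<^sub>R (W (c * c) 1 + W 1 (c * c))"
    by (simp add: W.scaleR_left W.scaleR_right scaleR_add_right add.commute)
  then show ?thesis
    by simp
qed

text \<open>Adding a real multiple of 1 to c changes both sides by the same terms, so c may be
  shifted by its norm to become positive.\<close>

lemma local_bilinear_square:
  fixes c :: "'a::unital_cstar_algebra" and W :: "'a \<Rightarrow> 'a \<Rightarrow> 'b::real_normed_vector"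
  assumes W: "bounded_bilinear W" and local: "\<And>f g. f * g = 0 \<Longrightarrow> W f g = 0"
    and sa: "star c = c"
  shows "W (c * c) 1 + W 1 (c * c) = 2 *\<^sub>R W c c"
proof -
  interpret W: bounded_bilinear W by (fact W)
  let ?a = "norm c *\<^sub>R (1::'a)"
  have "pos (?a + c)"
    using pos_norm_minus[of "- c"] sa by (simp add: of_real_def)
  from local_bilinear_square_pos[OF W local this]
  moreover have "(2 * r) *\<^sub>R x = r *\<^sub>R x + r *\<^sub>R x" for r and x :: 'b
    by (simp add: scaleR_add_left[symmetric])
  ultimately show ?thesis
    by (simp add: distrib_left distrib_right W.add_left W.add_right W.scaleR_left W.scaleR_right
        scaleR_2 scaleR_add_right)
qed

section \<open>The unitization of a C*-algebra\<close>

datatype 'a unitization = Unitization (ideal_part: 'a) (scalar_part: complex)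

lemma unitization_eq_iff:
  "u = v \<longleftrightarrow> ideal_part u = ideal_part v \<and> scalar_part u = scalar_part v"
  by (cases u; cases v) simp

lemma scaleR_scaleC: "scaleC (r *\<^sub>R c) x = r *\<^sub>R scaleC c (x::'a::cstar_algebra)"
  by (simp add: scaleR_conv_of_real[where 'a = complex] scaleC_scaleC[symmetric] scaleC_of_real)

definition left_mult :: "'a::cstar_algebra unitization \<Rightarrow> 'a \<Rightarrow> 'a"
  where "left_mult u b = ideal_part u * b + scaleC (scalar_part u) b"

lemma bounded_linear_left_mult: "bounded_linear (left_mult u)"
  unfolding left_mult_def
  by (intro bounded_linear_add bounded_linear_mult_right bounded_linear_scaleC)

text \<open>The second term alone is only a seminorm when the algebra is already unital.\<close>

definition unitization_norm :: "'a::cstar_algebra unitization \<Rightarrow> real"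
  where "unitization_norm u = max (cmod (scalar_part u)) (onorm (left_mult u))"

instantiation unitization :: (cstar_algebra) ring_1
begin

definition zero_unitization :: "'a unitization"
  where "0 = Unitization 0 0"
definition one_unitization :: "'a unitization"
  where "1 = Unitization 0 1"
definition plus_unitization :: "'a unitization \<Rightarrow> 'a unitization \<Rightarrow> 'a unitization"
  where "u + v = Unitization (ideal_part u + ideal_part v) (scalar_part u + scalar_part v)"
definition minus_unitization :: "'a unitization \<Rightarrow> 'a unitization \<Rightarrow> 'a unitization"
  where "u - v = Unitization (ideal_part u - ideal_part v) (scalar_part u - scalar_part v)"
definition uminus_unitization :: "'a unitization \<Rightarrow> 'a unitization"
  where "- u = Unitization (- ideal_part u) (- scalar_part u)"
definition times_unitization :: "'a unitization \<Rightarrow> 'a unitization \<Rightarrow> 'a unitization"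
  where "u * v = Unitization
    (ideal_part u * ideal_part v + scaleC (scalar_part u) (ideal_part v)
      + scaleC (scalar_part v) (ideal_part u))
    (scalar_part u * scalar_part v)"

instance
  by standard
    (simp_all add: unitization_eq_iff zero_unitization_def one_unitization_def plus_unitization_def
      minus_unitization_def uminus_unitization_def times_unitization_def algebra_simps
      scaleC_add_right scaleC_add_left scaleC_scaleC mult_scaleC_left mult_scaleC_right)

end

lemma unitization_sel [simp]:
  "ideal_part (0 :: 'a::cstar_algebra unitization) = 0"
  "scalar_part (0 :: 'a unitization) = 0"
  "ideal_part (1 :: 'a unitization) = 0"
  "scalar_part (1 :: 'a unitization) = 1"
  "ideal_part (u + v :: 'a unitization) = ideal_part u + ideal_part v"
  "scalar_part (u + v :: 'a unitization) = scalar_part u + scalar_part v"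
  "ideal_part (u - v :: 'a unitization) = ideal_part u - ideal_part v"
  "scalar_part (u - v :: 'a unitization) = scalar_part u - scalar_part v"
  "ideal_part (- u :: 'a unitization) = - ideal_part u"
  "scalar_part (- u :: 'a unitization) = - scalar_part u"
  "ideal_part (u * v :: 'a unitization) = ideal_part u * ideal_part v
    + scaleC (scalar_part u) (ideal_part v) + scaleC (scalar_part v) (ideal_part u)"
  "scalar_part (u * v :: 'a unitization) = scalar_part u * scalar_part v"
  by (simp_all add: zero_unitization_def one_unitization_def plus_unitization_def
      minus_unitization_def uminus_unitization_def times_unitization_def)

lemma left_mult_mult: "left_mult (u * v) b = left_mult u (left_mult v b)"
  by (simp add: left_mult_def algebra_simps scaleC_add_right scaleC_scaleC mult_scaleC_left
      mult_scaleC_right)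

lemma left_mult_one: "left_mult 1 = (\<lambda>b. b)"
  by (simp add: left_mult_def fun_eq_iff)

lemma norm_left_mult_le: "norm (left_mult u b) \<le> unitization_norm u * norm b"
  using onorm[OF bounded_linear_left_mult, of u b]
  by (rule order.trans) (simp add: unitization_norm_def mult_right_mono)

lemma cmod_scalar_part_le: "cmod (scalar_part u) \<le> unitization_norm u"
  by (simp add: unitization_norm_def)

lemma unitization_norm_nonneg: "0 \<le> unitization_norm u"
  by (simp add: unitization_norm_def max_def order.trans[OF norm_ge_zero])

lemma unitization_norm_leI:
  assumes "cmod (scalar_part u) \<le> K" "\<And>b. norm (left_mult u b) \<le> K * norm b"
  shows "unitization_norm u \<le> K"
proof -
  have "0 \<le> K"
    using assms(1) norm_ge_zero order.trans by blast
  then have "onorm (left_mult u) \<le> K"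
    by (rule onorm_bound) (rule assms(2))
  then show ?thesis
    using assms(1) by (simp add: unitization_norm_def)
qed

text \<open>Testing on b = \<open>star a\<close>, the C*-identity recovers the norm from left
  multiplication.\<close>

lemma norm_le_of_left_mult:
  fixes a :: "'a::cstar_algebra"
  assumes "\<And>b. norm (a * b) \<le> K * norm b" "K \<ge> 0"
  shows "norm a \<le> K"
proof (cases "norm a = 0")
  case False
  have "norm a * norm a \<le> K * norm a"
    using assms(1)[of "star a"] cstar_identity[of "star a"] by (simp add: star_star power2_eq_square)
  then show ?thesis
    using False by simp
qed (use assms in simp)

text \<open>The ideal part acts as \<open>left_mult u\<close> minus the scalar part, each bounded by
  the norm of u. Together with \<open>unitization_norm_le\<close> this makes the norm equivalent to
  the sum of the norms of the components, whence definiteness and completeness.\<close>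

lemma norm_ideal_part_le: "norm (ideal_part u) \<le> 2 * unitization_norm u"
proof (rule norm_le_of_left_mult)
  fix b
  have "ideal_part u * b = left_mult u b - scaleC (scalar_part u) b"
    by (simp add: left_mult_def)
  then have "norm (ideal_part u * b) \<le> norm (left_mult u b) + norm (scaleC (scalar_part u) b)"
    using norm_triangle_ineq4 by metis
  moreover have "norm (scaleC (scalar_part u) b) \<le> unitization_norm u * norm b"
    by (simp add: norm_scaleC mult_right_mono cmod_scalar_part_le)
  ultimately show "norm (ideal_part u * b) \<le> 2 * unitization_norm u * norm b"
    using norm_left_mult_le[of u b] by simp
qed (simp add: unitization_norm_nonneg)

lemma unitization_norm_le: "unitization_norm u \<le> norm (ideal_part u) + cmod (scalar_part u)"
proof (rule unitization_norm_leI)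
  fix b
  have "norm (left_mult u b) \<le> norm (ideal_part u * b) + norm (scaleC (scalar_part u) b)"
    unfolding left_mult_def by (rule norm_triangle_ineq)
  also have "\<dots> \<le> norm (ideal_part u) * norm b + cmod (scalar_part u) * norm b"
    by (intro add_mono norm_mult_ineq) (simp add: norm_scaleC)
  finally show "norm (left_mult u b) \<le> (norm (ideal_part u) + cmod (scalar_part u)) * norm b"
    by (simp add: distrib_right)
qed simp

instantiation unitization :: (cstar_algebra) real_algebra_1
begin

definition scaleR_unitization :: "real \<Rightarrow> 'a unitization \<Rightarrow> 'a unitization"
  where "scaleR r u = Unitization (scaleR r (ideal_part u)) (scaleR r (scalar_part u))"

instance
  by standard
    (simp_all add: scaleR_unitization_def unitization_eq_iff scaleR_add_right scaleR_add_left
      scaleC_scaleR scaleR_scaleC)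

end

instantiation unitization :: (cstar_algebra) real_normed_algebra_1
begin

definition norm_unitization :: "'a unitization \<Rightarrow> real"
  where "norm_unitization = unitization_norm"
definition dist_unitization :: "'a unitization \<Rightarrow> 'a unitization \<Rightarrow> real"
  where "dist_unitization u v = norm (u - v)"
definition sgn_unitization :: "'a unitization \<Rightarrow> 'a unitization"
  where "sgn_unitization u = u /\<^sub>R norm u"
definition uniformity_unitization :: "('a unitization \<times> 'a unitization) filter"
  where "uniformity_unitization = (INF e\<in>{0<..}. principal {(x, y). dist x y < e})"
definition open_unitization :: "'a unitization set \<Rightarrow> bool"
  where "open_unitization U \<longleftrightarrow> (\<forall>x\<in>U. eventually (\<lambda>(x', y). x' = x \<longrightarrow> y \<in> U) uniformity)"

instance
proof
  fix u v :: "'a unitization" and r :: real and U :: "'a unitization set"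
  show "dist u v = norm (u - v)" "sgn u = u /\<^sub>R norm u"
    by (simp_all add: dist_unitization_def sgn_unitization_def)
  show "(uniformity :: ('a unitization \<times> 'a unitization) filter)
      = (INF e\<in>{0<..}. principal {(x, y). dist x y < e})"
    by (rule uniformity_unitization_def)
  show "open U \<longleftrightarrow> (\<forall>x\<in>U. eventually (\<lambda>(x', y). x' = x \<longrightarrow> y \<in> U) uniformity)"
    by (rule open_unitization_def)
  show "norm u = 0 \<longleftrightarrow> u = 0"
  proof
    assume "norm u = 0"
    then show "u = 0"
      using norm_ideal_part_le[of u] cmod_scalar_part_le[of u]
      by (simp add: norm_unitization_def unitization_eq_iff)
  next
    assume "u = 0"
    then show "norm u = 0"
      using unitization_norm_le[of u] unitization_norm_nonneg[of u]
      by (simp add: norm_unitization_def)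
  qed
  show "norm (u + v) \<le> norm u + norm v"
    unfolding norm_unitization_def
  proof (rule unitization_norm_leI)
    show "cmod (scalar_part (u + v)) \<le> unitization_norm u + unitization_norm v"
      using cmod_scalar_part_le[of u] cmod_scalar_part_le[of v]
        norm_triangle_ineq[of "scalar_part u" "scalar_part v"] by simp
    fix b
    have "left_mult (u + v) b = left_mult u b + left_mult v b"
      by (simp add: left_mult_def algebra_simps scaleC_add_left)
    then show "norm (left_mult (u + v) b) \<le> (unitization_norm u + unitization_norm v) * norm b"
      using norm_triangle_mono[OF norm_left_mult_le norm_left_mult_le, of u b v b]
      by (simp add: distrib_right)
  qed
  show "norm (u * v) \<le> norm u * norm v"
    unfolding norm_unitization_def
  proof (rule unitization_norm_leI)
    show "cmod (scalar_part (u * v)) \<le> unitization_norm u * unitization_norm v"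
      by (simp add: norm_mult mult_mono cmod_scalar_part_le unitization_norm_nonneg)
    fix b
    have "norm (left_mult u (left_mult v b)) \<le> unitization_norm u * norm (left_mult v b)"
      by (rule norm_left_mult_le)
    also have "\<dots> \<le> unitization_norm u * (unitization_norm v * norm b)"
      by (intro mult_left_mono norm_left_mult_le unitization_norm_nonneg)
    finally show "norm (left_mult (u * v) b) \<le> unitization_norm u * unitization_norm v * norm b"
      by (simp add: left_mult_mult mult.assoc)
  qed
  show "norm (r *\<^sub>R u) = \<bar>r\<bar> * norm u"
  proof -
    have le: "norm (t *\<^sub>R x) \<le> \<bar>t\<bar> * norm x" for t and x :: "'a unitization"
      unfolding norm_unitization_def
    proof (rule unitization_norm_leI)
      show "cmod (scalar_part (t *\<^sub>R x)) \<le> \<bar>t\<bar> * unitization_norm x"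
        by (simp add: scaleR_unitization_def mult_left_mono cmod_scalar_part_le)
      fix b
      have "left_mult (t *\<^sub>R x) b = t *\<^sub>R left_mult x b"
        by (simp add: left_mult_def scaleR_unitization_def scaleR_add_right scaleR_scaleC)
      then show "norm (left_mult (t *\<^sub>R x) b) \<le> \<bar>t\<bar> * unitization_norm x * norm b"
        by (simp add: mult.assoc mult_left_mono norm_left_mult_le)
    qed
    show ?thesis
    proof (cases "r = 0")
      case True
      then show ?thesis
        using le[of 0 u] unitization_norm_nonneg[of "0 *\<^sub>R u"]
        by (simp add: norm_unitization_def)
    next
      case False
      have "(1 / r) *\<^sub>R r *\<^sub>R u = u"
        using False by (simp add: scaleR_unitization_def unitization_eq_iff)
      then have "norm u \<le> \<bar>1 / r\<bar> * norm (r *\<^sub>R u)"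
        using le[of "1 / r" "r *\<^sub>R u"] by simp
      then have "\<bar>r\<bar> * norm u \<le> norm (r *\<^sub>R u)"
        using False by (simp add: field_simps)
      then show ?thesis
        using le[of r u] by simp
    qed
  qed
  show "norm (1 :: 'a unitization) = 1"
    unfolding norm_unitization_def
    by (intro antisym unitization_norm_leI order.trans[OF _ cmod_scalar_part_le])
      (simp_all add: left_mult_one)
qed

end

lemma unitization_sel_scaleR [simp]:
  "ideal_part (r *\<^sub>R u) = r *\<^sub>R ideal_part u" "scalar_part (r *\<^sub>R u) = r *\<^sub>R scalar_part u"
  by (simp_all add: scaleR_unitization_def)

lemma bounded_linear_ideal_part: "bounded_linear ideal_part"
  by (rule bounded_linear_intro[where K = 2])
    (use norm_ideal_part_le in \<open>simp_all add: norm_unitization_def mult.commute\<close>)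

lemma bounded_linear_scalar_part: "bounded_linear scalar_part"
  by (rule bounded_linear_intro[where K = 1])
    (use cmod_scalar_part_le in \<open>simp_all add: norm_unitization_def\<close>)

instance unitization :: (cstar_algebra) banach
proof
  fix X :: "nat \<Rightarrow> 'a unitization"
  assume X: "Cauchy X"
  obtain a \<alpha> where a: "(\<lambda>n. ideal_part (X n)) \<longlonglongrightarrow> a" and \<alpha>: "(\<lambda>n. scalar_part (X n)) \<longlonglongrightarrow> \<alpha>"
    using bounded_linear.Cauchy[OF bounded_linear_ideal_part X]
      bounded_linear.Cauchy[OF bounded_linear_scalar_part X]
    unfolding Cauchy_convergent_iff convergent_def by blast
  have "X \<longlonglongrightarrow> Unitization a \<alpha>"
  proof (rule LIM_zero_cancel, rule tendsto_0_le[where K = 1])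
    show "\<forall>\<^sub>F n in sequentially. norm (X n - Unitization a \<alpha>)
        \<le> norm (norm (ideal_part (X n) - a) + cmod (scalar_part (X n) - \<alpha>)) * 1"
      using unitization_norm_le[of "X _ - Unitization a \<alpha>"]
      by (intro always_eventually allI) (simp add: norm_unitization_def)
    show "(\<lambda>n. norm (ideal_part (X n) - a) + cmod (scalar_part (X n) - \<alpha>)) \<longlonglongrightarrow> 0"
      using tendsto_add[OF tendsto_norm_zero[OF LIM_zero[OF a]] tendsto_norm_zero[OF LIM_zero[OF \<alpha>]]]
      by simp
  qed
  then show "convergent X"
    by (auto simp: convergent_def)
qed

instantiation unitization :: (cstar_algebra) unital_cstar_algebra
begin

definition scaleC_unitization :: "complex \<Rightarrow> 'a unitization \<Rightarrow> 'a unitization"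
  where "scaleC c u = Unitization (scaleC c (ideal_part u)) (c * scalar_part u)"
definition star_unitization :: "'a unitization \<Rightarrow> 'a unitization"
  where "star u = Unitization (star (ideal_part u)) (cnj (scalar_part u))"

instance
proof
  fix u v :: "'a unitization" and c d :: complex and r :: real
  show "scaleC c (u + v) = scaleC c u + scaleC c v" "scaleC (c + d) u = scaleC c u + scaleC d u"
    "scaleC c (scaleC d u) = scaleC (c * d) u" "r *\<^sub>R u = scaleC (complex_of_real r) u"
    by (simp_all add: scaleC_unitization_def unitization_eq_iff scaleC_add_left scaleC_add_right
        scaleC_scaleC algebra_simps scaleC_of_real scaleR_conv_of_real[where 'a = complex])
  show "scaleC c u * v = scaleC c (u * v)" "u * scaleC c v = scaleC c (u * v)"
    by (simp_all add: scaleC_unitization_def unitization_eq_iff scaleC_add_right scaleC_scaleC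
        mult_scaleC_left mult_scaleC_right mult_ac)
  show star_star: "star (star u) = u" for u :: "'a unitization"
    by (simp add: star_unitization_def unitization_eq_iff star_star)
  show "star (u + v) = star u + star v" "star (scaleC c u) = scaleC (cnj c) (star u)"
    by (simp_all add: star_unitization_def scaleC_unitization_def unitization_eq_iff star_add
        star_scaleC)
  show "star (u * v) = star v * star u"
    by (simp add: star_unitization_def unitization_eq_iff star_add star_scaleC star_mult
        mult.commute add_ac)
  show "norm (scaleC c u) = cmod c * norm u"
  proof -
    have le: "norm (scaleC e x) \<le> cmod e * norm x" for e and x :: "'a unitization"
      unfolding norm_unitization_def
    proof (rule unitization_norm_leI)
      show "cmod (scalar_part (scaleC e x)) \<le> cmod e * unitization_norm x"
        by (simp add: scaleC_unitization_def norm_mult mult_left_mono cmod_scalar_part_le)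
      fix b
      have "left_mult (scaleC e x) b = scaleC e (left_mult x b)"
        by (simp add: left_mult_def scaleC_unitization_def scaleC_add_right scaleC_scaleC
            mult_scaleC_left)
      then show "norm (left_mult (scaleC e x) b) \<le> cmod e * unitization_norm x * norm b"
        by (simp add: norm_scaleC mult.assoc mult_left_mono norm_left_mult_le)
    qed
    show ?thesis
    proof (cases "c = 0")
      case True
      then show ?thesis
        using le[of 0 u] by simp
    next
      case False
      have "scaleC (1 / c) (scaleC c u) = u"
        using False by (simp add: scaleC_unitization_def unitization_eq_iff scaleC_scaleC)
      then have "norm u \<le> cmod (1 / c) * norm (scaleC c u)"
        using le[of "1 / c" "scaleC c u"] by simp
      then have "cmod c * norm u \<le> norm (scaleC c u)"
        using False by (simp add: norm_divide field_simps)
      then show ?thesis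
        using le[of c u] by simp
    qed
  qed
  show "norm (star u * u) = (norm u)\<^sup>2"
  proof -
    \<comment> \<open>This half suffices: with submultiplicativity it makes \<open>star\<close>
      isometric, and then the other half follows.\<close>
    have le: "(norm x)\<^sup>2 \<le> norm (star x * x)" for x :: "'a unitization"
    proof -
      let ?N = "norm (star x * x)"
      have "norm x \<le> sqrt ?N"
        unfolding norm_unitization_def
      proof (rule unitization_norm_leI)
        have "(cmod (scalar_part x))\<^sup>2 = cmod (scalar_part (star x * x))"
          by (simp add: star_unitization_def norm_mult power2_eq_square)
        also have "\<dots> \<le> unitization_norm (star x * x)"
          by (rule cmod_scalar_part_le)
        finally show "cmod (scalar_part x) \<le> sqrt (unitization_norm (star x * x))"
          by (rule real_le_rsqrt)
        fix b
        have "star (left_mult x b) * left_mult x b = star b * left_mult (star x * x) b"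
          by (simp add: left_mult_def star_unitization_def star_add star_mult star_scaleC
              algebra_simps mult_scaleC_left mult_scaleC_right scaleC_scaleC scaleC_add_right)
        then have "(norm (left_mult x b))\<^sup>2 = norm (star b * left_mult (star x * x) b)"
          by (metis cstar_identity)
        also have "\<dots> \<le> norm b * (unitization_norm (star x * x) * norm b)"
          using norm_mult_ineq[of "star b" "left_mult (star x * x) b"]
            mult_left_mono[OF norm_left_mult_le[of "star x * x" b] norm_ge_zero[of b]]
          by simp
        finally have "norm (left_mult x b) \<le> sqrt (unitization_norm (star x * x) * (norm b)\<^sup>2)"
          by (intro real_le_rsqrt) (simp add: power2_eq_square mult_ac)
        then show "norm (left_mult x b) \<le> sqrt (unitization_norm (star x * x)) * norm b"
          by (simp add: real_sqrt_mult)
      qed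
      then have "(norm x)\<^sup>2 \<le> (sqrt ?N)\<^sup>2"
        by (rule power_mono) simp
      then show ?thesis
        by simp
    qed
    have le_star: "norm x \<le> norm (star x)" for x :: "'a unitization"
    proof (cases "norm x = 0")
      case False
      have "norm x * norm x \<le> norm (star x) * norm x"
        using le[of x] norm_mult_ineq[of "star x" x] by (simp add: power2_eq_square)
      then show ?thesis
        using False by simp
    qed simp
    have "norm (star u) = norm u"
      using le_star[of u] le_star[of "star u"] by (simp add: star_star)
    then show ?thesis
      using le[of u] norm_mult_ineq[of "star u" u] by (simp add: power2_eq_square)
  qed
qed

end

definition embed :: "'a \<Rightarrow> 'a::cstar_algebra unitization"
  where "embed a = Unitization a 0"

lemma embed_sel [simp]: "ideal_part (embed a) = a" "scalar_part (embed a) = 0"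
  by (simp_all add: embed_def)

lemma embed_simps:
  "embed 0 = (0 :: 'a::cstar_algebra unitization)"
  "embed (a + b) = embed a + embed (b :: 'a)"
  "embed (a - b) = embed a - embed (b :: 'a)"
  "embed (a * b) = embed a * embed (b :: 'a)"
  "embed (star a) = star (embed (a :: 'a))"
  "embed (r *\<^sub>R a) = r *\<^sub>R embed (a :: 'a)"
  "embed (scaleC c a) = scaleC c (embed (a :: 'a))"
  by (simp_all add: unitization_eq_iff star_unitization_def scaleC_unitization_def)

lemma embed_ideal_part: "scalar_part u = 0 \<Longrightarrow> embed (ideal_part u) = u"
  by (simp add: unitization_eq_iff)

lemma norm_embed [simp]: "norm (embed a) = norm (a::'a::cstar_algebra)"
proof (rule antisym)
  show "norm (embed a) \<le> norm a"
    using unitization_norm_le[of "embed a"] by (simp add: norm_unitization_def)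
  show "norm a \<le> norm (embed a)"
  proof (rule norm_le_of_left_mult)
    show "norm (a * b) \<le> norm (embed a) * norm b" for b
      using norm_left_mult_le[of "embed a" b] by (simp add: norm_unitization_def left_mult_def)
  qed simp
qed

section \<open>Order and matrices over a C*-algebra\<close>

definition below_pos :: "'a::cstar_algebra \<Rightarrow> 'a \<Rightarrow> bool"  (infix "\<preceq>" 50)
  where "p \<preceq> q \<longleftrightarrow> pos (embed (q - p))"

lemma below_pos_refl [simp]: "p \<preceq> p"
  by (simp add: below_pos_def embed_simps)

lemma below_pos_trans [trans]: "p \<preceq> q \<Longrightarrow> q \<preceq> r \<Longrightarrow> p \<preceq> r"
  using pos_add[of "embed (q - p)" "embed (r - q)"] by (simp add: below_pos_def embed_simps)

lemma below_pos_add: "p \<preceq> q \<Longrightarrow> r \<preceq> s \<Longrightarrow> p + r \<preceq> q + s"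
  using pos_add[of "embed (q - p)" "embed (s - r)"]
  by (simp add: below_pos_def embed_simps algebra_simps)

lemma below_pos_sum: "(\<And>i. i \<in> I \<Longrightarrow> f i \<preceq> g i) \<Longrightarrow> (\<Sum>i\<in>I. f i) \<preceq> (\<Sum>i\<in>I. g i)"
  by (induction I rule: infinite_finite_induct) (simp_all add: below_pos_add)

lemma below_pos_scaleR: "p \<preceq> q \<Longrightarrow> r \<ge> 0 \<Longrightarrow> r *\<^sub>R p \<preceq> r *\<^sub>R q"
  using pos_scaleR[of "embed (q - p)" r] by (simp add: below_pos_def embed_simps scaleR_diff_right)

lemma below_pos_scaleR_mono: "0 \<preceq> p \<Longrightarrow> r \<le> s \<Longrightarrow> r *\<^sub>R p \<preceq> s *\<^sub>R p"
  using pos_scaleR[of "embed p" "s - r"]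
  by (simp add: below_pos_def embed_simps scaleR_diff_left)

lemma star_mult_self_ge_0: "0 \<preceq> star x * x"
  using pos_star_mult[of "embed x"] by (simp add: below_pos_def embed_simps)

lemma below_pos_norm:
  assumes "0 \<preceq> p" "p \<preceq> q"
  shows "norm p \<le> 2 * norm q"
  using pos_norm_mono[of "embed p" "embed (q - p)"] assms
  by (simp add: below_pos_def embed_simps(2)[symmetric])

lemma below_pos_zero_add: "0 \<preceq> q \<Longrightarrow> p \<preceq> p + q"
  by (simp add: below_pos_def)

lemma star_mult_mult_below: "star (x * y) * (x * y) \<preceq> (norm x)\<^sup>2 *\<^sub>R (star y * y)"
proof -
  have "pos (of_real (norm (star x * x)) - embed (star x * x))"
    using pos_norm_minus[of "embed (star x * x)"]
    by (simp add: star_mult star_star embed_simps(5)[symmetric])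
  from pos_compress[OF this, of "embed y"]
  have "pos (star (embed y) * (of_real ((norm x)\<^sup>2) - embed (star x * x)) * embed y)"
    by (simp add: cstar_identity)
  moreover have "star (embed y) * (of_real ((norm x)\<^sup>2) - embed (star x * x)) * embed y
      = embed ((norm x)\<^sup>2 *\<^sub>R (star y * y) - star (x * y) * (x * y))"
    by (simp add: embed_simps star_mult left_diff_distrib right_diff_distrib mult.assoc of_real_def)
  ultimately show ?thesis
    by (simp add: below_pos_def)
qed

lemma sum_star_mult_self_ge_0: "0 \<preceq> (\<Sum>i\<in>I. star (x i) * x i)"
  using below_pos_sum[of I "\<lambda>_. 0" "\<lambda>i. star (x i) * x i"] by (simp add: star_mult_self_ge_0)

lemma norm_component_le:
  assumes "finite I" "i \<in> I"
  shows "(norm (x i))\<^sup>2 \<le> 2 * norm (\<Sum>i\<in>I. star (x i) * x i)"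
proof -
  have "star (x i) * x i \<preceq> star (x i) * x i + (\<Sum>j\<in>I - {i}. star (x j) * x j)"
    by (intro below_pos_zero_add sum_star_mult_self_ge_0)
  also have "\<dots> = (\<Sum>j\<in>I. star (x j) * x j)"
    using assms by (simp add: sum.remove)
  finally show ?thesis
    using below_pos_norm[OF star_mult_self_ge_0, of "x i"] by (simp add: cstar_identity)
qed

lemma sum_star_mult_self_eq_0D:
  assumes "(\<Sum>i\<in>I. star (x i) * x i) = 0" "finite I" "i \<in> I"
  shows "x i = 0"
  using norm_component_le[of I i x] assms by simp

text \<open>A Cauchy-Schwarz inequality with values in the algebra: summing
  \<open>star (z i - z j) * (z i - z j)\<close> over all pairs gives twice the difference of the two
  sides.\<close>

lemma star_sum_mult_sum_below:
  "star (\<Sum>j<k. z j) * (\<Sum>j<k. z j) \<preceq> real k *\<^sub>R (\<Sum>j<k. star (z j) * z j)"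
proof -
  let ?S = "\<Sum>j<k. star (z j) * z j" and ?z = "\<Sum>j<k. z j"
  have "(\<Sum>i<k. \<Sum>j<k. star (z i - z j) * (z i - z j)) = 2 *\<^sub>R (real k *\<^sub>R ?S - star ?z * ?z)"
    by (simp add: star_diff algebra_simps sum.distrib sum_subtractf sum_distrib_left[symmetric]
        sum_distrib_right[symmetric] star_sum scaleR_2 sum_constant_scaleR
        scaleR_sum_right[symmetric]) (simp add: scaleR_add_left[symmetric])
  moreover have "0 \<preceq> (\<Sum>i<k. \<Sum>j<k. star (z i - z j) * (z i - z j))"
    using below_pos_sum[of "{..<k}" "\<lambda>_. 0" "\<lambda>i. \<Sum>j<k. star (z i - z j) * (z i - z j)"]
    by (simp add: sum_star_mult_self_ge_0)
  ultimately have "0 \<preceq> 2 *\<^sub>R (real k *\<^sub>R ?S - star ?z * ?z)"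
    by simp
  from below_pos_scaleR[OF this, of "1/2"] show ?thesis
    by (simp add: below_pos_def)
qed

text \<open>\<open>k \<times> k\<close> matrices are represented by functions whose values outside the index range are
  irrelevant; \<open>mm k\<close> contracts over the indices below \<open>k\<close>.\<close>

definition mm :: "nat \<Rightarrow> (nat \<Rightarrow> nat \<Rightarrow> 'a) \<Rightarrow> (nat \<Rightarrow> nat \<Rightarrow> 'a) \<Rightarrow> nat \<Rightarrow> nat \<Rightarrow> 'a::cstar_algebra"
  where "mm k f g = (\<lambda>i j. \<Sum>p<k. f i p * g p j)"

definition ms :: "(nat \<Rightarrow> nat \<Rightarrow> 'a) \<Rightarrow> nat \<Rightarrow> nat \<Rightarrow> 'a::cstar_algebra"
  where "ms f = (\<lambda>i j. star (f j i))"

lemma mm_assoc: "mm m (mm k f g) h = mm k f (mm m g h)"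
proof (intro ext)
  fix i j
  have "(\<Sum>p<m. \<Sum>q<k. f i q * (g q p * h p j)) = (\<Sum>q<k. \<Sum>p<m. f i q * (g q p * h p j))"
    by (rule sum.swap)
  then show "mm m (mm k f g) h i j = mm k f (mm m g h) i j"
    by (simp add: mm_def sum_distrib_left sum_distrib_right mult.assoc)
qed

lemma mm_add_left: "mm k (f + g) h = mm k f h + mm k g h"
  by (simp add: mm_def fun_eq_iff distrib_right sum.distrib)

lemma mm_add_right: "mm k h (f + g) = mm k h f + mm k h g"
  by (simp add: mm_def fun_eq_iff distrib_left sum.distrib)

lemma mm_diff_left: "mm k (f - g) h = mm k f h - mm k g h"
  by (simp add: mm_def fun_eq_iff left_diff_distrib sum_subtractf)

lemma mm_diff_right: "mm k h (f - g) = mm k h f - mm k h g"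
  by (simp add: mm_def fun_eq_iff right_diff_distrib sum_subtractf)

lemma mm_zero [simp]: "mm k 0 f = 0" "mm k f 0 = 0"
  by (simp_all add: mm_def fun_eq_iff)

lemma ms_add: "ms (f + g) = ms f + ms g"
  by (simp add: ms_def fun_eq_iff star_add)

lemma ms_diff: "ms (f - g) = ms f - ms g"
  by (simp add: ms_def fun_eq_iff star_diff)

lemma ms_zero [simp]: "ms 0 = 0"
  by (simp add: ms_def fun_eq_iff)

lemma ms_mm: "ms (mm k f g) = mm k (ms g) (ms f)"
  by (simp add: ms_def mm_def fun_eq_iff star_sum star_mult)

lemma ms_ms [simp]: "ms (ms f) = f"
  by (simp add: ms_def fun_eq_iff star_star)

lemma mm_scaleR:
  "mm k (\<lambda>i j. c *\<^sub>R f i j) g = (\<lambda>i j. c *\<^sub>R mm k f g i j)"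
  "mm k g (\<lambda>i j. c *\<^sub>R f i j) = (\<lambda>i j. c *\<^sub>R mm k g f i j)"
  by (simp_all add: mm_def scaleR_sum_right)

lemma ms_scaleR: "ms (\<lambda>i j. c *\<^sub>R f i j) = (\<lambda>i j. c *\<^sub>R ms f i j)"
  by (simp add: ms_def star_scaleR)

section \<open>The Hilbert module of columns of length k\<close>

definition mv :: "nat \<Rightarrow> (nat \<Rightarrow> nat \<Rightarrow> 'a) \<Rightarrow> (nat \<Rightarrow> 'a) \<Rightarrow> nat \<Rightarrow> 'a::cstar_algebra"
  where "mv k f \<xi> = (\<lambda>i. \<Sum>p<k. f i p * \<xi> p)"

definition ip :: "nat \<Rightarrow> (nat \<Rightarrow> 'a) \<Rightarrow> (nat \<Rightarrow> 'a) \<Rightarrow> 'a::cstar_algebra"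
  where "ip k \<xi> \<eta> = (\<Sum>i<k. star (\<xi> i) * \<eta> i)"

lemma mv_mm: "mv k (mm k f g) \<xi> = mv k f (mv k g \<xi>)"
proof
  fix i
  have "(\<Sum>p<k. \<Sum>q<k. f i q * (g q p * \<xi> p)) = (\<Sum>q<k. \<Sum>p<k. f i q * (g q p * \<xi> p))"
    by (rule sum.swap)
  then show "mv k (mm k f g) \<xi> i = mv k f (mv k g \<xi>) i"
    by (simp add: mv_def mm_def sum_distrib_left sum_distrib_right mult.assoc)
qed

lemma mv_diff: "mv k (f - g) \<xi> = mv k f \<xi> - mv k g \<xi>"
  by (simp add: mv_def fun_eq_iff left_diff_distrib sum_subtractf)

lemma mv_diff_right: "mv k f (\<xi> - \<eta>) = mv k f \<xi> - mv k f \<eta>"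
  by (simp add: mv_def fun_eq_iff right_diff_distrib sum_subtractf)

lemma ip_diff_left: "ip k (\<xi> - \<eta>) \<zeta> = ip k \<xi> \<zeta> - ip k \<eta> \<zeta>"
  by (simp add: ip_def star_diff left_diff_distrib sum_subtractf)

lemma ip_diff_right: "ip k \<zeta> (\<xi> - \<eta>) = ip k \<zeta> \<xi> - ip k \<zeta> \<eta>"
  by (simp add: ip_def right_diff_distrib sum_subtractf)

lemmas fun_apply_simps = plus_fun_apply minus_apply zero_fun_apply

declare fun_apply_simps [simp del]

lemma ip_mv: "ip k \<xi> (mv k f \<eta>) = ip k (mv k (ms f) \<xi>) \<eta>"
proof -
  have "(\<Sum>i<k. \<Sum>p<k. star (\<xi> i) * (f i p * \<eta> p)) = (\<Sum>p<k. \<Sum>i<k. star (\<xi> i) * (f i p * \<eta> p))"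
    by (rule sum.swap)
  then show ?thesis
    by (simp add: ip_def mv_def ms_def sum_distrib_left sum_distrib_right star_sum star_mult star_star
        mult.assoc)
qed

lemma ip_self_ge_0: "0 \<preceq> ip k \<xi> \<xi>"
  unfolding ip_def by (rule sum_star_mult_self_ge_0)

text \<open>The entrywise bound stands in for an operator norm bound: by Cauchy-Schwarz each row
  contributes at most k (1/k)^2 times the inner product, and there are k rows.\<close>

lemma mv_contraction:
  assumes "\<And>i j. i < k \<Longrightarrow> j < k \<Longrightarrow> norm (f i j) \<le> 1 / real k"
  shows "ip k (mv k f \<xi>) (mv k f \<xi>) \<preceq> ip k \<xi> \<xi>"
proof -
  have row: "star (mv k f \<xi> i) * mv k f \<xi> i \<preceq> (1 / real k) *\<^sub>R ip k \<xi> \<xi>" if i: "i < k" for i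
  proof -
    have "star (mv k f \<xi> i) * mv k f \<xi> i
        \<preceq> real k *\<^sub>R (\<Sum>j<k. star (f i j * \<xi> j) * (f i j * \<xi> j))"
      unfolding mv_def by (rule star_sum_mult_sum_below)
    also have "\<dots> \<preceq> real k *\<^sub>R (\<Sum>j<k. (1 / real k)\<^sup>2 *\<^sub>R (star (\<xi> j) * \<xi> j))"
    proof (intro below_pos_scaleR below_pos_sum)
      fix j
      assume "j \<in> {..<k}"
      then have "(norm (f i j))\<^sup>2 \<le> (1 / real k)\<^sup>2"
        using assms[OF i] by (intro power_mono) auto
      then show "star (f i j * \<xi> j) * (f i j * \<xi> j) \<preceq> (1 / real k)\<^sup>2 *\<^sub>R (star (\<xi> j) * \<xi> j)"
        using star_mult_mult_below below_pos_scaleR_mono[OF star_mult_self_ge_0] below_pos_trans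
        by blast
    qed simp
    also have "\<dots> = (1 / real k) *\<^sub>R ip k \<xi> \<xi>"
      using i by (simp add: ip_def scaleR_sum_right[symmetric] power2_eq_square)
    finally show ?thesis .
  qed
  have "ip k (mv k f \<xi>) (mv k f \<xi>) \<preceq> (\<Sum>i<k. (1 / real k) *\<^sub>R ip k \<xi> \<xi>)"
    unfolding ip_def[of k "mv k f \<xi>"] by (intro below_pos_sum row) simp
  also have "\<dots> = ip k \<xi> \<xi>"
    by (cases "k = 0") (simp_all add: ip_def sum_constant_scaleR del: sum_constant)
  finally show ?thesis .
qed

text \<open>For a self-adjoint contraction \<open>T\<close> the inner products \<open>g n = \<langle>T\<xi>\<^sub>n, T\<xi>\<^sub>n\<rangle>\<close> with
  \<open>\<xi>\<^sub>n = (1 - T\<^sup>2)\<^sup>n \<xi>\<close> decrease and have sum at most \<open>\<langle>\<xi>, \<xi>\<rangle>\<close>, so \<open>n g n \<preceq> \<langle>\<xi>, \<xi>\<rangle>\<close>.\<close>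

lemma mv_decay:
  fixes u :: "nat \<Rightarrow> nat \<Rightarrow> 'a::cstar_algebra"
  assumes sa: "ms u = u" and contr: "\<And>i j. i < k \<Longrightarrow> j < k \<Longrightarrow> norm (u i j) \<le> 1 / real k"
  defines "T \<equiv> mv k u"
  defines "D \<equiv> \<lambda>\<xi>. \<xi> - T (T \<xi>)"
  shows "real n *\<^sub>R ip k (T ((D ^^ n) \<xi>)) (T ((D ^^ n) \<xi>)) \<preceq> ip k \<xi> \<xi>"
proof -
  have T_contr: "ip k (T \<eta>) (T \<eta>) \<preceq> ip k \<eta> \<eta>" for \<eta>
    unfolding T_def by (rule mv_contraction) (rule contr)
  have T_sa: "ip k \<xi> (T \<eta>) = ip k (T \<xi>) \<eta>" for \<xi> \<eta>
    unfolding T_def by (subst ip_mv) (simp add: sa)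
  have TD: "T (D \<eta>) = D (T \<eta>)" for \<eta>
    by (simp add: D_def T_def mv_diff_right)
  \<comment> \<open>For T a number \<lambda> in [-1, 1] this is \<lambda>^2 + (1 - \<lambda>^2)^2
    \<le> 1.\<close>
  have drop: "ip k (T \<eta>) (T \<eta>) + ip k (D \<eta>) (D \<eta>) \<preceq> ip k \<eta> \<eta>" for \<eta>
  proof -
    have "ip k (D \<eta>) (D \<eta>)
        = ip k \<eta> \<eta> - ip k (T \<eta>) (T \<eta>) - ip k (T \<eta>) (T \<eta>) + ip k (T (T \<eta>)) (T (T \<eta>))"
      by (simp add: D_def ip_diff_left ip_diff_right T_sa[of \<eta> "T \<eta>"] T_sa[of "T (T \<eta>)", symmetric]
          T_sa[of "T \<eta>" \<eta>, symmetric])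
    then have "ip k \<eta> \<eta> - (ip k (T \<eta>) (T \<eta>) + ip k (D \<eta>) (D \<eta>))
        = ip k (T \<eta>) (T \<eta>) - ip k (T (T \<eta>)) (T (T \<eta>))"
      by (simp add: algebra_simps)
    then show ?thesis
      using T_contr[of "T \<eta>"] by (simp add: below_pos_def)
  qed
  define g where "g n = ip k (T ((D ^^ n) \<xi>)) (T ((D ^^ n) \<xi>))" for n
  have D_le: "ip k (D \<eta>) (D \<eta>) \<preceq> ip k \<eta> \<eta>" for \<eta>
    using below_pos_trans[OF below_pos_zero_add[OF ip_self_ge_0[of k "T \<eta>"], of "ip k (D \<eta>) (D \<eta>)"]]
      drop[of \<eta>] by (simp add: add.commute)
  have g_dec: "g (Suc n) \<preceq> g n" for n
    by (simp add: g_def TD D_le)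
  have "real n *\<^sub>R g n + ip k ((D ^^ n) \<xi>) ((D ^^ n) \<xi>) \<preceq> ip k \<xi> \<xi>"
  proof (induction n)
    case (Suc n)
    have "real (Suc n) *\<^sub>R g (Suc n) + ip k ((D ^^ Suc n) \<xi>) ((D ^^ Suc n) \<xi>)
        \<preceq> real (Suc n) *\<^sub>R g n + ip k ((D ^^ Suc n) \<xi>) ((D ^^ Suc n) \<xi>)"
      by (intro below_pos_add below_pos_scaleR g_dec) simp_all
    also have "\<dots> = real n *\<^sub>R g n + (g n + ip k (D ((D ^^ n) \<xi>)) (D ((D ^^ n) \<xi>)))"
      by (simp add: scaleR_add_left algebra_simps)
    also have "\<dots> \<preceq> real n *\<^sub>R g n + ip k ((D ^^ n) \<xi>) ((D ^^ n) \<xi>)"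
      unfolding g_def by (intro below_pos_add drop below_pos_refl)
    finally show ?case
      using Suc by (rule below_pos_trans)
  qed simp
  then have "real n *\<^sub>R g n \<preceq> ip k \<xi> \<xi>"
    using below_pos_trans[OF below_pos_zero_add[OF ip_self_ge_0]] by blast
  then show ?thesis
    by (simp add: g_def)
qed

section \<open>Approximate inverses and Cuntz comparison with the cube\<close>

text \<open>\<open>u * approx_inv k u n = 1 - (1 - u\<^sup>2)\<^sup>n\<close>.\<close>

primrec approx_inv :: "nat \<Rightarrow> (nat \<Rightarrow> nat \<Rightarrow> 'a) \<Rightarrow> nat \<Rightarrow> nat \<Rightarrow> nat \<Rightarrow> 'a::cstar_algebra" where
  "approx_inv k u 0 = 0"
| "approx_inv k u (Suc n) = approx_inv k u n + u - mm k u (mm k u (approx_inv k u n))"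

text \<open>This is u (1 - u^2)^n, written without an identity matrix, which need not exist over a
  non-unital algebra.\<close>

definition residual :: "nat \<Rightarrow> (nat \<Rightarrow> nat \<Rightarrow> 'a) \<Rightarrow> nat \<Rightarrow> nat \<Rightarrow> nat \<Rightarrow> 'a::cstar_algebra"
  where "residual k u n = u - mm k u (mm k u (approx_inv k u n))"

lemma approx_inv_commute: "mm k (approx_inv k u n) u = mm k u (approx_inv k u n)"
proof (induction n)
  case (Suc n)
  then have "mm k (mm k u (mm k u (approx_inv k u n))) u = mm k u (mm k u (mm k u (approx_inv k u n)))"
    by (simp add: mm_assoc)
  with Suc show ?case
    by (simp add: mm_add_left mm_add_right mm_diff_left mm_diff_right)
qed simp

lemma ms_approx_inv:
  assumes "ms u = u"
  shows "ms (approx_inv k u n) = approx_inv k u n"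
proof (induction n)
  case (Suc n)
  then have "ms (mm k u (mm k u (approx_inv k u n))) = mm k (mm k (approx_inv k u n) u) u"
    by (simp add: ms_mm assms)
  also have "\<dots> = mm k u (mm k u (approx_inv k u n))"
    by (simp add: approx_inv_commute mm_assoc)
  finally show ?case
    by (simp add: ms_add ms_diff assms Suc)
qed simp

lemma residual_Suc: "residual k u (Suc n) = residual k u n - mm k u (mm k u (residual k u n))"
  by (simp add: residual_def mm_add_right mm_diff_right)

lemma residual_commute: "mm k (residual k u n) u = mm k u (residual k u n)"
  by (simp add: residual_def mm_diff_left mm_diff_right mm_assoc approx_inv_commute)

text \<open>With y the n-th approximate inverse, 1 - u y is (1 - u^2)^n, so this is the addition of
  exponents, phrased so that the unit never stands alone.\<close>

lemma residual_add:
  "residual k u m - mm k (residual k u m) (mm k u (approx_inv k u n)) = residual k u (m + n)"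
proof (induction n)
  case (Suc n)
  let ?R = "residual k u m" and ?y = "approx_inv k u n"
  have comm: "mm k ?R (mm k u x) = mm k u (mm k ?R x)" for x
    by (simp only: mm_assoc[symmetric] residual_commute)
  have "mm k ?R (mm k u u) = mm k u (mm k u ?R)"
    by (simp only: comm residual_commute)
  moreover have "mm k ?R (mm k u (mm k u (mm k u ?y))) = mm k u (mm k u (mm k ?R (mm k u ?y)))"
    by (simp only: comm)
  ultimately have "?R - mm k ?R (mm k u (approx_inv k u (Suc n)))
      = (?R - mm k ?R (mm k u ?y)) - mm k u (mm k u (?R - mm k ?R (mm k u ?y)))"
    by (simp add: mm_add_right mm_diff_right algebra_simps)
  then show ?case
    by (simp add: Suc residual_Suc)
qed simp

lemma mv_residual:
  fixes u :: "nat \<Rightarrow> nat \<Rightarrow> 'a::cstar_algebra" and k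
  defines "D \<equiv> \<lambda>\<xi>. \<xi> - mv k u (mv k u \<xi>)"
  shows "mv k (residual k u n) \<xi> = mv k u ((D ^^ n) \<xi>)"
proof (induction n)
  case 0
  then show ?case
    by (simp add: residual_def)
next
  case (Suc n)
  then show ?case
    by (simp add: residual_Suc mv_diff mv_mm D_def mv_diff_right)
qed

text \<open>The residual is tested on the column whose only entry is b =
  \<open>star (?R i j)\<close> at position j: the i-th component of its image has norm (norm b)^2.
  The decay estimate then gives n (norm b)^4 \<le> 4 (norm b)^2, the 4 being one factor 2 from
  monotonicity of the norm and one from picking a component.\<close>

lemma norm_residual_le:
  fixes u :: "nat \<Rightarrow> nat \<Rightarrow> 'a::cstar_algebra"
  assumes sa: "ms u = u" and contr: "\<And>i j. i < k \<Longrightarrow> j < k \<Longrightarrow> norm (u i j) \<le> 1 / real k"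
    and ij: "i < k" "j < k" and n: "n > 0"
  shows "(norm (residual k u n i j))\<^sup>2 \<le> 4 / real n"
proof -
  let ?R = "residual k u n"
  define b where "b = star (?R i j)"
  define \<xi> where "\<xi> p = (if p = j then b else 0)" for p
  have mv: "mv k ?R \<xi> i = ?R i j * b"
    using ij by (simp add: mv_def \<xi>_def if_distrib cong: if_cong)
  have ip: "ip k \<xi> \<xi> = star b * b"
    using ij by (simp add: ip_def \<xi>_def if_distrib cong: if_cong)
  define q where "q = ip k (mv k ?R \<xi>) (mv k ?R \<xi>)"
  have "real n *\<^sub>R q \<preceq> ip k \<xi> \<xi>"
    unfolding q_def mv_residual by (rule mv_decay[OF sa contr])
  moreover have "0 \<preceq> real n *\<^sub>R q"
    using below_pos_scaleR[OF ip_self_ge_0, of "real n"] by (simp add: q_def)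
  ultimately have "real n * norm q \<le> 2 * (norm b)\<^sup>2"
    using below_pos_norm[of "real n *\<^sub>R q" "star b * b"] by (simp add: ip cstar_identity)
  moreover have "(norm (?R i j * b))\<^sup>2 \<le> 2 * norm q"
    using norm_component_le[of "{..<k}" i "mv k ?R \<xi>"] ij unfolding q_def ip_def mv by simp
  moreover have "norm (?R i j * b) = (norm b)\<^sup>2"
    using cstar_identity[of b] by (simp add: b_def star_star)
  ultimately have "real n * ((norm b)\<^sup>2)\<^sup>2 \<le> 4 * (norm b)\<^sup>2"
    using mult_left_mono[of "((norm b)\<^sup>2)\<^sup>2" "2 * norm q" "real n"] by simp
  then have "real n * (norm b)\<^sup>2 \<le> 4"
    by (cases "norm b = 0") (simp_all add: power2_eq_square)
  then show ?thesis
    using n by (simp add: b_def field_simps)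
qed

lemma residual_small:
  fixes u :: "nat \<Rightarrow> nat \<Rightarrow> 'a::cstar_algebra"
  assumes sa: "ms u = u" and contr: "\<And>i j. i < k \<Longrightarrow> j < k \<Longrightarrow> norm (u i j) \<le> 1 / real k"
    and \<epsilon>: "\<epsilon> > 0"
  obtains N where "\<And>n i j. n \<ge> N \<Longrightarrow> i < k \<Longrightarrow> j < k \<Longrightarrow> norm (residual k u n i j) < \<epsilon>"
proof -
  obtain N :: nat where N: "4 / \<epsilon>\<^sup>2 < real N"
    using reals_Archimedean2 by blast
  show ?thesis
  proof
    fix n i j
    assume n: "N \<le> n" and ij: "i < k" "j < k"
    have "0 < real N"
      using N \<epsilon> by (meson divide_pos_pos less_trans zero_less_numeral zero_less_power)
    then have "4 / real n < \<epsilon>\<^sup>2"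
      using N \<epsilon> n by (simp add: field_simps) (smt (verit) mult_right_mono of_nat_mono zero_less_power)
    then have "(norm (residual k u n i j))\<^sup>2 < \<epsilon>\<^sup>2"
      using norm_residual_le[OF sa contr ij, of n] n \<open>0 < real N\<close> by simp
    then show "norm (residual k u n i j) < \<epsilon>"
      using \<epsilon> by (simp add: power2_less_imp_less)
  qed
qed

text \<open>The approximate inverse y of u = c t nearly cancels two of the three factors: y u^3 y =
  u - 2 R_N + R_2N, where R_n denotes the residual of order n, and residuals become small.\<close>

lemma cube_approximation:
  fixes t :: "nat \<Rightarrow> nat \<Rightarrow> 'a::cstar_algebra"
  assumes sa: "ms t = t" and \<epsilon>: "\<epsilon> > 0"
  obtains y where "\<forall>i<k. \<forall>j<k.
    norm (mm k (ms y) (mm k (mm k t (mm k t t)) y) i j - t i j) < \<epsilon>"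
proof -
  define M where "M = 1 + (\<Sum>i<k. \<Sum>j<k. norm (t i j))"
  have norm_t: "norm (t i j) \<le> M" if "i < k" "j < k" for i j
  proof -
    have "norm (t i j) \<le> (\<Sum>j<k. norm (t i j))"
      using that by (intro member_le_sum) auto
    also have "\<dots> \<le> (\<Sum>i<k. \<Sum>j<k. norm (t i j))"
      using that by (intro member_le_sum[of i _ "\<lambda>i. \<Sum>j<k. norm (t i j)"] sum_nonneg) auto
    finally show ?thesis
      by (simp add: M_def)
  qed
  have M0: "M > 0"
    unfolding M_def by (intro add_pos_nonneg sum_nonneg) auto
  show ?thesis
  proof (cases "k = 0")
    case True
    then show ?thesis
      using that by simp
  next
    case False
    \<comment> \<open>M bounds all entries of t, so this scaling brings those of u down to 1/k, as
      the decay estimate requires; the 1 in M keeps it positive for t = 0.\<close>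
    define c where "c = 1 / (M * real k)"
    have c: "c > 0"
      using M0 False by (simp add: c_def)
    define u where "u = (\<lambda>i j. c *\<^sub>R t i j)"
    have ms_u: "ms u = u"
      using sa by (simp add: u_def ms_def fun_eq_iff star_scaleR)
    have contr: "norm (u i j) \<le> 1 / real k" if "i < k" "j < k" for i j
      using norm_t[OF that] M0 False by (simp add: u_def c_def field_simps)
    have "c * \<epsilon> / 3 > 0"
      using c \<epsilon> by simp
    from residual_small[OF ms_u contr this] obtain N
      where N: "\<And>n i j. n \<ge> N \<Longrightarrow> i < k \<Longrightarrow> j < k \<Longrightarrow> norm (residual k u n i j) < c * \<epsilon> / 3"
      by blast
    let ?y = "approx_inv k u N" and ?R = "residual k u"
    have RE: "mm k (?R N) (mm k u ?y) = ?R N - ?R (N + N)"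
      using residual_add[of k u N N] by (simp add: algebra_simps)
    have "mm k ?y (mm k u x) = mm k u (mm k ?y x)" for x
      by (simp only: mm_assoc[symmetric] approx_inv_commute)
    then have "mm k (ms ?y) (mm k (mm k u (mm k u u)) ?y) = mm k (mm k u (mm k u ?y)) (mm k u ?y)"
      by (simp only: ms_approx_inv[OF ms_u] mm_assoc)
    also have "\<dots> = u - ?R N - mm k (?R N) (mm k u ?y)"
    proof -
      have "mm k u (mm k u ?y) = u - ?R N"
        by (simp add: residual_def)
      then show ?thesis
        by (simp add: mm_diff_left)
    qed
    finally have eq: "mm k (ms ?y) (mm k (mm k u (mm k u u)) ?y) = u - (?R N + ?R N - ?R (N + N))"
      unfolding RE by (simp add: algebra_simps)
    have small: "norm (mm k (ms ?y) (mm k (mm k u (mm k u u)) ?y) i j - u i j) < c * \<epsilon>"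
      if ij: "i < k" "j < k" for i j
    proof -
      have "norm (mm k (ms ?y) (mm k (mm k u (mm k u u)) ?y) i j - u i j)
          = norm (?R N i j + ?R N i j - ?R (N + N) i j)"
        unfolding eq by (simp add: fun_apply_simps norm_minus_commute)
      also have "\<dots> \<le> norm (?R N i j) + norm (?R N i j) + norm (?R (N + N) i j)"
        by (meson add_mono norm_triangle_ineq norm_triangle_ineq4 order.refl order.trans)
      also have "\<dots> < c * \<epsilon>"
        using N[of N i j] N[of "N + N" i j] ij by simp
      finally show ?thesis .
    qed
    \<comment> \<open>Of the three factors c in u^3, two are absorbed into z and the third is
      divided out.\<close>
    define z where "z = (\<lambda>i j. c *\<^sub>R ?y i j)"
    have "norm (mm k (ms z) (mm k (mm k t (mm k t t)) z) i j - t i j) < \<epsilon>"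
      if ij: "i < k" "j < k" for i j
    proof -
      have "mm k (ms ?y) (mm k (mm k u (mm k u u)) ?y) i j
          = c *\<^sub>R mm k (ms z) (mm k (mm k t (mm k t t)) z) i j"
        unfolding u_def z_def by (simp only: mm_scaleR ms_scaleR scaleR_scaleR mult_ac)
      then have "norm (c *\<^sub>R (mm k (ms z) (mm k (mm k t (mm k t t)) z) i j - t i j)) < c * \<epsilon>"
        using small[OF ij] by (simp add: u_def scaleR_diff_right)
      then show ?thesis
        using c by simp
    qed
    then show ?thesis
      by (intro that[of z]) blast
  qed
qed

text \<open>For x nonzero let u be the positive multiple of \<open>x * star x\<close> of norm one
  and e = 1 - (1 - u^2)^N, which lies in the algebra. The residual of order 2N is (1 - e) u (1 - e),
  a multiple of \<open>(x - e * x) * star (x - e * x)\<close>, so its smallness is that of the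
  squared norm of x - e x.\<close>

lemma approximate_left_unit:
  fixes x :: "'a::cstar_algebra"
  assumes \<epsilon>: "\<epsilon> > 0"
  obtains e where "norm (x - e * x) < \<epsilon>"
proof (cases "x = 0")
  case True
  then show ?thesis
    using that[of 0] \<epsilon> by simp
next
  case False
  define c where "c = 1 / (norm x)\<^sup>2"
  have c: "c > 0"
    using False by (simp add: c_def)
  define u :: "nat \<Rightarrow> nat \<Rightarrow> 'a" where "u = (\<lambda>i j. c *\<^sub>R (x * star x))"
  have ms_u: "ms u = u"
    by (simp add: u_def ms_def star_scaleR star_mult star_star)
  have contr: "norm (u i j) \<le> 1 / real 1" if "i < 1" "j < 1" for i j
    using False cstar_identity[of "star x"] by (simp add: u_def c_def star_star)
  have "c * \<epsilon>\<^sup>2 > 0"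
    using c \<epsilon> by simp
  from residual_small[OF ms_u contr this] obtain N
    where N: "\<And>n i j. n \<ge> N \<Longrightarrow> i < 1 \<Longrightarrow> j < 1 \<Longrightarrow> norm (residual 1 u n i j) < c * \<epsilon>\<^sup>2"
    by blast
  define E where "E = mm 1 u (approx_inv 1 u N)"
  have E_comm: "mm 1 u E = mm 1 E u"
    by (simp add: E_def mm_assoc approx_inv_commute)
  have "ms E = mm 1 (approx_inv 1 u N) u"
    by (simp add: E_def ms_mm ms_approx_inv[OF ms_u] ms_u)
  then have "ms E = E"
    by (simp add: E_def approx_inv_commute)
  define e where "e = E 0 0"
  have sa_e: "star e = e"
    using fun_cong[OF fun_cong[OF \<open>ms E = E\<close>, of 0], of 0] by (simp add: ms_def e_def)
  have R: "residual 1 u N = u - mm 1 u E"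
    by (simp add: residual_def E_def)
  have "residual 1 u (N + N) = (u - mm 1 E u) - mm 1 (u - mm 1 E u) E"
    using residual_add[of 1 u N N] R E_comm by (simp add: E_def)
  then have "residual 1 u (N + N) 0 0 = u 0 0 - e * u 0 0 - (u 0 0 - e * u 0 0) * e"
    by (simp add: fun_apply_simps mm_def e_def)
  also have "\<dots> = c *\<^sub>R ((x - e * x) * star (x - e * x))"
    by (simp add: u_def star_diff star_mult sa_e algebra_simps)
  finally have "norm (c *\<^sub>R ((x - e * x) * star (x - e * x))) < c * \<epsilon>\<^sup>2"
    using N[of "N + N" 0 0] by simp
  then have "(norm (x - e * x))\<^sup>2 < \<epsilon>\<^sup>2"
    using c cstar_identity[of "star (x - e * x)"] by (simp add: star_star)
  then have "norm (x - e * x) < \<epsilon>"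
    using \<epsilon> by (simp add: power2_less_imp_less)
  then show ?thesis
    by (rule that)
qed

section \<open>Order zero maps\<close>

lemma mat_mult_entry:
  assumes "A \<in> carrier_mat n k" "B \<in> carrier_mat k m" "i < n" "j < m"
  shows "(A * B) $$ (i, j) = (\<Sum>p<k. A $$ (i, p) * B $$ (p, j))"
  using assms by (auto simp: scalar_prod_def lessThan_atLeast0)

lemma mat_star_carrier: "A \<in> carrier_mat n k \<Longrightarrow> mat_star A \<in> carrier_mat k n"
  by (auto simp: mat_star_def)

lemma mat_star_entry:
  assumes "A \<in> carrier_mat n k" "i < k" "j < n"
  shows "mat_star A $$ (i, j) = star (A $$ (j, i))"
  using assms by (simp add: mat_star_def)

lemma mat_star_mult_entry:
  assumes "X \<in> carrier_mat k m" "i < m" "j < m"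
  shows "(mat_star X * X) $$ (i, j) = (\<Sum>p<k. star (X $$ (p, i)) * X $$ (p, j))"
  unfolding mat_mult_entry[OF mat_star_carrier[OF assms(1)] assms]
  by (intro sum.cong refl arg_cong2[where f = "(*)"] mat_star_entry[OF assms(1,2)]) simp

lemma mat_pos_carrier: "a \<in> mat_pos k \<Longrightarrow> a \<in> carrier_mat k k"
  unfolding mat_pos_def using mult_carrier_mat[OF mat_star_carrier] by blast

lemma
  assumes "completely_positive \<phi>"
  shows completely_positive_add: "\<phi> (x + y) = \<phi> x + \<phi> y"
    and completely_positive_scaleC: "\<phi> (scaleC c x) = scaleC c (\<phi> x)"
    and completely_positive_zero: "\<phi> 0 = 0"
proof -
  interpret Vector_Spaces.linear scaleC scaleC \<phi>
    using assms by (simp add: completely_positive_def)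
  show "\<phi> (x + y) = \<phi> x + \<phi> y" "\<phi> (scaleC c x) = scaleC c (\<phi> x)" "\<phi> 0 = 0"
    by (rule add, rule scale, rule zero)
qed

text \<open>This is 2-positivity for the Gram matrix of v and w, realised by the matrix with first
  row (v, w); Y and Z are the columns of a factor of its image. They do the work of a Stinespring
  dilation.\<close>

lemma completely_positive_pair:
  fixes \<phi> :: "'a::cstar_algebra \<Rightarrow> 'b::cstar_algebra"
  assumes cp: "completely_positive \<phi>"
  obtains Y Z where "\<phi> (star v * v) = (\<Sum>p<2::nat. star (Y p) * Y p)"
    "\<phi> (star v * w) = (\<Sum>p<2. star (Y p) * Z p)"
    "\<phi> (star w * v) = (\<Sum>p<2. star (Z p) * Y p)"
    "\<phi> (star w * w) = (\<Sum>p<2. star (Z p) * Z p)"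
proof -
  define X where "X = mat 2 2 (\<lambda>(i, j). if i = 0 then (if j = 0 then v else w) else (0 :: 'a))"
  have X: "X \<in> carrier_mat 2 2"
    by (simp add: X_def)
  then have "mat_star X * X \<in> mat_pos 2"
    by (auto simp: mat_pos_def)
  then have "map_mat \<phi> (mat_star X * X) \<in> mat_pos 2"
    using cp by (auto simp: completely_positive_def)
  then obtain Q where Q: "Q \<in> carrier_mat 2 2" "map_mat \<phi> (mat_star X * X) = mat_star Q * Q"
    by (auto simp: mat_pos_def)
  have entry: "\<phi> (\<Sum>p<2. star (X $$ (p, i)) * X $$ (p, j)) = (\<Sum>p<2. star (Q $$ (p, i)) * Q $$ (p, j))"
    if "i < 2" "j < 2" for i j
  proof -
    have "map_mat \<phi> (mat_star X * X) $$ (i, j) = \<phi> ((mat_star X * X) $$ (i, j))"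
      using that X mat_star_carrier[OF X] by (intro index_map_mat) auto
    then show ?thesis
      using Q that mat_star_mult_entry[OF X that] mat_star_mult_entry[OF Q(1) that] by simp
  qed
  have two: "{..<2::nat} = {0, 1}"
    by auto
  show ?thesis
    by (rule that[of "\<lambda>p. Q $$ (p, 0)" "\<lambda>p. Q $$ (p, 1)"])
      (use entry[of 0 0] entry[of 0 1] entry[of 1 0] entry[of 1 1] in \<open>simp_all add: two X_def\<close>)
qed

locale cpc_order_zero =
  fixes \<phi> :: "'a::cstar_algebra \<Rightarrow> 'b::cstar_algebra"
  assumes cp: "completely_positive \<phi>"
    and contr: "contractive \<phi>"
    and oz: "order_zero \<phi>"
begin

lemmas add = completely_positive_add[OF cp]
  and scaleC = completely_positive_scaleC[OF cp]
  and zero [simp] = completely_positive_zero[OF cp]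

lemma norm_le: "norm (\<phi> x) \<le> norm x"
  using contr by (simp add: contractive_def)

lemma scaleR: "\<phi> (r *\<^sub>R x) = r *\<^sub>R \<phi> x"
  by (simp add: scaleR_eq_scaleC scaleC)

lemma bounded_linear: "bounded_linear \<phi>"
  by (rule bounded_linear_intro[where K = 1]) (simp_all add: add scaleR norm_le)

lemma diff: "\<phi> (x - y) = \<phi> x - \<phi> y"
  by (rule linear_diff[OF bounded_linear.linear[OF bounded_linear]])

lemma sum: "\<phi> (\<Sum>i\<in>I. f i) = (\<Sum>i\<in>I. \<phi> (f i))"
  by (rule linear_sum[OF bounded_linear.linear[OF bounded_linear]])

lemma star_mult_star: "\<phi> (star (e * x)) = star (\<phi> (e * x))"
proof -
  obtain Y Z where "\<phi> (star (star e) * x) = (\<Sum>p<2::nat. star (Y p) * Z p)"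
    "\<phi> (star x * star e) = (\<Sum>p<2::nat. star (Z p) * Y p)"
    by (rule completely_positive_pair[OF cp, of "star e" x])
  then show ?thesis
    by (simp add: star_mult star_star star_sum)
qed

text \<open>Off-diagonal entries of a Gram matrix are products, so without a unit only elements
  \<open>e * x\<close> are reached directly. Approximate left units and contractivity pass to x
  itself.\<close>

lemma star: "\<phi> (star x) = star (\<phi> x)"
proof -
  have "norm (\<phi> (star x) - star (\<phi> x)) \<le> \<epsilon>" if "\<epsilon> > 0" for \<epsilon>
  proof -
    obtain e where e: "norm (x - e * x) < \<epsilon> / 2"
      using approximate_left_unit[of "\<epsilon> / 2"] \<open>\<epsilon> > 0\<close> by auto
    have "\<phi> (star x) - star (\<phi> x) = \<phi> (star (x - e * x)) - star (\<phi> (x - e * x))"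
      by (simp add: star_diff diff star_mult_star)
    also have "norm \<dots> \<le> norm (\<phi> (star (x - e * x))) + norm (\<phi> (x - e * x))"
      using norm_triangle_ineq4 by (metis norm_star)
    also have "\<dots> \<le> norm (x - e * x) + norm (x - e * x)"
      by (intro add_mono order.trans[OF norm_le]) simp_all
    finally show ?thesis
      using e by simp
  qed
  then have "norm (\<phi> (star x) - star (\<phi> x)) \<le> 0"
    by (rule field_le_epsilon[of _ 0, simplified])
  then show ?thesis
    by simp
qed

text \<open>In the Gram factorization the column Z of x annihilates z, as the squares of
  \<open>Z p * z\<close> add up to \<open>star z * \<phi> (star x * x) * z\<close>. The mixed entry
  \<phi>(e x) ends in Z, so it annihilates z as well, and an approximate left unit removes
  e.\<close>

lemma annihilator:
  assumes z: "\<phi> (star x * x) * z = 0"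
  shows "\<phi> x * z = 0"
proof -
  have ex: "\<phi> (e * x) * z = 0" for e
  proof -
    obtain Y Z where YZ: "\<phi> (star (star e) * x) = (\<Sum>p<2::nat. star (Y p) * Z p)"
      "\<phi> (star x * x) = (\<Sum>p<2::nat. star (Z p) * Z p)"
      by (rule completely_positive_pair[OF cp, of "star e" x])
    have "(\<Sum>p<2::nat. star (Z p * z) * (Z p * z)) = star z * (\<phi> (star x * x) * z)"
      by (simp add: YZ star_mult sum_distrib_left sum_distrib_right mult.assoc)
    then have Zz: "Z p * z = 0" if "p < 2" for p :: nat
      using z that by (intro sum_star_mult_self_eq_0D[of "\<lambda>p. Z p * z" "{..<2}"]) auto
    have "\<phi> (e * x) * z = (\<Sum>p<2::nat. star (Y p) * (Z p * z))"
      using YZ(1) by (simp add: star_star sum_distrib_right mult.assoc)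
    also have "\<dots> = 0"
      using Zz by (intro sum.neutral) auto
    finally show ?thesis .
  qed
  have "norm (\<phi> x * z) \<le> \<epsilon>" if "\<epsilon> > 0" for \<epsilon>
  proof -
    obtain e where e: "norm (x - e * x) < \<epsilon> / (1 + norm z)"
      using approximate_left_unit[of "\<epsilon> / (1 + norm z)"] \<open>\<epsilon> > 0\<close>
      by (auto simp: add_pos_nonneg)
    have "\<phi> x * z = \<phi> (x - e * x) * z"
      by (simp add: diff left_diff_distrib ex)
    also have "norm \<dots> \<le> norm (x - e * x) * norm z"
      by (rule order.trans[OF norm_mult_ineq]) (intro mult_right_mono norm_le norm_ge_zero)
    also have "\<dots> \<le> \<epsilon> / (1 + norm z) * (1 + norm z)"
      using e \<open>\<epsilon> > 0\<close> by (intro mult_mono) auto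
    also have "\<dots> = \<epsilon>"
      using norm_ge_zero[of z] by (simp add: add_nonneg_eq_0_iff)
    finally show ?thesis .
  qed
  then have "norm (\<phi> x * z) \<le> 0"
    by (rule field_le_epsilon[of _ 0, simplified])
  then show ?thesis
    by simp
qed

text \<open>Order zero speaks of positive elements. Here \<open>star x * x\<close> and
  \<open>y * star y\<close> are orthogonal because x y = 0, and \<open>annihilator\<close> peels off
  the additional factors, the second one after taking adjoints.\<close>

lemma zero_product:
  assumes "x * y = 0"
  shows "\<phi> x * \<phi> y = 0"
proof -
  let ?a = "star x * x" and ?b = "star (star y) * star y"
  have ab: "?a * ?b = 0"
    using assms by (metis mult.assoc mult_zero_left mult_zero_right star_star)
  then have ba: "?b * ?a = 0"
    using star_mult[of ?a ?b] by (simp add: star_mult star_star)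
  have "orthogonal_elements ?a ?b"
    unfolding orthogonal_elements_def using ab ba by (simp add: star_mult star_star)
  then have "orthogonal_elements (\<phi> ?a) (\<phi> ?b)"
    using oz unfolding order_zero_def positive_elements_def by blast
  then have "\<phi> ?a * \<phi> ?b = 0"
    by (simp add: orthogonal_elements_def)
  then have "\<phi> x * \<phi> ?b = 0"
    by (rule annihilator)
  then have "star (\<phi> x * \<phi> ?b) = 0"
    by simp
  then have "\<phi> ?b * star (\<phi> x) = 0"
    by (simp only: star_mult star[symmetric] star_star)
  then have "\<phi> (star y) * star (\<phi> x) = 0"
    by (rule annihilator)
  then have "star (\<phi> x * \<phi> y) = 0"
    by (simp only: star_mult star)
  then show ?thesis
    by (metis star_star star_zero)
qed

section \<open>The unitization acting from both sides\<close>

definition ract :: "'a \<Rightarrow> 'a unitization \<Rightarrow> 'a"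
  where "ract x f = ideal_part (embed x * f)"

definition lact :: "'a unitization \<Rightarrow> 'a \<Rightarrow> 'a"
  where "lact f y = ideal_part (f * embed y)"

lemma embed_ract: "embed (ract x f) = embed x * f"
  unfolding ract_def by (rule embed_ideal_part) simp

lemma embed_lact: "embed (lact f y) = f * embed y"
  unfolding lact_def by (rule embed_ideal_part) simp

lemma embed_inj: "embed x = embed y \<longleftrightarrow> x = (y::'a)"
  by (simp add: unitization_eq_iff)

lemma act_simps:
  "ract (ract x f) g = ract x (f * g)" "lact f (lact g y) = lact (f * g) y"
  "ract x 1 = x" "lact 1 y = y"
  "ract x (embed a) = x * a" "lact (embed a) y = a * y"
  "ract x (f + g) = ract x f + ract x g" "lact (f + g) y = lact f y + lact g y"
  "ract x (f - g) = ract x f - ract x g" "lact (f - g) y = lact f y - lact g y"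
  "ract x (scaleC c f) = scaleC c (ract x f)" "lact (scaleC c f) y = scaleC c (lact f y)"
  by (simp_all add: embed_inj[symmetric] embed_ract embed_lact embed_simps mult.assoc
      distrib_left distrib_right left_diff_distrib right_diff_distrib
      mult_scaleC_left mult_scaleC_right)

lemma norm_ract: "norm (ract x f) \<le> norm x * norm f"
  unfolding norm_embed[of "ract x f", symmetric] embed_ract
  using norm_mult_ineq[of "embed x" f] by simp

lemma norm_lact: "norm (lact f y) \<le> norm f * norm y"
  unfolding norm_embed[of "lact f y", symmetric] embed_lact
  using norm_mult_ineq[of f "embed y"] by simp

lemma bounded_bilinear_act: "bounded_bilinear (\<lambda>f g. \<phi> (ract x f) * \<phi> (lact g y))"
proof (rule bounded_bilinear.comp[OF bounded_bilinear_mult])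
  show "bounded_linear (\<lambda>f. \<phi> (ract x f))" "bounded_linear (\<lambda>g. \<phi> (lact g y))"
    unfolding ract_def lact_def
    by (intro bounded_linear_compose[OF bounded_linear] bounded_linear_compose[OF bounded_linear_ideal_part]
        bounded_linear_mult_right bounded_linear_mult_left)+
qed

text \<open>The defect E is complex bilinear and vanishes on the diagonal for self-adjoint elements
  by the local square identity. Polarization at h + k kills E(h, k) + E(k, h). As E is not
  sesquilinear, E(h + i k, h + i k) equals E(h, h) - E(k, k) plus i times that sum, so it vanishes
  too.\<close>

lemma square_relation:
  "\<phi> (ract x (u * u)) * \<phi> y + \<phi> x * \<phi> (lact (u * u) y) = 2 *\<^sub>R (\<phi> (ract x u) * \<phi> (lact u y))"
proof -
  define E where "E f g = \<phi> (ract x (f * g)) * \<phi> y + \<phi> x * \<phi> (lact (f * g) y)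
    - 2 *\<^sub>R (\<phi> (ract x f) * \<phi> (lact g y))" for f g
  have E_selfadjoint: "E f f = 0" if "star f = f" for f
  proof -
    have loc: "\<phi> (ract x f) * \<phi> (lact g y) = 0" if "f * g = 0" for f g
    proof (rule zero_product)
      have "embed x * f * (g * embed y) = embed x * (f * g) * embed y"
        by (simp only: mult.assoc)
      then show "ract x f * lact g y = 0"
        by (simp add: embed_inj[symmetric] embed_simps embed_ract embed_lact that)
    qed
    show ?thesis
      using local_bilinear_square[OF bounded_bilinear_act[of x y] loc that]
      by (simp add: E_def act_simps)
  qed
  have E_add: "E (f + g) (f + g) = E f f + E g g + (E f g + E g f)" for f g
    by (simp add: E_def act_simps add distrib_left distrib_right scaleR_add_right)
  have E_scaleC: "E (scaleC c f) g = scaleC c (E f g)" "E f (scaleC c g) = scaleC c (E f g)" for c f g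
    by (simp_all add: E_def act_simps scaleC mult_scaleC_left mult_scaleC_right scaleC_add_right
        scaleC_diff_right scaleC_scaleR)
  define h where "h = (1/2) *\<^sub>R (u + star u)"
  define k where "k = scaleC (- \<i> / 2) (u - star u)"
  have sa_h: "star h = h"
    by (simp add: h_def star_scaleR star_add star_star add.commute)
  have sa_k: "star k = k"
    by (simp add: k_def star_scaleC star_diff star_star scaleC_diff_right scaleC_minus_left)
  have u: "u = h + scaleC \<i> k"
    unfolding h_def k_def
    by (simp add: scaleC_scaleC scaleC_of_real[of "1/2", simplified] scaleR_diff_right scaleR_add_right)
      (simp add: scaleR_add_left[symmetric])
  have "E (h + k) (h + k) = 0"
    using sa_h sa_k by (intro E_selfadjoint) (simp add: star_add)
  then have "E h k + E k h = 0"
    using E_selfadjoint[OF sa_h] E_selfadjoint[OF sa_k] by (simp add: E_add)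
  then have "E (h + scaleC \<i> k) (h + scaleC \<i> k) = 0"
    unfolding E_add E_scaleC using E_selfadjoint[OF sa_h] E_selfadjoint[OF sa_k]
    by (simp add: scaleC_add_right[symmetric])
  then have "E u u = 0"
    using u by simp
  then show ?thesis
    by (simp add: E_def)
qed

text \<open>\<open>n \<mapsto> \<phi> (x u\<^sup>n) \<phi> (u\<^sup>-\<^sup>n y)\<close> has vanishing second differences and is bounded, hence constant.\<close>

lemma unitary_relation:
  assumes u: "star u * u = 1" "u * star u = 1"
  shows "\<phi> (ract x u) * \<phi> y = \<phi> x * \<phi> (lact u y)"
proof -
  \<comment> \<open>The extra factor u on y places the two sides of the claim at n = 1 and n =
    0.\<close>
  define w where "w n = \<phi> (ract x (u ^ n)) * \<phi> (lact (star u ^ n) (lact u y))" for n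
  define d where "d = w 1 - w 0"
  have cancel: "u * (star u ^ Suc n) = star u ^ n" for n
    by (simp add: mult.assoc[symmetric] u)
  have "w (Suc (Suc n)) + w n = 2 *\<^sub>R w (Suc n)" for n
  proof -
    let ?y = "lact (star u ^ Suc (Suc n)) (lact u y)"
    have "u * u * star u ^ Suc (Suc n) = star u ^ n" "u * star u ^ Suc (Suc n) = star u ^ Suc n"
      by (simp_all only: mult.assoc cancel)
    then have "lact (u * u) ?y = lact (star u ^ n) (lact u y)"
      "lact u ?y = lact (star u ^ Suc n) (lact u y)"
      by (metis act_simps(2))+
    moreover have "ract (ract x (u ^ n)) (u * u) = ract x (u ^ Suc (Suc n))"
      "ract (ract x (u ^ n)) u = ract x (u ^ Suc n)"
      by (simp_all add: act_simps power_Suc2 mult.assoc del: power_Suc)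
    ultimately show ?thesis
      using square_relation[of "ract x (u ^ n)" u ?y] by (simp only: w_def)
  qed
  then have step: "w (Suc (Suc n)) - w (Suc n) = w (Suc n) - w n" for n
    by (simp add: scaleR_2 algebra_simps)
  have diff: "w (Suc n) - w n = d" for n
    by (induction n) (simp_all add: d_def step)
  have affine: "w n = w 0 + real n *\<^sub>R d" for n
  proof (induction n)
    case (Suc n)
    then show ?case
      using diff[of n] by (simp add: scaleR_add_left algebra_simps)
  qed simp
  define B where "B = norm x * norm (lact u y)"
  have bound: "norm (w n) \<le> B" for n
  proof -
    have "norm (u ^ n) \<le> 1" "norm (star u ^ n) \<le> 1"
      using norm_power_ineq[of u n] norm_power_ineq[of "star u" n] norm_unitary[OF u(1)] by simp_all
    then have "norm (ract x (u ^ n)) \<le> norm x" "norm (lact (star u ^ n) (lact u y)) \<le> norm (lact u y)"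
      using norm_ract[of x "u ^ n"] norm_lact[of "star u ^ n" "lact u y"]
      by (meson mult_left_le mult_left_le_one_le norm_ge_zero order.trans)+
    then show ?thesis
      unfolding w_def B_def
      by (intro order.trans[OF norm_mult_ineq] mult_mono order.trans[OF norm_le]) auto
  qed
  have "real n * norm d \<le> 2 * B" for n
  proof -
    have "real n *\<^sub>R d = w n - w 0"
      using affine[of n] by simp
    then have "norm (real n *\<^sub>R d) \<le> norm (w n) + norm (w 0)"
      by (metis norm_triangle_ineq4)
    then show ?thesis
      using bound[of n] bound[of 0] by simp
  qed
  then have "norm d \<le> 0"
    using reals_Archimedean3[of "norm d"] by (meson not_less)
  then have "w 1 = w 0"
    by (simp add: d_def)
  then show ?thesis
    by (simp add: w_def act_simps u)
qed

text \<open>Both sides are linear in a, so self-adjoint contractions suffice, and these are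
  combinations of a unitary and its adjoint. Such unitaries live in the unitization, which is why
  the preceding relations are stated for its actions.\<close>

theorem product_relation: "\<phi> (x * a) * \<phi> y = \<phi> x * \<phi> (a * y)"
proof -
  define P where "P a \<longleftrightarrow> \<phi> (x * a) * \<phi> y = \<phi> x * \<phi> (a * y)" for a
  have P_add: "P (a + b)" if "P a" "P b" for a b
    using that by (simp add: P_def add distrib_left distrib_right)
  have P_scaleC: "P (scaleC c a)" if "P a" for c a
    using that by (simp add: P_def scaleC mult_scaleC_left mult_scaleC_right)
  have P_contraction: "P a" if "star a = a" "norm a \<le> 1" for a
  proof -
    have "star (embed a) = embed a" "norm (embed a) \<le> 1"
      using that by (simp_all add: embed_simps(5)[symmetric])
    then obtain u where u: "star u * u = 1" "u * star u = 1"
      and a: "embed a = scaleC (- \<i> / 2) (u - star u)"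
      by (rule selfadjoint_unitary_decomposition)
    have "\<phi> (ract x (embed a)) * \<phi> y = \<phi> x * \<phi> (lact (embed a) y)"
      unfolding a using unitary_relation[OF u] unitary_relation[of "star u"] u
      by (simp add: act_simps scaleC diff mult_scaleC_left mult_scaleC_right left_diff_distrib
          right_diff_distrib star_star)
    then show ?thesis
      by (simp add: P_def act_simps)
  qed
  have P_selfadjoint: "P a" if "star a = a" for a
  proof -
    define r where "r = norm a + 1"
    have r: "r > 0"
      by (simp add: r_def add_nonneg_pos)
    have "P ((1 / r) *\<^sub>R a)"
      using r by (intro P_contraction) (simp_all add: star_scaleR that r_def)
    then have "P (scaleC (complex_of_real r) ((1 / r) *\<^sub>R a))"
      by (rule P_scaleC)
    then show ?thesis
      using r by (simp add: scaleC_of_real)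
  qed
  have "P (scaleC (1/2) (a + star a))"
    by (intro P_scaleC P_selfadjoint) (simp add: star_add star_star add.commute)
  moreover have "P (scaleC (1/2) (scaleC (- \<i>) (scaleC \<i> (a - star a))))"
    by (intro P_scaleC P_selfadjoint)
      (simp add: star_scaleC star_diff star_star scaleC_diff_right scaleC_minus_left)
  ultimately have "P (scaleC (1/2) (a + star a) + scaleC (1/2) (a - star a))"
    using P_add by (simp add: scaleC_scaleC)
  moreover have "scaleC (1/2) (a + star a) + scaleC (1/2) (a - star a) = a"
    by (simp add: scaleC_add_right scaleC_diff_right scaleC_add_left[symmetric])
  ultimately show ?thesis
    by (simp add: P_def)
qed

end

section \<open>Cuntz comparison\<close>

lemma norm_index_le_column_norm:
  assumes "i < dim_vec \<xi>"
  shows "norm (\<xi> $ i) \<le> 2 * column_norm \<xi>"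
proof (rule power2_le_imp_le)
  let ?S = "norm (\<Sum>i<dim_vec \<xi>. star (\<xi> $ i) * \<xi> $ i)"
  have "(norm (\<xi> $ i))\<^sup>2 \<le> 2 * ?S"
    using assms by (intro norm_component_le[of "{..<dim_vec \<xi>}" i "vec_index \<xi>"]) auto
  also have "\<dots> \<le> (2 * column_norm \<xi>)\<^sup>2"
    by (simp add: column_norm_def power_mult_distrib)
  finally show "(norm (\<xi> $ i))\<^sup>2 \<le> (2 * column_norm \<xi>)\<^sup>2" .
qed (simp add: column_norm_def)

lemma column_norm_le_sum: "column_norm \<xi> \<le> (\<Sum>i<dim_vec \<xi>. norm (\<xi> $ i))"
proof -
  let ?s = "\<Sum>i<dim_vec \<xi>. norm (\<xi> $ i)"
  have "norm (\<Sum>i<dim_vec \<xi>. star (\<xi> $ i) * \<xi> $ i) \<le> (\<Sum>i<dim_vec \<xi>. norm (\<xi> $ i) * ?s)"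
  proof (rule sum_norm_le)
    fix i
    assume "i \<in> {..<dim_vec \<xi>}"
    then have "norm (\<xi> $ i) \<le> ?s"
      by (intro member_le_sum) auto
    then show "norm (star (\<xi> $ i) * \<xi> $ i) \<le> norm (\<xi> $ i) * ?s"
      by (simp add: cstar_identity power2_eq_square mult_left_mono)
  qed
  also have "\<dots> = ?s\<^sup>2"
    by (simp add: sum_distrib_right[symmetric] power2_eq_square)
  finally show ?thesis
    unfolding column_norm_def by (intro real_le_lsqrt) (auto intro: sum_nonneg)
qed

lemma column_norm_nonneg: "0 \<le> column_norm \<xi>"
  by (simp add: column_norm_def)

lemma column_norm_zero: "column_norm (0\<^sub>v k) = 0"
  by (simp add: column_norm_def)

lemma mult_mat_vec_index:
  assumes "X \<in> carrier_mat n k" "\<xi> \<in> carrier_vec k" "i < n"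
  shows "(mult_mat_vec X \<xi>) $ i = (\<Sum>j<k. X $$ (i, j) * \<xi> $ j)"
  using assms by (auto simp: scalar_prod_def lessThan_atLeast0)

lemma column_norm_mult_le:
  assumes X: "X \<in> carrier_mat k k" and \<xi>: "\<xi> \<in> carrier_vec k" "column_norm \<xi> \<le> 1"
  shows "column_norm (mult_mat_vec X \<xi>) \<le> 2 * (\<Sum>i<k. \<Sum>j<k. norm (X $$ (i, j)))"
proof -
  have "column_norm (mult_mat_vec X \<xi>) \<le> (\<Sum>i<k. norm (mult_mat_vec X \<xi> $ i))"
    using column_norm_le_sum[of "mult_mat_vec X \<xi>"] X by simp
  also have "\<dots> \<le> (\<Sum>i<k. \<Sum>j<k. norm (X $$ (i, j)) * 2)"
  proof (rule sum_mono)
    fix i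
    assume "i \<in> {..<k}"
    then have "norm (mult_mat_vec X \<xi> $ i) = norm (\<Sum>j<k. X $$ (i, j) * \<xi> $ j)"
      using mult_mat_vec_index[OF X \<xi>(1), of i] by simp
    also have "\<dots> \<le> (\<Sum>j<k. norm (X $$ (i, j)) * 2)"
    proof (rule sum_norm_le)
      fix j
      assume "j \<in> {..<k}"
      then have "norm (\<xi> $ j) \<le> 2"
        using norm_index_le_column_norm[of j \<xi>] \<xi> by simp
      then show "norm (X $$ (i, j) * \<xi> $ j) \<le> norm (X $$ (i, j)) * 2"
        by (meson mult_left_mono norm_ge_zero norm_mult_ineq order.trans)
    qed
    finally show "norm (mult_mat_vec X \<xi> $ i) \<le> (\<Sum>j<k. norm (X $$ (i, j)) * 2)" .
  qed
  also have "\<dots> = 2 * (\<Sum>i<k. \<Sum>j<k. norm (X $$ (i, j)))"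
    by (simp add: sum_distrib_right[symmetric])
  finally show ?thesis .
qed

lemma mat_norm_le_sum:
  assumes X: "X \<in> carrier_mat k k"
  shows "mat_norm X \<le> 2 * (\<Sum>i<k. \<Sum>j<k. norm (X $$ (i, j)))"
  unfolding mat_norm_def
proof (rule cSUP_least)
  show "{\<xi> \<in> carrier_vec (dim_col X). column_norm \<xi> \<le> 1} \<noteq> {}"
    by (auto simp: column_norm_zero intro!: exI[of _ "0\<^sub>v (dim_col X)"])
qed (use column_norm_mult_le[OF X] X in auto)

lemma column_norm_mult_le_mat_norm:
  assumes X: "X \<in> carrier_mat k k" and \<xi>: "\<xi> \<in> carrier_vec k" "column_norm \<xi> \<le> 1"
  shows "column_norm (mult_mat_vec X \<xi>) \<le> mat_norm X"
  unfolding mat_norm_def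
proof (rule cSUP_upper)
  show "\<xi> \<in> {\<xi> \<in> carrier_vec (dim_col X). column_norm \<xi> \<le> 1}"
    using X \<xi> by auto
  show "bdd_above ((\<lambda>\<xi>. column_norm (mult_mat_vec X \<xi>)) `
      {\<xi> \<in> carrier_vec (dim_col X). column_norm \<xi> \<le> 1})"
    using column_norm_mult_le[OF X] X by (intro bdd_aboveI2) auto
qed

lemma mat_norm_nonneg: "X \<in> carrier_mat k k \<Longrightarrow> 0 \<le> mat_norm X"
  using column_norm_mult_le_mat_norm[of X k "0\<^sub>v k"] column_norm_nonneg order.trans
  by (fastforce simp: column_norm_zero)

text \<open>For r the entry in question, the test column has the normalised \<open>star r\<close> at
  position j as its only nonzero entry: by the C*-identity the i-th component of the image has norm
  exactly \<open>norm r\<close>. With \<open>mat_norm_le_sum\<close> this reduces norm convergence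
  to convergence of entries.\<close>

lemma norm_entry_le_mat_norm:
  fixes X :: "'a::cstar_algebra mat"
  assumes X: "X \<in> carrier_mat k k" and ij: "i < k" "j < k"
  shows "norm (X $$ (i, j)) \<le> 2 * mat_norm X"
proof (cases "X $$ (i, j) = 0")
  case True
  then show ?thesis
    using mat_norm_nonneg[OF X] by simp
next
  case False
  define r where "r = X $$ (i, j)"
  define c where "c = (1 / norm r) *\<^sub>R star r"
  define \<xi> where "\<xi> = vec k (\<lambda>p. if p = j then c else 0)"
  have r: "norm r > 0"
    using False by (simp add: r_def)
  have \<xi>: "\<xi> \<in> carrier_vec k"
    by (simp add: \<xi>_def)
  have "(\<Sum>p<k. star (\<xi> $ p) * \<xi> $ p) = (\<Sum>p<k. if p = j then star c * c else 0)"
    by (intro sum.cong) (auto simp: \<xi>_def)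
  then have "column_norm \<xi> = norm c"
    using ij \<xi> by (simp add: column_norm_def cstar_identity)
  also have "\<dots> = 1"
    using r by (simp add: c_def)
  finally have \<xi>1: "column_norm \<xi> \<le> 1"
    by simp
  have "(mult_mat_vec X \<xi>) $ i = (\<Sum>p<k. if p = j then X $$ (i, p) * c else 0)"
    unfolding mult_mat_vec_index[OF X \<xi> ij(1)] by (intro sum.cong) (auto simp: \<xi>_def)
  then have "(mult_mat_vec X \<xi>) $ i = r * c"
    using ij by (simp add: r_def)
  also have "norm (r * c) = norm r"
    using cstar_identity[of "star r"] r by (simp add: c_def star_star power2_eq_square)
  finally have "norm r \<le> 2 * column_norm (mult_mat_vec X \<xi>)"
    using norm_index_le_column_norm[of i "mult_mat_vec X \<xi>"] X ij by simp
  then show ?thesis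
    using column_norm_mult_le_mat_norm[OF X \<xi> \<xi>1] by (simp add: r_def)
qed

text \<open>Cuntz comparison of a \<open>k \<times> k\<close> with an \<open>l \<times> l\<close> matrix by means of rectangular matrices.\<close>

definition cuntz_le ::
    "nat \<Rightarrow> (nat \<Rightarrow> nat \<Rightarrow> 'a) \<Rightarrow> nat \<Rightarrow> (nat \<Rightarrow> nat \<Rightarrow> 'a::cstar_algebra) \<Rightarrow> bool"
  where "cuntz_le k a l b \<longleftrightarrow> (\<forall>\<epsilon>>0. \<exists>x. \<forall>i<k. \<forall>j<k.
    norm (mm l (mm l (ms x) b) x i j - a i j) < \<epsilon>)"

lemma cuntz_leI:
  assumes "\<And>\<epsilon>. \<epsilon> > 0 \<Longrightarrow> \<exists>x. \<forall>i<k. \<forall>j<k. norm (mm l (mm l (ms x) b) x i j - a i j) < \<epsilon>"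
  shows "cuntz_le k a l b"
  using assms by (simp add: cuntz_le_def)

lemma cuntz_leE:
  assumes "cuntz_le k a l b" "\<epsilon> > 0"
  obtains x where "\<forall>i<k. \<forall>j<k. norm (mm l (mm l (ms x) b) x i j - a i j) < \<epsilon>"
  using assms unfolding cuntz_le_def by blast

lemma cuntz_le_cong:
  assumes "\<And>i j. i < k \<Longrightarrow> j < k \<Longrightarrow> a i j = a' i j" "\<And>i j. i < l \<Longrightarrow> j < l \<Longrightarrow> b i j = b' i j"
  shows "cuntz_le k a l b \<longleftrightarrow> cuntz_le k a' l b'"
proof -
  have "mm l (mm l (ms x) b) x = mm l (mm l (ms x) b') x" for x
    using assms(2) by (simp add: mm_def fun_eq_iff cong: sum.cong_simp)
  then show ?thesis
    unfolding cuntz_le_def using assms(1) by (simp cong: conj_cong)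
qed

lemma cuntz_le_trans:
  fixes a b c :: "nat \<Rightarrow> nat \<Rightarrow> 'a::cstar_algebra"
  assumes ab: "cuntz_le k a l b" and bc: "cuntz_le l b m c"
  shows "cuntz_le k a m c"
proof (rule cuntz_leI)
  fix \<epsilon> :: real
  assume "\<epsilon> > 0"
  then have "\<epsilon> / 2 > 0"
    by simp
  then obtain x where "\<forall>i<k. \<forall>j<k. norm (mm l (mm l (ms x) b) x i j - a i j) < \<epsilon> / 2"
    by (rule cuntz_leE[OF ab])
  note x = this[rule_format]
  \<comment> \<open>x is fixed before the accuracy \<delta> of the second comparison is chosen;
    conjugation by x magnifies an error by at most S^2.\<close>
  define S where "S = 1 + (\<Sum>i<k. \<Sum>p<l. norm (x p i))"
  have S0: "S > 0"
    unfolding S_def by (intro add_pos_nonneg sum_nonneg) auto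
  have S: "(\<Sum>p<l. norm (x p i)) \<le> S" if "i < k" for i
  proof -
    have "(\<Sum>p<l. norm (x p i)) \<le> (\<Sum>i<k. \<Sum>p<l. norm (x p i))"
      using that by (intro member_le_sum[of i _ "\<lambda>i. \<Sum>p<l. norm (x p i)"] sum_nonneg) auto
    then show ?thesis
      by (simp add: S_def)
  qed
  define \<delta> where "\<delta> = \<epsilon> / (2 * (S * S))"
  have \<delta>: "\<delta> > 0"
    using \<open>\<epsilon> > 0\<close> S0 by (simp add: \<delta>_def)
  then obtain y where "\<forall>p<l. \<forall>q<l. norm (mm m (mm m (ms y) c) y p q - b p q) < \<delta>"
    by (rule cuntz_leE[OF bc])
  note y = this[rule_format]
  define d where "d = mm m (mm m (ms y) c) y - b"
  have close: "norm (mm l (mm l (ms x) d) x i j) \<le> \<epsilon> / 2" if ij: "i < k" "j < k" for i j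
  proof -
    have "norm (mm l (mm l (ms x) d) x i j) \<le> (\<Sum>q<l. (\<Sum>p<l. norm (x p i) * \<delta>) * norm (x q j))"
      unfolding mm_def[of l "mm l (ms x) d"]
    proof (rule sum_norm_le)
      fix q
      assume q: "q \<in> {..<l}"
      have "norm (mm l (ms x) d i q) \<le> (\<Sum>p<l. norm (x p i) * \<delta>)"
        unfolding mm_def
      proof (rule sum_norm_le)
        fix p
        assume "p \<in> {..<l}"
        then have "norm (d p q) \<le> \<delta>"
          using y[of p q] q by (simp add: d_def fun_apply_simps)
        then show "norm (ms x i p * d p q) \<le> norm (x p i) * \<delta>"
          by (intro order.trans[OF norm_mult_ineq]) (simp add: ms_def mult_left_mono)
      qed
      then show "norm (mm l (ms x) d i q * x q j) \<le> (\<Sum>p<l. norm (x p i) * \<delta>) * norm (x q j)"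
        by (intro order.trans[OF norm_mult_ineq] mult_right_mono) auto
    qed
    also have "\<dots> = (\<Sum>p<l. norm (x p i)) * \<delta> * (\<Sum>q<l. norm (x q j))"
      by (simp add: sum_distrib_left sum_distrib_right)
    also have "\<dots> \<le> S * \<delta> * S"
      using S[OF ij(1)] S[OF ij(2)] S0 \<delta> by (intro mult_mono) (auto intro: sum_nonneg)
    also have "\<dots> = \<epsilon> / 2"
      using S0 by (simp add: \<delta>_def)
    finally show ?thesis .
  qed
  let ?z = "mm l y x"
  have "mm m (mm m (ms ?z) c) ?z = mm l (mm l (ms x) (mm m (mm m (ms y) c) y)) x"
    by (simp add: ms_mm mm_assoc)
  also have "\<dots> = mm l (mm l (ms x) d) x + mm l (mm l (ms x) b) x"
    by (simp add: d_def mm_diff_left mm_diff_right)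
  finally have eq: "mm m (mm m (ms ?z) c) ?z = \<dots>" .
  have "norm (mm m (mm m (ms ?z) c) ?z i j - a i j) < \<epsilon>" if ij: "i < k" "j < k" for i j
  proof -
    have "norm (mm l (mm l (ms x) d) x i j + (mm l (mm l (ms x) b) x i j - a i j)) < \<epsilon>"
      using close[OF ij] x[OF ij] by (intro norm_triangle_lt) simp
    then show ?thesis
      by (simp add: eq fun_apply_simps add_diff_eq)
  qed
  then show "\<exists>x. \<forall>i<k. \<forall>j<k. norm (mm m (mm m (ms x) c) x i j - a i j) < \<epsilon>"
    by blast
qed

lemma cuntz_le_refl:
  assumes "ms a = a"
  shows "cuntz_le k a k a"
proof (rule cuntz_leI)
  fix \<epsilon> :: real
  assume "\<epsilon> > 0"
  then obtain y where "\<forall>i<k. \<forall>j<k.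
      norm (mm k (ms y) (mm k (mm k a (mm k a a)) y) i j - a i j) < \<epsilon>"
    by (rule cube_approximation[OF assms])
  moreover have "mm k (mm k (ms (mm k a y)) a) (mm k a y) = mm k (ms y) (mm k (mm k a (mm k a a)) y)"
    by (simp add: ms_mm assms mm_assoc)
  ultimately show "\<exists>x. \<forall>i<k. \<forall>j<k. norm (mm k (mm k (ms x) a) x i j - a i j) < \<epsilon>"
    by (intro exI[of _ "mm k a y"]) (simp only: simp_thms)
qed

text \<open>The matrix \<open>diag (f, g)\<close>, the block \<open>f\<close> having \<open>r\<close> rows and \<open>c\<close> columns.\<close>

definition block_diag ::
    "nat \<Rightarrow> nat \<Rightarrow> (nat \<Rightarrow> nat \<Rightarrow> 'a) \<Rightarrow> (nat \<Rightarrow> nat \<Rightarrow> 'a) \<Rightarrow> nat \<Rightarrow> nat \<Rightarrow> 'a::cstar_algebra"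
  where "block_diag r c f g = (\<lambda>i j. if i < r then (if j < c then f i j else 0)
    else (if j < c then 0 else g (i - r) (j - c)))"

lemma sum_lessThan_add: "(\<Sum>p<m + n. f p) = (\<Sum>p<m. f p) + (\<Sum>p<n::nat. f (m + p) :: 'a::comm_monoid_add)"
  by (induction n) (simp_all add: add.assoc)

lemma mm_block_diag:
  "mm (m + n) (block_diag r m f g) (block_diag m c f' g') = block_diag r c (mm m f f') (mm n g g')"
  by (simp add: fun_eq_iff mm_def block_diag_def sum_lessThan_add)

lemma ms_block_diag: "ms (block_diag r c f g) = block_diag c r (ms f) (ms g)"
  by (simp add: fun_eq_iff ms_def block_diag_def)

lemma cuntz_le_block_diag:
  assumes a: "cuntz_le k a k' a'" and b: "cuntz_le l b l' b'"
  shows "cuntz_le (k + l) (block_diag k k a b) (k' + l') (block_diag k' k' a' b')"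
proof (rule cuntz_leI)
  fix \<epsilon> :: real
  assume \<epsilon>: "\<epsilon> > 0"
  obtain x where "\<forall>i<k. \<forall>j<k. norm (mm k' (mm k' (ms x) a') x i j - a i j) < \<epsilon>"
    using \<epsilon> by (rule cuntz_leE[OF a])
  note x = this[rule_format]
  obtain y where "\<forall>i<l. \<forall>j<l. norm (mm l' (mm l' (ms y) b') y i j - b i j) < \<epsilon>"
    using \<epsilon> by (rule cuntz_leE[OF b])
  note y = this[rule_format]
  let ?z = "block_diag k' k x y"
  have "mm (k' + l') (mm (k' + l') (ms ?z) (block_diag k' k' a' b')) ?z
      = block_diag k k (mm k' (mm k' (ms x) a') x) (mm l' (mm l' (ms y) b') y)"
    by (simp add: ms_block_diag mm_block_diag)
  then have "\<forall>i<k + l. \<forall>j<k + l.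
      norm (mm (k' + l') (mm (k' + l') (ms ?z) (block_diag k' k' a' b')) ?z i j
        - block_diag k k a b i j) < \<epsilon>"
    using x y \<epsilon> by (auto simp: block_diag_def)
  then show "\<exists>x. \<forall>i<k + l. \<forall>j<k + l.
      norm (mm (k' + l') (mm (k' + l') (ms x) (block_diag k' k' a' b')) x i j
        - block_diag k k a b i j) < \<epsilon>"
    by blast
qed

section \<open>Amplifications of an order zero map\<close>

context cpc_order_zero
begin

definition amp :: "(nat \<Rightarrow> nat \<Rightarrow> 'a) \<Rightarrow> nat \<Rightarrow> nat \<Rightarrow> 'b"
  where "amp f = (\<lambda>i j. \<phi> (f i j))"

lemma ms_amp: "ms (amp f) = amp (ms f)"
  by (simp add: ms_def amp_def star)

lemma amp_product: "mm k (amp (mm m f g)) (amp h) = mm m (amp f) (amp (mm k g h))"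
proof (intro ext)
  fix i j
  have "(\<Sum>p<k. \<Sum>q<m. \<phi> (f i q) * \<phi> (g q p * h p j)) = (\<Sum>q<m. \<Sum>p<k. \<phi> (f i q) * \<phi> (g q p * h p j))"
    by (rule sum.swap)
  then show "mm k (amp (mm m f g)) (amp h) i j = mm m (amp f) (amp (mm k g h)) i j"
    by (simp add: mm_def amp_def sum sum_distrib_left sum_distrib_right product_relation)
qed

text \<open>For \<open>c = x\<^sup>*bx\<close> the product relation gives \<open>\<phi>(xc)\<^sup>* \<phi>(b) \<phi>(xc) = \<phi>(c)\<^sup>3\<close>.\<close>

lemma cuntz_le_amp:
  assumes sa: "ms b = b" and le: "cuntz_le k a l b"
  shows "cuntz_le k (amp a) l (amp b)"
proof (rule cuntz_leI)
  fix \<epsilon> :: real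
  assume "\<epsilon> > 0"
  then have \<epsilon>: "\<epsilon> / 2 > 0"
    by simp
  then obtain x where "\<forall>i<k. \<forall>j<k. norm (mm l (mm l (ms x) b) x i j - a i j) < \<epsilon> / 2"
    by (rule cuntz_leE[OF le])
  note x = this[rule_format]
  define c where "c = mm l (mm l (ms x) b) x"
  have ms_c: "ms c = c"
    by (simp add: c_def ms_mm sa mm_assoc)
  define t where "t = amp c"
  have ms_t: "ms t = t"
    by (simp add: t_def ms_amp ms_c)
  define y where "y = amp (mm k x c)"
  have "mm l (amp b) y = mm k (amp (mm l b x)) t"
    by (simp add: y_def t_def amp_product)
  \<comment> \<open>This is the product relation moving \<open>ms x\<close> from the left factor
    \<phi>(c \<open>ms x\<close>) to the right factor \<phi>(b x), which thereby becomes
    \<phi>(c).\<close>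
  moreover have "mm l (ms y) (amp (mm l b x)) = mm k t t"
    by (simp add: y_def t_def ms_amp ms_mm ms_c amp_product) (simp add: c_def mm_assoc)
  ultimately have cube: "mm l (mm l (ms y) (amp b)) y = mm k t (mm k t t)"
    by (metis mm_assoc)
  obtain z where "\<forall>i<k. \<forall>j<k.
      norm (mm k (ms z) (mm k (mm k t (mm k t t)) z) i j - t i j) < \<epsilon> / 2"
    using \<epsilon> by (rule cube_approximation[OF ms_t])
  note z = this[rule_format]
  have "mm l (mm l (ms (mm k y z)) (amp b)) (mm k y z) = mm k (ms z) (mm k (mm l (mm l (ms y) (amp b)) y) z)"
    by (simp add: ms_mm mm_assoc)
  then have eq: "mm l (mm l (ms (mm k y z)) (amp b)) (mm k y z)
      = mm k (ms z) (mm k (mm k t (mm k t t)) z)"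
    by (simp only: cube)
  have "norm (mm k (ms z) (mm k (mm k t (mm k t t)) z) i j - amp a i j) < \<epsilon>"
    if ij: "i < k" "j < k" for i j
  proof -
    have "norm (t i j - amp a i j) < \<epsilon> / 2"
      using norm_le[of "c i j - a i j"] x[OF ij] by (simp add: t_def amp_def diff c_def)
    with z[OF ij] have "norm ((mm k (ms z) (mm k (mm k t (mm k t t)) z) i j - t i j)
        + (t i j - amp a i j)) < \<epsilon>"
      by (intro norm_triangle_lt) simp
    then show ?thesis
      by simp
  qed
  then show "\<exists>x. \<forall>i<k. \<forall>j<k. norm (mm l (mm l (ms x) (amp b)) x i j - amp a i j) < \<epsilon>"
    by (intro exI[of _ "mm k y z"]) (simp add: eq)
qed

end

section \<open>Matrices and their entry functions\<close>

definition entries :: "'a mat \<Rightarrow> nat \<Rightarrow> nat \<Rightarrow> 'a"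
  where "entries A = (\<lambda>i j. A $$ (i, j))"

lemma mat_sandwich_entry:
  assumes X: "X \<in> carrier_mat n n" and B: "B \<in> carrier_mat n n" and ij: "i < n" "j < n"
  shows "(mat_star X * B * X) $$ (i, j) = mm n (mm n (ms (entries X)) (entries B)) (entries X) i j"
proof -
  have "(mat_star X * B) $$ (i, q) = mm n (ms (entries X)) (entries B) i q" if "q < n" for q
    using mat_mult_entry[OF mat_star_carrier[OF X] B ij(1) that]
    by (simp add: mm_def ms_def entries_def mat_star_entry[OF X ij(1)] cong: sum.cong_simp)
  then show ?thesis
    using mat_mult_entry[OF mult_carrier_mat[OF mat_star_carrier[OF X] B] X ij]
    by (simp add: mm_def[of n _ "entries X"]) (simp add: entries_def)
qed

lemma mat_oplus_carrier:
  "A \<in> carrier_mat k k \<Longrightarrow> B \<in> carrier_mat l l \<Longrightarrow> mat_oplus A B \<in> carrier_mat (k + l) (k + l)"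
  by (auto simp: mat_oplus_def)

lemma mat_oplus_entry:
  assumes "A \<in> carrier_mat k k" "B \<in> carrier_mat l l" "i < k + l" "j < k + l"
  shows "mat_oplus A B $$ (i, j) = block_diag k k (entries A) (entries B) i j"
  using assms by (auto simp: mat_oplus_def block_diag_def entries_def)

lemma mat_pad_carrier:
  assumes "A \<in> carrier_mat k k" "k \<le> n"
  shows "mat_pad n A \<in> carrier_mat n n"
  using mat_oplus_carrier[OF assms(1) zero_carrier_mat[of "n - k" "n - k"]] assms
  by (simp add: mat_pad_def)

lemma mat_pad_entry:
  assumes "A \<in> carrier_mat k k" "k \<le> n" "i < n" "j < n"
  shows "mat_pad n A $$ (i, j) = (if i < k \<and> j < k then A $$ (i, j) else 0)"
  using mat_oplus_entry[OF assms(1) zero_carrier_mat[of "n - k" "n - k"], of i j] assms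
  by (auto simp: mat_pad_def block_diag_def entries_def)

lemma mm_truncate:
  assumes "l \<le> n" "\<And>i p. l \<le> p \<Longrightarrow> p < n \<Longrightarrow> f i p * g p j = 0"
  shows "mm n f g i j = mm l f g i j"
  unfolding mm_def using assms by (intro sum.mono_neutral_right) auto

lemma mm_cong:
  assumes "\<And>p. p < n \<Longrightarrow> f i p = f' i p" "\<And>p. p < n \<Longrightarrow> g p j = g' p j"
  shows "mm n f g i j = mm n f' g' i j"
  unfolding mm_def using assms by (intro sum.cong) auto

text \<open>Padding B with zeros makes only the first l rows of X count; padding A demands zeros
  outside the first k rows and columns, which zero columns of X provide. So the square matrices of
  the definition may be exchanged for rectangular ones, and by the two norm bounds the limit for
  entrywise estimates.\<close>

lemma cuntz_below_iff:
  fixes A B :: "'a::cstar_algebra mat"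
  assumes A: "A \<in> carrier_mat k k" and B: "B \<in> carrier_mat l l"
  shows "cuntz_below A B \<longleftrightarrow> cuntz_le k (entries A) l (entries B)"
proof -
  define n where "n = max k l"
  have kn: "k \<le> n" "l \<le> n"
    by (simp_all add: n_def)
  let ?A = "mat_pad n A" and ?B = "mat_pad n B"
  note cA = mat_pad_carrier[OF A kn(1)] and cB = mat_pad_carrier[OF B kn(2)]
  have below: "cuntz_below A B \<longleftrightarrow> (\<exists>x. (\<forall>m. x m \<in> carrier_mat n n) \<and>
      (\<lambda>m. mat_norm (mat_star (x m) * ?B * x m - ?A)) \<longlonglongrightarrow> 0)"
    using A B by (simp add: cuntz_below_def n_def Let_def)
  have carrier: "mat_star X * ?B * X - ?A \<in> carrier_mat n n" if "X \<in> carrier_mat n n" for X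
    using that cA cB mat_star_carrier[OF that] by auto
  have entry: "(mat_star X * ?B * X - ?A) $$ (i, j)
      = mm l (mm l (ms (entries X)) (entries B)) (entries X) i j - (if i < k \<and> j < k then A $$ (i, j) else 0)"
    if X: "X \<in> carrier_mat n n" and ij: "i < n" "j < n" for X i j
  proof -
    have inner: "mm n (ms (entries X)) (entries ?B) i q
        = (if q < l then mm l (ms (entries X)) (entries B) i q else 0)" if q: "q < n" for q
    proof -
      have "mm n (ms (entries X)) (entries ?B) i q = mm l (ms (entries X)) (entries ?B) i q"
        using kn q by (intro mm_truncate) (auto simp: entries_def mat_pad_entry[OF B])
      also have "\<dots> = (if q < l then mm l (ms (entries X)) (entries B) i q else 0)"
        using kn q by (auto simp: mm_def entries_def mat_pad_entry[OF B])
      finally show ?thesis .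
    qed
    have "mm n (mm n (ms (entries X)) (entries ?B)) (entries X) i j
        = (\<Sum>q<n. if q < l then mm l (ms (entries X)) (entries B) i q * entries X q j else 0)"
      unfolding mm_def[of n _ "entries X"] by (intro sum.cong) (auto simp: inner)
    also have "\<dots> = mm l (mm l (ms (entries X)) (entries B)) (entries X) i j"
      unfolding mm_def[of l _ "entries X"] using kn
      by (intro sum.mono_neutral_cong_right) auto
    finally have "(mat_star X * ?B * X) $$ (i, j) = mm l (mm l (ms (entries X)) (entries B)) (entries X) i j"
      by (simp add: mat_sandwich_entry[OF X cB ij])
    then show ?thesis
      using cA ij mat_pad_entry[OF A kn(1) ij] by simp
  qed
  show ?thesis
    unfolding below
  proof
    assume "\<exists>x. (\<forall>m. x m \<in> carrier_mat n n) \<and>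
      (\<lambda>m. mat_norm (mat_star (x m) * ?B * x m - ?A)) \<longlonglongrightarrow> 0"
    then obtain x where x: "\<And>m. x m \<in> carrier_mat n n"
      and lim: "(\<lambda>m. mat_norm (mat_star (x m) * ?B * x m - ?A)) \<longlonglongrightarrow> 0"
      by blast
    show "cuntz_le k (entries A) l (entries B)"
    proof (rule cuntz_leI)
      fix \<epsilon> :: real
      assume "\<epsilon> > 0"
      then have "\<forall>\<^sub>F m in sequentially. mat_norm (mat_star (x m) * ?B * x m - ?A) < \<epsilon> / 2"
        using lim by (intro order_tendstoD(2)[OF lim]) simp
      then obtain m where m: "mat_norm (mat_star (x m) * ?B * x m - ?A) < \<epsilon> / 2"
        by (auto dest: eventually_happens)
      have "norm (mm l (mm l (ms (entries (x m))) (entries B)) (entries (x m)) i j - entries A i j) < \<epsilon>"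
        if ij: "i < k" "j < k" for i j
        using norm_entry_le_mat_norm[OF carrier[OF x[of m]], of i j] ij kn m entry[OF x[of m], of i j]
        by (simp add: entries_def)
      then show "\<exists>x. \<forall>i<k. \<forall>j<k. norm (mm l (mm l (ms x) (entries B)) x i j - entries A i j) < \<epsilon>"
        by blast
    qed
  next
    assume le: "cuntz_le k (entries A) l (entries B)"
    have "\<exists>X \<in> carrier_mat n n. mat_norm (mat_star X * ?B * X - ?A)
        \<le> 2 * (real n * (real n * (1 / real (Suc m))))" for m
    proof -
      have "1 / real (Suc m) > 0"
        by simp
      then obtain x where "\<forall>i<k. \<forall>j<k.
          norm (mm l (mm l (ms x) (entries B)) x i j - entries A i j) < 1 / real (Suc m)"
        by (rule cuntz_leE[OF le])
      note x = this[rule_format]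
      \<comment> \<open>Columns from k on are set to zero to match the padding of A; rows from l on
        may keep any values of x, as the padded B vanishes there.\<close>
      define X where "X = Matrix.mat n n (\<lambda>(p, i). if i < k then x p i else 0)"
      have X: "X \<in> carrier_mat n n"
        by (simp add: X_def)
      have small: "norm ((mat_star X * ?B * X - ?A) $$ (i, j)) \<le> 1 / real (Suc m)"
        if ij: "i < n" "j < n" for i j
      proof -
        have X_entry: "entries X p i = (if i < k then x p i else 0)" if "p < l" "i < n" for p i
          using that kn by (simp add: X_def entries_def)
        show ?thesis
        proof (cases "i < k \<and> j < k")
          case True
          have "mm l (ms (entries X)) (entries B) i q = mm l (ms x) (entries B) i q" for q
            using True ij by (intro mm_cong) (simp_all add: ms_def X_entry)
          then have "mm l (mm l (ms (entries X)) (entries B)) (entries X) i j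
              = mm l (mm l (ms x) (entries B)) x i j"
            using True ij by - (rule mm_cong, simp_all add: X_entry)
          then show ?thesis
            using entry[OF X ij] x[of i j] True by (simp add: entries_def)
        next
          case False
          have "mm l (ms (entries X)) (entries B) i q = 0" if "\<not> i < k" for q
            using that ij by (simp add: mm_def ms_def X_entry)
          then have "mm l (mm l (ms (entries X)) (entries B)) (entries X) i j = 0"
            using False ij by (auto simp: mm_def[of l _ "entries X"] X_entry)
          then show ?thesis
            using entry[OF X ij] False by simp
        qed
      qed
      have "mat_norm (mat_star X * ?B * X - ?A)
          \<le> 2 * (\<Sum>i<n. \<Sum>j<n. norm ((mat_star X * ?B * X - ?A) $$ (i, j)))"
        by (rule mat_norm_le_sum[OF carrier[OF X]])
      also have "\<dots> \<le> 2 * (\<Sum>i<n. \<Sum>j<n. 1 / real (Suc m))"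
        by (intro mult_left_mono sum_mono small) auto
      finally show ?thesis
        using X by auto
    qed
    then obtain X where X: "\<And>m. X m \<in> carrier_mat n n"
      and bound: "\<And>m. mat_norm (mat_star (X m) * ?B * X m - ?A)
        \<le> 2 * (real n * (real n * (1 / real (Suc m))))"
      by metis
    have "(\<lambda>m. mat_norm (mat_star (X m) * ?B * X m - ?A)) \<longlonglongrightarrow> 0"
    proof (rule tendsto_sandwich)
      show "\<forall>\<^sub>F m in sequentially. 0 \<le> mat_norm (mat_star (X m) * ?B * X m - ?A)"
        using mat_norm_nonneg[OF carrier[OF X]] by simp
      show "\<forall>\<^sub>F m in sequentially. mat_norm (mat_star (X m) * ?B * X m - ?A)
          \<le> 2 * (real n * (real n * (1 / real (Suc m))))"
        using bound by simp
      have "(\<lambda>m. 2 * (real n * (real n * (1 / real (Suc m))))) \<longlonglongrightarrow> 2 * (real n * (real n * 0))"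
        by (intro tendsto_intros LIMSEQ_Suc[OF lim_1_over_n])
      then show "(\<lambda>m. 2 * (real n * (real n * (1 / real (Suc m))))) \<longlonglongrightarrow> 0"
        by simp
    qed simp
    then show "\<exists>x. (\<forall>m. x m \<in> carrier_mat n n) \<and>
      (\<lambda>m. mat_norm (mat_star (x m) * ?B * x m - ?A)) \<longlonglongrightarrow> 0"
      using X by blast
  qed
qed

section \<open>The induced morphism\<close>

text \<open>\<open>entries A\<close> has unspecified values outside the index range, whereas
  \<open>ms a = a\<close> is an identity for all indices. The representative is therefore computed
  from a factor of A.\<close>

lemma mat_pos_entriesE:
  assumes "A \<in> mat_pos k"
  obtains a where "ms a = a" "\<forall>i<k. \<forall>j<k. entries A i j = a i j"
proof -
  obtain X where X: "X \<in> carrier_mat k k" "A = mat_star X * X"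
    using assms by (auto simp: mat_pos_def)
  have "ms (mm k (ms (entries X)) (entries X)) = mm k (ms (entries X)) (entries X)"
    by (simp add: ms_mm)
  moreover have "\<forall>i<k. \<forall>j<k. entries A i j = mm k (ms (entries X)) (entries X) i j"
    using mat_star_mult_entry[OF X(1)] by (simp add: X(2) entries_def mm_def ms_def)
  ultimately show ?thesis
    by (rule that)
qed

lemma mat_oplus_pos:
  assumes "A \<in> mat_pos k" "B \<in> mat_pos l"
  shows "mat_oplus A B \<in> mat_pos (k + l)"
proof -
  obtain X where X: "X \<in> carrier_mat k k" "A = mat_star X * X"
    using assms(1) by (auto simp: mat_pos_def)
  obtain Y where Y: "Y \<in> carrier_mat l l" "B = mat_star Y * Y"
    using assms(2) by (auto simp: mat_pos_def)
  note cA = mat_pos_carrier[OF assms(1)] and cB = mat_pos_carrier[OF assms(2)]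
  define Z where "Z = mat_oplus X Y"
  have Z: "Z \<in> carrier_mat (k + l) (k + l)"
    unfolding Z_def by (rule mat_oplus_carrier[OF X(1) Y(1)])
  let ?x = "entries X" and ?y = "entries Y"
  have "mat_oplus A B = mat_star Z * Z"
  proof (rule eq_matI)
    fix i j
    assume "i < dim_row (mat_star Z * Z)" "j < dim_col (mat_star Z * Z)"
    then have ij: "i < k + l" "j < k + l"
      using Z mat_star_carrier[OF Z] by auto
    have "(mat_star Z * Z) $$ (i, j)
        = mm (k + l) (ms (block_diag k k ?x ?y)) (block_diag k k ?x ?y) i j"
      unfolding mat_star_mult_entry[OF Z ij] mm_def ms_def
      using ij by (intro sum.cong) (simp_all add: Z_def mat_oplus_entry[OF X(1) Y(1)])
    also have "\<dots> = block_diag k k (mm k (ms ?x) ?x) (mm l (ms ?y) ?y) i j"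
      by (simp add: ms_block_diag mm_block_diag)
    also have "\<dots> = block_diag k k (entries A) (entries B) i j"
      using ij mat_star_mult_entry[OF X(1)] mat_star_mult_entry[OF Y(1)]
      by (simp add: block_diag_def X(2) Y(2) entries_def mm_def ms_def)
    finally show "mat_oplus A B $$ (i, j) = (mat_star Z * Z) $$ (i, j)"
      using mat_oplus_entry[OF cA cB ij] by simp
  qed (use mat_oplus_carrier[OF cA cB] Z mat_star_carrier[OF Z] in auto)
  then show ?thesis
    using Z by (auto simp: mat_pos_def)
qed

lemma mat_inf_posE:
  assumes "A \<in> mat_inf_pos"
  obtains k where "k \<ge> 1" "A \<in> mat_pos k" "A \<in> carrier_mat k k"
  using assms mat_pos_carrier by (force simp: mat_inf_pos_def)

lemma mat_inf_posI: "k \<ge> 1 \<Longrightarrow> A \<in> mat_pos k \<Longrightarrow> A \<in> mat_inf_pos"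
  by (auto simp: mat_inf_pos_def)

lemma mat_oplus_inf_pos:
  assumes "A \<in> mat_inf_pos" "B \<in> mat_inf_pos"
  shows "mat_oplus A B \<in> mat_inf_pos"
proof -
  obtain k l where "k \<ge> 1" "A \<in> mat_pos k" "B \<in> mat_pos l"
    using assms mat_inf_posE by metis
  then show ?thesis
    using mat_oplus_pos by (intro mat_inf_posI[of "k + l"]) auto
qed

lemma cuntz_below_refl:
  assumes "A \<in> mat_inf_pos"
  shows "cuntz_below A A"
proof -
  obtain k where A: "A \<in> mat_pos k" "A \<in> carrier_mat k k"
    using assms by (rule mat_inf_posE)
  obtain a where a: "ms a = a" "\<forall>i<k. \<forall>j<k. entries A i j = a i j"
    using A(1) by (rule mat_pos_entriesE)
  have "cuntz_le k a k a"
    by (rule cuntz_le_refl[OF a(1)])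
  then show ?thesis
    unfolding cuntz_below_iff[OF A(2) A(2)] using a(2) by (subst cuntz_le_cong) auto
qed

lemma cuntz_below_trans:
  assumes "A \<in> mat_inf_pos" "B \<in> mat_inf_pos" "C \<in> mat_inf_pos"
    and "cuntz_below A B" "cuntz_below B C"
  shows "cuntz_below A C"
proof -
  obtain k where k: "A \<in> carrier_mat k k" using assms(1) by (rule mat_inf_posE)
  obtain l where l: "B \<in> carrier_mat l l" using assms(2) by (rule mat_inf_posE)
  obtain m where m: "C \<in> carrier_mat m m" using assms(3) by (rule mat_inf_posE)
  show ?thesis
    using cuntz_le_trans assms(4,5)
    unfolding cuntz_below_iff[OF k l] cuntz_below_iff[OF l m] cuntz_below_iff[OF k m] by blast
qed

lemma cuntz_below_oplus:
  assumes "A \<in> mat_inf_pos" "B \<in> mat_inf_pos" "A' \<in> mat_inf_pos" "B' \<in> mat_inf_pos"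
    and "cuntz_below A A'" "cuntz_below B B'"
  shows "cuntz_below (mat_oplus A B) (mat_oplus A' B')"
proof -
  obtain k where k: "A \<in> carrier_mat k k" using assms(1) by (rule mat_inf_posE)
  obtain l where l: "B \<in> carrier_mat l l" using assms(2) by (rule mat_inf_posE)
  obtain k' where k': "A' \<in> carrier_mat k' k'" using assms(3) by (rule mat_inf_posE)
  obtain l' where l': "B' \<in> carrier_mat l' l'" using assms(4) by (rule mat_inf_posE)
  have "cuntz_le (k + l) (block_diag k k (entries A) (entries B))
      (k' + l') (block_diag k' k' (entries A') (entries B'))"
    using assms(5,6) unfolding cuntz_below_iff[OF k k'] cuntz_below_iff[OF l l']
    by (rule cuntz_le_block_diag)
  then show ?thesis
    unfolding cuntz_below_iff[OF mat_oplus_carrier[OF k l] mat_oplus_carrier[OF k' l']]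
    using mat_oplus_entry[OF k l] mat_oplus_entry[OF k' l']
    by (subst cuntz_le_cong) (auto simp: entries_def[of "mat_oplus _ _"])
qed

section \<open>The Cuntz semigroup and its addition\<close>

lemma equiv_cuntz_rel: "equiv mat_inf_pos cuntz_rel"
proof (rule equivI)
  show "cuntz_rel \<subseteq> mat_inf_pos \<times> mat_inf_pos"
    by (auto simp: cuntz_rel_def)
  show "refl_on mat_inf_pos cuntz_rel"
    by (auto simp: refl_on_def cuntz_rel_def cuntz_below_refl)
  show "sym cuntz_rel"
    by (auto simp: sym_def cuntz_rel_def)
  show "trans cuntz_rel"
    unfolding trans_def cuntz_rel_def using cuntz_below_trans by blast
qed

lemma cuntz_class_eq_iff:
  assumes "a \<in> mat_inf_pos" "b \<in> mat_inf_pos"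
  shows "cuntz_class a = cuntz_class b \<longleftrightarrow> cuntz_below a b \<and> cuntz_below b a"
proof -
  have "cuntz_class a = cuntz_class b \<longleftrightarrow> cuntz_rel `` {a} = cuntz_rel `` {b}"
    unfolding cuntz_class_def using assms by (intro Abs_cuntz_inject) (auto intro: quotientI)
  also have "\<dots> \<longleftrightarrow> (a, b) \<in> cuntz_rel"
    using eq_equiv_class_iff[OF equiv_cuntz_rel] assms by blast
  finally show ?thesis
    using assms by (simp add: cuntz_rel_def)
qed

lemma cuntz_class_surj:
  obtains a where "a \<in> mat_inf_pos" "x = cuntz_class a"
proof -
  obtain a where "a \<in> mat_inf_pos" "Rep_cuntz x = cuntz_rel `` {a}"
    using Rep_cuntz[of x] by (auto elim: quotientE)
  then show ?thesis
    using that by (metis Rep_cuntz_inverse cuntz_class_def)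
qed

text \<open>The definite description has a unique value because direct sums respect Cuntz
  equivalence.\<close>

lemma cuntz_class_plus:
  assumes a: "a \<in> mat_inf_pos" and b: "b \<in> mat_inf_pos"
  shows "cuntz_class a + cuntz_class b = cuntz_class (mat_oplus a b)"
  unfolding plus_cuntz_def
proof (rule the_equality)
  show "\<exists>a'\<in>mat_inf_pos. \<exists>b'\<in>mat_inf_pos. cuntz_class a = cuntz_class a' \<and>
      cuntz_class b = cuntz_class b' \<and> cuntz_class (mat_oplus a b) = cuntz_class (mat_oplus a' b')"
    using a b by blast
  fix z
  assume "\<exists>a'\<in>mat_inf_pos. \<exists>b'\<in>mat_inf_pos. cuntz_class a = cuntz_class a' \<and>
      cuntz_class b = cuntz_class b' \<and> z = cuntz_class (mat_oplus a' b')"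
  then show "z = cuntz_class (mat_oplus a b)"
    using a b by (auto simp: cuntz_class_eq_iff mat_oplus_inf_pos cuntz_below_oplus)
qed

context cpc_order_zero
begin

lemma map_mat_inf_pos:
  assumes "a \<in> mat_inf_pos"
  shows "map_mat \<phi> a \<in> mat_inf_pos"
  using assms cp by (auto simp: mat_inf_pos_def completely_positive_def)

lemma cuntz_below_map_mat:
  assumes "a \<in> mat_inf_pos" "b \<in> mat_inf_pos" "cuntz_below a b"
  shows "cuntz_below (map_mat \<phi> a) (map_mat \<phi> b)"
proof -
  obtain k where k: "a \<in> carrier_mat k k"
    using assms(1) by (rule mat_inf_posE)
  obtain l where b: "b \<in> mat_pos l" and l: "b \<in> carrier_mat l l"
    using assms(2) by (rule mat_inf_posE)
  obtain b' where b': "ms b' = b'" "\<forall>i<l. \<forall>j<l. entries b i j = b' i j"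
    using b by (rule mat_pos_entriesE)
  have "cuntz_le k (entries a) l b'"
    using assms(3) b'(2) unfolding cuntz_below_iff[OF k l] by (subst (asm) cuntz_le_cong) auto
  then have "cuntz_le k (amp (entries a)) l (amp b')"
    by (rule cuntz_le_amp[OF b'(1)])
  moreover have "cuntz_le k (entries (map_mat \<phi> a)) l (entries (map_mat \<phi> b))
      \<longleftrightarrow> cuntz_le k (amp (entries a)) l (amp b')"
    using k l b'(2) by (intro cuntz_le_cong) (auto simp: amp_def entries_def)
  moreover have "map_mat \<phi> a \<in> carrier_mat k k" "map_mat \<phi> b \<in> carrier_mat l l"
    using k l by auto
  ultimately show ?thesis
    by (simp add: cuntz_below_iff)
qed

text \<open>The off-diagonal zero blocks are preserved because \<open>\<phi> 0 = 0\<close>.\<close>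

lemma map_mat_oplus:
  assumes "a \<in> mat_inf_pos" "b \<in> mat_inf_pos"
  shows "map_mat \<phi> (mat_oplus a b) = mat_oplus (map_mat \<phi> a) (map_mat \<phi> b)"
  by (rule eq_matI) (auto simp: mat_oplus_def)

end

theorem corollary3p5:
  fixes \<phi> :: "'a::cstar_algebra \<Rightarrow> 'b::cstar_algebra"
  assumes "completely_positive \<phi>"
    and "contractive \<phi>"
    and "order_zero \<phi>"
  shows "\<exists>!W :: 'a cuntz \<Rightarrow> 'b cuntz.
    ordered_semigroup_morphism W \<and>
    (\<forall>k\<ge>1. \<forall>a \<in> mat_pos k. W (cuntz_class a) = cuntz_class (map_mat \<phi> a))"
proof -
  interpret cpc_order_zero \<phi>
    by unfold_locales (rule assms)+
  define W :: "'a cuntz \<Rightarrow> 'b cuntz" where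
    "W x = cuntz_class (map_mat \<phi> (SOME a. a \<in> mat_inf_pos \<and> x = cuntz_class a))" for x
  \<comment> \<open>The choice of representative is harmless: two representatives lie below each
    other, and \<phi> preserves both comparisons.\<close>
  have W: "W (cuntz_class a) = cuntz_class (map_mat \<phi> a)" if a: "a \<in> mat_inf_pos" for a
  proof -
    define c where "c = (SOME c. c \<in> mat_inf_pos \<and> cuntz_class a = cuntz_class c)"
    have c: "c \<in> mat_inf_pos" "cuntz_class a = cuntz_class c"
      using someI[of "\<lambda>c. c \<in> mat_inf_pos \<and> cuntz_class a = cuntz_class c" a] a
      by (simp_all add: c_def)
    then have "cuntz_class (map_mat \<phi> a) = cuntz_class (map_mat \<phi> c)"
      using a by (simp add: cuntz_class_eq_iff map_mat_inf_pos cuntz_below_map_mat)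
    then show ?thesis
      by (simp add: W_def c_def)
  qed
  have plus: "W (x + y) = W x + W y" for x y
  proof -
    obtain a where a: "a \<in> mat_inf_pos" "x = cuntz_class a"
      by (rule cuntz_class_surj)
    obtain b where b: "b \<in> mat_inf_pos" "y = cuntz_class b"
      by (rule cuntz_class_surj)
    show ?thesis
      using a b by (simp add: cuntz_class_plus W mat_oplus_inf_pos map_mat_oplus map_mat_inf_pos)
  qed
  have mono: "W x \<le> W y" if "x \<le> y" for x y
    using that unfolding less_eq_cuntz_def using W map_mat_inf_pos cuntz_below_map_mat by metis
  show ?thesis
  proof (rule ex1I[of _ W])
    show "ordered_semigroup_morphism W \<and>
        (\<forall>k\<ge>1. \<forall>a \<in> mat_pos k. W (cuntz_class a) = cuntz_class (map_mat \<phi> a))"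
      using plus mono W mat_inf_posI unfolding ordered_semigroup_morphism_def by blast
  next
    fix V :: "'a cuntz \<Rightarrow> 'b cuntz"
    assume V: "ordered_semigroup_morphism V \<and>
        (\<forall>k\<ge>1. \<forall>a \<in> mat_pos k. V (cuntz_class a) = cuntz_class (map_mat \<phi> a))"
    show "V = W"
    proof
      fix x :: "'a cuntz"
      obtain a where a: "a \<in> mat_inf_pos" "x = cuntz_class a"
        by (rule cuntz_class_surj)
      obtain k where "k \<ge> 1" "a \<in> mat_pos k"
        using a(1) by (rule mat_inf_posE)
      then show "V x = W x"
        using V W[OF a(1)] a(2) by simp
    qed
  qed
qed

end
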